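(* Assume the Basor–Widom sine-kernel determinant asymptotics: for fixed real $\sigma<1$, as $s\to+\infty$, \[ \ln\det(I-\sigma K_s)=\frac{2s}\pi\ln(1-\sigma)+\frac{\ln^2(1-\sigma)}{2\pi^2}\ln(4s)+2\ln\bigl[\mathsf G(1+i\mathsf z)\mathsf G(1-i\mathsf z)\bigr]+O\!\Bigl(\frac{\ln s}{s}\Bigr),\qquad \mathsf z=\mathsf z(\sigma)=-\frac{\ln(1-\sigma)}{2\pi}, \] with error term uniform for $\sigma$ in compact subsets of $(-\infty,1)$. Fix $u>\ln2$ and set \[ a_u=e^{-2u}(1-e^{-2u}),\qquad b_u=e^{-u}(1-e^{-u}),\qquad\text{so that }0<a_u<b_u<\tfrac14 . \] Then for every $c_1$ with $0<c_1<\frac2{\pi^2}\bigl(u+\ln(1+e^{-u})\bigr)$ there is a finite $C_1$, depending on $u$ and on $c_1$, with \[ W_0(u,\ell)+W_1(u,\ell)\ \ge\ c_1\ln\ell-C_1\qquad(\ell\ge1). \] In particular the plunge has density $\gtrsim\frac1{\pi^2}$ per unit of depth on any compact depth range in $(\ln2,\infty)$.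
   Context: $K_s$ is the integral operator on $L^2(-1,1)$ with the sine kernel $\sin s(x-y)/(\pi(x-y))$; $\mathsf G$ is the Barnes $G$-function; $\det$ is the Fredholm determinant. Let $Q$ be the orthogonal projection of $L^2(\mathbb{R})$ onto functions with Fourier support in $(-\frac12,\frac12)$ (Fourier transform $\int f(x)e^{-2\pi i x\xi}dx$), i.e. the integral operator with kernel $\operatorname{sinc}(x-y)$, $\operatorname{sinc}(t)=\sin(\pi t)/(\pi t)$, $\operatorname{sinc}(0)=1$. For $\ell>0$ let $P$ be multiplication by the indicator of $(0,\ell)$ and $S_\ell=PQP$ on $L^2(0,\ell)$, with eigenvalues $1>\lambda_0(\ell)\ge\lambda_1(\ell)\ge\cdots>0$ (with multiplicity). For $u>0$, \[ W_0(u,\ell)=\#\{n:\lambda_n(\ell)\in(e^{-2u},e^{-u})\},\qquad W_1(u,\ell)=\#\{n:\lambda_n(\ell)\in(1-e^{-u},1-e^{-2u})\}. \] The plunge is the transition region of the spectrum of $S_\ell$, between the eigenvalues clustering at $1$ and those clustering at $0$. The depth of an eigenvalue $\lambda$ is $\ln\frac{1-\lambda}{\lambda}$ (positive below $\frac12$, negative above it); $W_0$ and $W_1$ are indexed by the magnitude $u$ of the depth, $W_0$ being regarded as counting depths in $(u,2u)$ and $W_1$ the reflected depths in $(-2u,-u)$. In the last sentence of the claim, density means the eigenvalue count relative to $\ln\ell$, counted through the symmetric pair $W_0+W_1$. *)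

theory Defs
  imports "HOL-Analysis.Analysis" "Jordan_Normal_Form.Determinant"
begin

text \<open>Square-integrable functions are used as representatives of their classes modulo
  null sets; equality and linear independence in \<open>L\<^sup>2\<close> are therefore taken almost everywhere.\<close>

definition L2 :: "real measure \<Rightarrow> (real \<Rightarrow> complex) set" where
  "L2 M = {f \<in> borel_measurable M. integrable M (\<lambda>x. (cmod (f x))\<^sup>2)}"

definition L2_independent :: "real measure \<Rightarrow> nat \<Rightarrow> (nat \<Rightarrow> real \<Rightarrow> complex) \<Rightarrow> bool" where
  "L2_independent M k \<phi> \<longleftrightarrow>
     (\<forall>c. (AE x in M. (\<Sum>i<k. c i * \<phi> i x) = 0) \<longrightarrow> (\<forall>i<k. c i = 0))"

text \<open>Complex dimension of the image of \<open>V\<close> in \<open>L\<^sup>2\<close>. Meaningful only when this is finite (the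
  supremum of an unbounded set of naturals is unspecified), as is the case for the eigenspaces
  below: the operator is compact and the eigenvalue nonzero.\<close>

definition L2_dim :: "real measure \<Rightarrow> (real \<Rightarrow> complex) set \<Rightarrow> nat" where
  "L2_dim M V = Sup {k. \<exists>\<phi>. (\<forall>i<k. \<phi> i \<in> V) \<and> L2_independent M k \<phi>}"

definition interval_measure_on :: "real \<Rightarrow> real \<Rightarrow> real measure" where
  "interval_measure_on a b = restrict_space lborel {a<..<b}"

definition nsinc :: "real \<Rightarrow> real" where
  "nsinc t = (if t = 0 then 1 else sin (pi * t) / (pi * t))"

definition Q_op :: "(real \<Rightarrow> complex) \<Rightarrow> real \<Rightarrow> complex" where
  "Q_op f x = (LINT y|lborel. of_real (nsinc (x - y)) * f y)"

definition P_op :: "real \<Rightarrow> (real \<Rightarrow> complex) \<Rightarrow> real \<Rightarrow> complex" where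
  "P_op l f x = (if x \<in> {0<..<l} then f x else 0)"

definition S_op :: "real \<Rightarrow> (real \<Rightarrow> complex) \<Rightarrow> real \<Rightarrow> complex" where
  "S_op l f = P_op l (Q_op (P_op l f))"

definition S_eigenspace :: "real \<Rightarrow> real \<Rightarrow> (real \<Rightarrow> complex) set" where
  "S_eigenspace l \<mu> =
     {f \<in> L2 (interval_measure_on 0 l).
        AE x in interval_measure_on 0 l. S_op l f x = of_real \<mu> * f x}"

definition S_multiplicity :: "real \<Rightarrow> real \<Rightarrow> nat" where
  "S_multiplicity l \<mu> = L2_dim (interval_measure_on 0 l) (S_eigenspace l \<mu>)"

text \<open>The number of indices \<open>n\<close> with \<open>\<lambda>\<^sub>n(l) \<in> I\<close>, where \<open>\<lambda>\<^sub>n(l)\<close> lists the eigenvalues of \<open>S_op l\<close>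
  repeated according to multiplicity. The index set of the sum is finite
  when \<open>I\<close> is bounded away from \<open>0\<close>.\<close>

definition S_count :: "real \<Rightarrow> real set \<Rightarrow> nat" where
  "S_count l I = (\<Sum>\<mu> | \<mu> \<in> I \<and> S_multiplicity l \<mu> > 0. S_multiplicity l \<mu>)"

definition W0 :: "real \<Rightarrow> real \<Rightarrow> nat" where
  "W0 u l = S_count l {exp (- 2 * u) <..< exp (- u)}"

definition W1 :: "real \<Rightarrow> real \<Rightarrow> nat" where
  "W1 u l = S_count l {1 - exp (- u) <..< 1 - exp (- 2 * u)}"

definition sine_kernel :: "real \<Rightarrow> real \<Rightarrow> real \<Rightarrow> real" where
  "sine_kernel s x y = (if x = y then s / pi else sin (s * (x - y)) / (pi * (x - y)))"

text \<open>Fredholm's series for \<open>det (I - \<sigma> K)\<close>, with \<open>K\<close> the integral operator on \<open>L\<^sup>2(a,b)\<close> with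
  the given kernel. The term for \<open>n = 0\<close> is \<open>1\<close>.\<close>

definition fredholm_det :: "real \<Rightarrow> real \<Rightarrow> (real \<Rightarrow> real \<Rightarrow> real) \<Rightarrow> real \<Rightarrow> real" where
  "fredholm_det a b K \<sigma> =
     (\<Sum>n. (- \<sigma>) ^ n / fact n *
        (LINT x|Pi\<^sub>M {..<n} (\<lambda>_. interval_measure_on a b).
           Determinant.det (Matrix.mat n n (\<lambda>(i, j). K (x i) (x j)))))"

text \<open>The Weierstrass product of the Barnes \<open>G\<close>-function, usually stated for \<open>G(1 + w)\<close>.\<close>

definition Barnes_G :: "complex \<Rightarrow> complex" where
  "Barnes_G z =
     (let w = z - 1 in
        of_real (2 * pi) powr (w / 2) *
        exp (- (w + w\<^sup>2 * (1 + euler_mascheroni)) / 2) *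
        (\<Prod>k. (1 + w / of_nat (Suc k)) ^ Suc k * exp (w\<^sup>2 / (2 * of_nat (Suc k)) - w)))"

definition bw_z :: "real \<Rightarrow> real" where
  "bw_z \<sigma> = - ln (1 - \<sigma>) / (2 * pi)"

text \<open>The argument of the complex logarithm is a positive real number, since
  \<open>G(1 - \<i>z)\<close> is conjugate to \<open>G(1 + \<i>z)\<close> and \<open>z\<close> is real.\<close>

definition bw_main :: "real \<Rightarrow> real \<Rightarrow> complex" where
  "bw_main s \<sigma> =
     of_real (2 * s / pi * ln (1 - \<sigma>) + (ln (1 - \<sigma>))\<^sup>2 / (2 * pi\<^sup>2) * ln (4 * s)) +
     2 * Ln (Barnes_G (1 + \<i> * of_real (bw_z \<sigma>)) * Barnes_G (1 - \<i> * of_real (bw_z \<sigma>)))"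

end

theory Submission
  imports Defs "HOL-Complex_Analysis.Great_Picard" "HOL-Real_Asymp.Real_Asymp"
begin

text \<open>
  Put \<open>h\<^sub>n = \<lambda>\<^sub>n (1 - \<lambda>\<^sub>n)\<close>. Since \<open>e\<^sup>-\<^sup>u < 1/2\<close>, an eigenvalue lies in one of the two
  windows defining \<open>W0\<close> and \<open>W1\<close> exactly when \<open>h\<^sub>n\<close> lies strictly between \<open>a\<^sub>u\<close> and \<open>b\<^sub>u\<close>, so
  the theorem is about the distribution of the numbers \<open>h\<^sub>n\<close>.

  The symmetric pair is what makes the determinant asymptotics usable with real \<open>\<sigma>\<close>. Take
  \<open>1 - \<sigma> = e\<^sup>v\<close> and \<open>1 - \<sigma>' = e\<^sup>-\<^sup>v\<close>. Then
  \<open>(1 - \<sigma>\<lambda>)(1 - \<sigma>'\<lambda>) = 1 + t \<lambda>(1 - \<lambda>)\<close> with \<open>t = e\<^sup>v + e\<^sup>-\<^sup>v - 2\<close>, and in the sum of the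
  two logarithmic determinants the terms linear in \<open>s\<close> cancel. What remains is
  \<open>\<Sum>\<^sub>n ln (1 + t h\<^sub>n) = (v\<^sup>2 / \<pi>\<^sup>2) ln s + O(1)\<close> for each fixed \<open>t > 0\<close>; the Barnes factors
  go into the bounded term.

  On the other hand \<open>v\<^sup>2 = \<integral>\<^sub>0\<^sup>1 ln (1 + t x(1 - x)) / (x(1 - x)) dx\<close>. Dividing by \<open>ln s\<close>, the
  measures \<open>\<Sum>\<^sub>n h\<^sub>n \<delta>(h\<^sub>n) / ln s\<close> and the image of \<open>dx / \<pi>\<^sup>2\<close> under \<open>x \<mapsto> x(1 - x)\<close> agree in the
  limit on the functions \<open>y \<mapsto> ln (1 + t y) / y\<close>. The closed span of these functions contains all
  powers of \<open>y\<close>, as one sees by letting \<open>t\<close> tend to \<open>0\<close>, hence all continuous functions on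
  \<open>[0, 1/4]\<close>. Weak convergence tested on a trapezoid supported in the window gives the count,
  and the density \<open>2 / \<pi>\<^sup>2\<close> times a difference of logits is \<open>(2 / \<pi>\<^sup>2) (u + ln (1 + e\<^sup>-\<^sup>u))\<close>.
  Because the trapezoid may be chosen inside the windows of all nearby \<open>u\<close> at once, a finite cover
  makes the bound uniform on a compact set of depths.

  Behind this stands the spectral theory of the sine kernel. The theorem \<open>mercer_expansion\<close>
  expands a continuous positive kernel in eigenfunctions, \<open>mercer_fredholm_det\<close> turns Fredholm's
  series into the product of the \<open>1 - \<sigma>\<lambda>\<^sub>n\<close>, \<open>sine_kernel_eigenvalue_le_1\<close> bounds the
  eigenvalues by \<open>1\<close>, and \<open>S_count_eq\<close> identifies the multiplicities of the operator on
  \<open>(0, l)\<close> with those in the expansion. The theorem \<open>plunge_count\<close> is the weak convergence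
  argument.
\<close>

section \<open>Integration over a bounded interval\<close>

lemma space_interval_measure [simp]: "space (interval_measure_on a b) = {a<..<b}"
  by (simp add: interval_measure_on_def space_restrict_space)

lemma finite_interval_measure: "finite_measure (interval_measure_on a b)"
proof (rule finite_measureI)
  have "emeasure (interval_measure_on a b) {a<..<b} = emeasure lborel {a<..<b}"
    unfolding interval_measure_on_def by (subst emeasure_restrict_space) auto
  also have "\<dots> \<noteq> \<infinity>"
    by (cases "a \<le> b") auto
  finally show "emeasure (interval_measure_on a b) (space (interval_measure_on a b)) \<noteq> \<infinity>"
    by simp
qed

lemma integrable_interval_measure_iff:
  fixes f :: "real \<Rightarrow> 'a::{banach, second_countable_topology}"
  shows "integrable (interval_measure_on a b) f \<longleftrightarrow> set_integrable lborel {a<..<b} f"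
  unfolding interval_measure_on_def set_integrable_def
  by (subst integrable_restrict_space) auto

lemma integral_interval_measure:
  fixes f :: "real \<Rightarrow> 'a::{banach, second_countable_topology}"
  shows "integral\<^sup>L (interval_measure_on a b) f = (LINT x:{a<..<b}|lborel. f x)"
  unfolding interval_measure_on_def set_lebesgue_integral_def
  by (subst integral_restrict_space) auto

lemma integrable_interval_measure:
  fixes f :: "real \<Rightarrow> 'a::{banach, second_countable_topology}"
  assumes "continuous_on {a..b} f"
  shows "integrable (interval_measure_on a b) f"
  unfolding integrable_interval_measure_iff
  by (rule set_integrable_subset[OF borel_integrable_atLeastAtMost'[OF assms]]) auto

lemma integral_interval_measure_HK:
  fixes f :: "real \<Rightarrow> 'a::euclidean_space"
  assumes "continuous_on {a..b} f"
  shows "integral\<^sup>L (interval_measure_on a b) f = integral {a..b} f"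
proof -
  have "set_integrable lborel {a<..<b} f"
    by (rule set_integrable_subset[OF borel_integrable_atLeastAtMost'[OF assms]]) auto
  from set_borel_integral_eq_integral(2)[OF this]
  show ?thesis
    by (simp add: integral_interval_measure integral_open_interval_real)
qed

lemma measure_interval_measure:
  "a \<le> b \<Longrightarrow> measure (interval_measure_on a b) (space (interval_measure_on a b)) = b - a"
  unfolding interval_measure_on_def measure_def
  by (subst emeasure_restrict_space) (auto simp: space_restrict_space)

lemma interval_measure_zero_imp_zero:
  fixes f :: "real \<Rightarrow> real"
  assumes "a < b" "continuous_on {a..b} f" "\<And>x. x \<in> {a..b} \<Longrightarrow> 0 \<le> f x"
    "integral\<^sup>L (interval_measure_on a b) f = 0" "x \<in> {a..b}"
  shows "f x = 0"
proof -
  have "integral (cbox a b) f = 0"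
    using integral_interval_measure_HK[OF assms(2)] assms(4) by simp
  then show ?thesis
    using integral_eq_0_iff[of a b f] assms by auto
qed

lemma integral_interval_measure_cont:
  fixes f :: "real \<Rightarrow> real"
  assumes "continuous_on UNIV f"
  shows "integral\<^sup>L (interval_measure_on a b) f = integral (cbox a b) f"
  using integral_interval_measure_HK[OF continuous_on_subset[OF assms subset_UNIV]] by simp

lemma kernel_compose:
  fixes K :: "real \<Rightarrow> real \<Rightarrow> real" and f g :: "'a::topological_space \<Rightarrow> real"
  assumes "continuous_on UNIV (\<lambda>p. K (fst p) (snd p))"
    "continuous_on S f" "continuous_on S g"
  shows "continuous_on S (\<lambda>x. K (f x) (g x))"
  using continuous_on_compose2[OF assms(1) continuous_on_Pair[OF assms(2,3)] subset_UNIV]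
  unfolding fst_conv snd_conv .

lemma kernel_row:
  fixes K :: "real \<Rightarrow> real \<Rightarrow> real"
  assumes "continuous_on UNIV (\<lambda>p. K (fst p) (snd p))"
  shows "continuous_on UNIV (K x)"
  by (rule kernel_compose[of K UNIV "\<lambda>_. x" "\<lambda>y. y", OF assms continuous_on_const continuous_on_id])

lemma param_cont:
  fixes F :: "real \<Rightarrow> real \<Rightarrow> real"
  assumes "continuous_on UNIV (\<lambda>p. F (fst p) (snd p))"
  shows "continuous_on UNIV (\<lambda>x. LINT y|interval_measure_on a b. F x y)"
proof -
  have "(\<lambda>x. LINT y|interval_measure_on a b. F x y) = (\<lambda>x. integral (cbox a b) (F x))"
    by (intro ext integral_interval_measure_cont kernel_compose[OF assms] continuous_on_const continuous_on_id)
  moreover have "continuous_on UNIV (\<lambda>x. integral (cbox a b) (F x))"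
    by (rule integral_continuous_on_param)
       (use continuous_on_subset[OF assms subset_UNIV] in \<open>simp add: case_prod_beta'\<close>)
  ultimately show ?thesis by (simp only:)
qed

lemma cont_fst:
  fixes f :: "real \<Rightarrow> real"
  assumes "continuous_on UNIV f"
  shows "continuous_on UNIV (\<lambda>p. f (fst p))"
  by (rule continuous_on_compose2[OF assms continuous_on_fst[OF continuous_on_id] subset_UNIV])

lemma cont_snd:
  fixes f :: "real \<Rightarrow> real"
  assumes "continuous_on UNIV f"
  shows "continuous_on UNIV (\<lambda>p. f (snd p))"
  by (rule continuous_on_compose2[OF assms continuous_on_snd[OF continuous_on_id] subset_UNIV])

lemma interval_measure_swap:
  fixes F :: "real \<Rightarrow> real \<Rightarrow> real"
  assumes F: "continuous_on UNIV (\<lambda>p. F (fst p) (snd p))"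
  shows "(LINT x|interval_measure_on a b. LINT y|interval_measure_on c d. F x y)
       = (LINT y|interval_measure_on c d. LINT x|interval_measure_on a b. F x y)"
proof -
  have F': "continuous_on UNIV (\<lambda>p. F (snd p) (fst p))"
    using continuous_on_compose2[OF F continuous_on_swap] by (simp add: prod.swap_def)
  have 1: "(LINT y|interval_measure_on c d. F x y) = integral (cbox c d) (F x)" for x
    by (rule integral_interval_measure_cont[OF kernel_row[OF F]])
  have 2: "(LINT x|interval_measure_on a b. F x y) = integral (cbox a b) (\<lambda>x. F x y)" for y
    by (rule integral_interval_measure_cont[OF kernel_row[of "\<lambda>y x. F x y", OF F']])
  have "(LINT x|interval_measure_on a b. LINT y|interval_measure_on c d. F x y)
      = integral (cbox a b) (\<lambda>x. integral (cbox c d) (F x))"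
    unfolding 1[symmetric] by (rule integral_interval_measure_cont[OF param_cont[OF F]])
  also have "\<dots> = integral (cbox c d) (\<lambda>y. integral (cbox a b) (\<lambda>x. F x y))"
    by (rule integral_swap_continuous)
       (use continuous_on_subset[OF F subset_UNIV] in \<open>simp add: case_prod_beta'\<close>)
  also have "\<dots> = (LINT y|interval_measure_on c d. LINT x|interval_measure_on a b. F x y)"
    unfolding 2[symmetric]
    by (rule integral_interval_measure_cont[OF param_cont[of "\<lambda>y x. F x y", OF F'], symmetric])
  finally show ?thesis .
qed

text \<open>The polynomial in \<open>t\<close> will be the value of a positive quadratic form at \<open>f + t g\<close>; all
Cauchy--Schwarz inequalities below are obtained in this way.\<close>

lemma discriminant_le:
  fixes x y z :: real
  assumes "\<And>t. x + 2 * t * y + t\<^sup>2 * z \<ge> 0" "z \<ge> 0"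
  shows "y\<^sup>2 \<le> x * z"
proof (cases "z = 0")
  case True
  have "y = 0"
  proof (rule ccontr)
    assume "y \<noteq> 0"
    with assms(1)[of "- (x + 1) / (2 * y)"] True show False
      by (simp add: field_simps)
  qed
  then show ?thesis using True by simp
next
  case False
  with assms have z: "z > 0" by simp
  have "x + 2 * (- y / z) * y + (- y / z)\<^sup>2 * z = x - y\<^sup>2 / z"
    using z by (simp add: power2_eq_square field_simps)
  with assms(1)[of "- y / z"] have "y\<^sup>2 / z \<le> x" by simp
  with z show ?thesis by (simp add: field_simps)
qed

lemma seq_squeeze:
  fixes f g h :: "nat \<Rightarrow> real"
  assumes "\<And>n. f n \<le> g n" "\<And>n. g n \<le> h n" "f \<longlonglongrightarrow> c" "h \<longlonglongrightarrow> c"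
  shows "g \<longlonglongrightarrow> c"
  by (rule tendsto_sandwich[OF _ _ assms(3,4)]) (simp_all add: assms(1,2))

section \<open>Positive kernels\<close>

text \<open>Functions are continuous on the whole line although only their restriction to \<open>{a..b}\<close> matters.
An eigenfunction \<open>\<phi> = K \<phi> / \<mu>\<close> is given by an integral that makes sense everywhere, so nothing
is lost, and no domain has to be carried along.\<close>

locale real_interval =
  fixes a b :: real
  assumes ab: "a < b"
begin

abbreviation M where "M \<equiv> interval_measure_on a b"

abbreviation cont :: "(real \<Rightarrow> real) \<Rightarrow> bool" where "cont \<equiv> continuous_on UNIV"

definition ip :: "(real \<Rightarrow> real) \<Rightarrow> (real \<Rightarrow> real) \<Rightarrow> real" where
  "ip f g = (LINT x|M. f x * g x)"

definition kop :: "(real \<Rightarrow> real \<Rightarrow> real) \<Rightarrow> (real \<Rightarrow> real) \<Rightarrow> real \<Rightarrow> real" where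
  "kop K f x = (LINT y|M. K x y * f y)"

text \<open>Positivity is tested against continuous functions and not on finite sets of points, because in this
form it passes to the deflated kernels; the pointwise consequences are recovered in
\<open>psd_diag\<close>.\<close>

definition psd :: "(real \<Rightarrow> real \<Rightarrow> real) \<Rightarrow> bool" where
  "psd K \<longleftrightarrow> continuous_on UNIV (\<lambda>p. K (fst p) (snd p)) \<and> (\<forall>x y. K x y = K y x) \<and>
     (\<forall>f. cont f \<longrightarrow> 0 \<le> ip (kop K f) f)"

lemma cont_integrable:
  fixes f :: "real \<Rightarrow> 'a::{banach, second_countable_topology}"
  shows "continuous_on UNIV f \<Longrightarrow> integrable M f"
  by (rule integrable_interval_measure[OF continuous_on_subset[OF _ subset_UNIV]])

lemma cont_measurable:
  fixes f :: "real \<Rightarrow> 'a::{banach, second_countable_topology}"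
  shows "continuous_on UNIV f \<Longrightarrow> f \<in> borel_measurable M"
  by (rule borel_measurable_integrable[OF cont_integrable])

lemma cont_bounded:
  assumes "cont g"
  obtains B where "0 \<le> B" "\<And>x. x \<in> {a..b} \<Longrightarrow> \<bar>g x\<bar> \<le> B"
proof -
  have "bounded (g ` {a..b})"
    by (intro compact_imp_bounded compact_continuous_image continuous_on_subset[OF assms]) auto
  then obtain B where "\<forall>y\<in>g ` {a..b}. norm y \<le> B" unfolding bounded_iff by blast
  then have B: "\<bar>g x\<bar> \<le> B" if "x \<in> {a..b}" for x using that by simp
  moreover have "0 \<le> B" using B[of a] ab by simp
  ultimately show ?thesis by (intro that)
qed

lemma ip_commute: "ip f g = ip g f"
  by (simp add: ip_def mult.commute)

lemma ip_add:
  assumes "cont f" "cont g" "cont h"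
  shows "ip (\<lambda>x. f x + g x) h = ip f h + ip g h"
  unfolding ip_def
  by (simp add: distrib_right cont_integrable assms continuous_on_mult)

lemma ip_scale: "ip (\<lambda>x. c * f x) h = c * ip f h"
  unfolding ip_def by (simp add: mult.assoc)

lemma ip_diff:
  assumes "cont f" "cont g" "cont h"
  shows "ip (\<lambda>x. f x - g x) h = ip f h - ip g h"
  unfolding ip_def
  by (simp add: left_diff_distrib cont_integrable assms continuous_on_mult)

lemma ip_nonneg: "0 \<le> ip f f"
  unfolding ip_def by (intro Bochner_Integration.integral_nonneg) auto

lemma ip_cong: "(\<And>x. x \<in> {a<..<b} \<Longrightarrow> f x = f' x) \<Longrightarrow> (\<And>x. x \<in> {a<..<b} \<Longrightarrow> g x = g' x) \<Longrightarrow> ip f g = ip f' g'"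
  unfolding ip_def by (intro Bochner_Integration.integral_cong) auto

lemma ip_expand:
  assumes f: "cont f" and g: "cont g"
  shows "ip (\<lambda>x. f x + t * g x) (\<lambda>x. f x + t * g x) = ip f f + 2 * t * ip f g + t\<^sup>2 * ip g g"
proof -
  let ?h = "\<lambda>x. f x + t * g x"
  have tg: "cont (\<lambda>x. t * g x)" using g by (rule continuous_on_mult_left)
  have h: "cont ?h" by (rule continuous_on_add[OF f tg])
  have 1: "ip ?h k = ip f k + t * ip g k" if "cont k" for k
    by (simp add: ip_add[OF f tg that] ip_scale)
  have "ip ?h ?h = ip f ?h + t * ip g ?h" by (rule 1[OF h])
  also have "ip f ?h = ip f f + t * ip f g"
    using 1[OF f] ip_commute[of f ?h] ip_commute[of g f] by simp
  also have "ip g ?h = ip f g + t * ip g g"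
    using 1[OF g] ip_commute[of g ?h] ip_commute[of g f] by simp
  finally show ?thesis by (simp add: algebra_simps power2_eq_square)
qed

lemma ip_CS:
  assumes "cont f" "cont g"
  shows "(ip f g)\<^sup>2 \<le> ip f f * ip g g"
proof (rule discriminant_le)
  show "0 \<le> ip f f + 2 * t * ip f g + t\<^sup>2 * ip g g" for t
    using ip_nonneg[of "\<lambda>x. f x + t * g x"] by (simp only: ip_expand[OF assms])
qed (rule ip_nonneg)

lemma ip_eq_0:
  assumes "cont f" "ip f f = 0" "x \<in> {a..b}"
  shows "f x = 0"
proof -
  have "continuous_on {a..b} (\<lambda>x. f x * f x)"
    by (rule continuous_on_subset[OF continuous_on_mult[OF assms(1) assms(1)]]) simp
  moreover have "0 \<le> f x * f x" for x
    by simp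
  ultimately have "f x * f x = 0"
    using assms(2,3) unfolding ip_def by (intro interval_measure_zero_imp_zero[OF ab, where f = "\<lambda>x. f x * f x"])
  then show ?thesis by simp
qed

lemma kop_ip: "kop K f x = ip (K x) f"
  by (simp add: kop_def ip_def)

lemma kop_cont:
  assumes "continuous_on UNIV (\<lambda>p. K (fst p) (snd p))" "cont f"
  shows "cont (kop K f)"
  unfolding kop_def
  by (rule param_cont[of "\<lambda>x y. K x y * f y", OF continuous_on_mult[OF assms(1) cont_snd[OF assms(2)]]])

lemma kop_sym:
  assumes K: "continuous_on UNIV (\<lambda>p. K (fst p) (snd p))" and sym: "\<And>x y. K x y = K y x"
    and f: "cont f" and g: "cont g"
  shows "ip (kop K f) g = ip f (kop K g)"
proof -
  have "ip (kop K f) g = (LINT x|M. LINT y|M. K x y * f y * g x)"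
    by (simp add: ip_def kop_def)
  also have "\<dots> = (LINT y|M. LINT x|M. K x y * f y * g x)"
    by (rule interval_measure_swap) (intro continuous_on_mult K cont_fst cont_snd f g)
  also have "\<dots> = (LINT y|M. LINT x|M. f y * (K y x * g x))"
    by (intro Bochner_Integration.integral_cong refl, subst sym) (simp only: mult_ac)
  also have "\<dots> = ip f (kop K g)"
    by (simp add: ip_def kop_def)
  finally show ?thesis .
qed

abbreviation kcont :: "(real \<Rightarrow> real \<Rightarrow> real) \<Rightarrow> bool" where
  "kcont K \<equiv> continuous_on UNIV (\<lambda>p. K (fst p) (snd p))"

lemma ip_bilin:
  assumes "cont p" "cont q" "cont r" "cont s"
  shows "ip (\<lambda>x. p x + t * q x) (\<lambda>x. r x + u * s x) = ip p r + u * ip p s + t * ip q r + t * u * ip q s"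
proof -
  have 1: "ip (\<lambda>x. f x + c * g x) k = ip f k + c * ip g k" if "cont f" "cont g" "cont k" for f g k c
    by (simp add: ip_add[OF that(1) continuous_on_mult_left[OF that(2)] that(3)] ip_scale)
  have 2: "ip k (\<lambda>x. f x + c * g x) = ip k f + c * ip k g" if "cont f" "cont g" "cont k" for f g k c
    using 1[OF that] by (simp only: ip_commute[of k])
  have "cont (\<lambda>x. r x + u * s x)"
    by (rule continuous_on_add[OF assms(3) continuous_on_mult_left[OF assms(4)]])
  then show ?thesis
    by (simp add: 1 2 assms algebra_simps)
qed

lemma kop_lin:
  assumes "kcont K" "cont f" "cont g"
  shows "kop K (\<lambda>x. f x + t * g x) x = kop K f x + t * kop K g x"
proof -
  have "ip (K x) (\<lambda>x. f x + t * g x) = ip (\<lambda>x. f x + t * g x) (K x)"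
    by (rule ip_commute)
  also have "\<dots> = ip f (K x) + t * ip g (K x)"
    by (simp add: ip_add[OF assms(2) continuous_on_mult_left[OF assms(3)] kernel_row[OF assms(1)]] ip_scale)
  finally show ?thesis
    by (simp add: kop_ip ip_commute[of "K x"])
qed

lemma kop_cong:
  assumes "\<And>x. x \<in> {a<..<b} \<Longrightarrow> f x = f' x"
  shows "kop K f x = kop K f' x"
  unfolding kop_ip by (rule ip_cong) (auto simp: assms)

lemma kop_scale: "kop K (\<lambda>x. c * f x) x = c * kop K f x"
  unfolding kop_ip by (simp add: ip_commute[of "K x"] ip_scale)

lemma kop_sq_le:
  assumes "kcont K" "cont f"
  shows "(kop K f x)\<^sup>2 \<le> ip (K x) (K x) * ip f f"
  unfolding kop_ip by (rule ip_CS[OF kernel_row[OF assms(1)] assms(2)])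

lemma psdD:
  assumes "psd K"
  shows "kcont K" "K x y = K y x" "cont f \<Longrightarrow> 0 \<le> ip (kop K f) f"
  using assms unfolding psd_def by blast+

lemma psd_CS:
  assumes K: "psd K" and f: "cont f" and g: "cont g"
  shows "(ip (kop K f) g)\<^sup>2 \<le> ip (kop K f) f * ip (kop K g) g"
proof (rule discriminant_le)
  fix t :: real
  note kc = psdD(1)[OF K]
  let ?h = "\<lambda>x. f x + t * g x"
  have "cont ?h" by (rule continuous_on_add[OF f continuous_on_mult_left[OF g]])
  then have "0 \<le> ip (kop K ?h) ?h" by (rule psdD(3)[OF K])
  also have "kop K ?h = (\<lambda>x. kop K f x + t * kop K g x)"
    by (rule ext, rule kop_lin[OF kc f g])
  also have "ip (kop K g) f = ip (kop K f) g"
    using kop_sym[OF kc psdD(2)[OF K] g f] ip_commute[of g] by simp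
  then have "ip (\<lambda>x. kop K f x + t * kop K g x) ?h
     = ip (kop K f) f + 2 * t * ip (kop K f) g + t\<^sup>2 * ip (kop K g) g"
    by (subst ip_bilin[OF kop_cont[OF kc f] kop_cont[OF kc g] f g])
       (simp add: power2_eq_square)
  finally show "0 \<le> ip (kop K f) f + 2 * t * ip (kop K f) g + t\<^sup>2 * ip (kop K g) g" .
qed (rule psdD(3)[OF K g])

text \<open>Cauchy--Schwarz for the form of \<open>K\<close>, applied to \<open>f\<close> and \<open>K f\<close>, bounds the operator by its form.
It turns a maximising sequence into a sequence of approximate eigenvectors.\<close>

lemma kop_norm_le:
  assumes K: "psd K" and le: "\<And>f. cont f \<Longrightarrow> ip (kop K f) f \<le> \<mu> * ip f f" and f: "cont f"
    and mu: "0 \<le> \<mu>"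
  shows "ip (kop K f) (kop K f) \<le> \<mu> * ip (kop K f) f"
proof -
  let ?g = "kop K f"
  have g: "cont ?g" by (rule kop_cont[OF psdD(1)[OF K] f])
  have q: "0 \<le> ip ?g f" by (rule psdD(3)[OF K f])
  have "(ip ?g ?g)\<^sup>2 \<le> ip ?g f * ip (kop K ?g) ?g"
    by (rule psd_CS[OF K f g])
  also have "\<dots> \<le> ip ?g f * (\<mu> * ip ?g ?g)"
    by (rule mult_left_mono[OF le[OF g] q])
  finally have "ip ?g ?g * ip ?g ?g \<le> (\<mu> * ip ?g f) * ip ?g ?g"
    by (simp add: power2_eq_square mult_ac)
  then show ?thesis
    using ip_nonneg[of ?g] mu q
    by (cases "ip ?g ?g = 0") (simp, metis mult_right_le_imp_le order_le_less)
qed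

text \<open>The supremum \<open>\<mu>\<close> of the form over unit functions is attained. For a maximising sequence \<open>F\<^sub>n\<close> one has
\<open>\<parallel>K F\<^sub>n - \<mu> F\<^sub>n\<parallel>\<^sup>2 \<le> \<mu> (\<mu> - \<langle>K F\<^sub>n, F\<^sub>n\<rangle>)\<close>, which tends to \<open>0\<close>, and the functions \<open>K F\<^sub>n\<close> are
equicontinuous, so that a subsequence of them converges uniformly by the theorem of Arzela and Ascoli;
the limit is an eigenfunction. The conventional pair \<open>\<mu> = 0\<close>, \<open>\<phi> = 0\<close> is returned when the form
vanishes, so that a finite spectrum needs no separate treatment later.\<close>

lemma psd_maximizer:
  assumes K: "psd K"
  obtains \<mu> \<phi> where "cont \<phi>" "0 \<le> \<mu>" "\<And>x. kop K \<phi> x = \<mu> * \<phi> x" "\<mu> = 0 \<Longrightarrow> \<phi> = (\<lambda>_. 0)"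
    "\<mu> \<noteq> 0 \<Longrightarrow> ip \<phi> \<phi> = 1" "\<And>f. cont f \<Longrightarrow> ip (kop K f) f \<le> \<mu> * ip f f"
proof -
  note kc = psdD(1)[OF K]
  define k2 where "k2 x = ip (K x) (K x)" for x
  have k2: "cont k2"
    unfolding k2_def ip_def by (rule param_cont[of "\<lambda>x y. K x y * K x y", OF continuous_on_mult[OF kc kc]])
  obtain C where "\<And>x. x \<in> {a..b} \<Longrightarrow> \<bar>k2 x\<bar> \<le> C" by (rule cont_bounded[OF k2]) (rule that)
  then have C: "k2 x \<le> C" if "x \<in> {a..b}" for x using that by (simp add: abs_le_iff)
  define B where "B = (LINT x|M. k2 x)"
  have kop2: "ip (kop K f) (kop K f) \<le> B * ip f f" if f: "cont f" for f
  proof -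
    have "ip (kop K f) (kop K f) \<le> (LINT x|M. k2 x * ip f f)"
      unfolding ip_def[of "kop K f"]
    proof (rule integral_mono)
      show "integrable M (\<lambda>x. kop K f x * kop K f x)"
        by (intro cont_integrable continuous_on_mult kop_cont[OF kc f])
      show "integrable M (\<lambda>x. k2 x * ip f f)"
        by (intro cont_integrable continuous_on_mult_right k2)
      show "kop K f x * kop K f x \<le> k2 x * ip f f" for x
        using kop_sq_le[OF kc f, of x] by (simp add: k2_def power2_eq_square)
    qed
    then show ?thesis by (simp add: B_def)
  qed
  define S where "S = {ip (kop K f) f | f. cont f \<and> ip f f = 1}"
  define \<mu> where "\<mu> = Sup S"
  have bdd: "bdd_above S"
  proof (rule bdd_aboveI)
    fix v assume "v \<in> S"
    then obtain f where f: "cont f" "ip f f = 1" "v = ip (kop K f) f" by (auto simp: S_def)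
    have "v\<^sup>2 \<le> ip (kop K f) (kop K f) * ip f f"
      unfolding f(3) by (rule ip_CS[OF kop_cont[OF kc f(1)] f(1)])
    also have "\<dots> \<le> B" using kop2[OF f(1)] f(2) by simp
    finally show "v \<le> 1 + B"
      using zero_le_power2[of "v - 1"] zero_le_power2[of v] unfolding power2_diff power_one by linarith
  qed
  have ne: "S \<noteq> {}"
  proof -
    have "ip (\<lambda>_. 1 / sqrt (b - a)) (\<lambda>_. 1 / sqrt (b - a)) = 1"
      using ab measure_interval_measure[of a b] by (simp add: ip_def field_simps)
    then show ?thesis unfolding S_def using continuous_on_const by blast
  qed
  have unit_le: "ip (kop K f) f \<le> \<mu>" if "cont f" "ip f f = 1" for f
    unfolding \<mu>_def by (rule cSup_upper[OF _ bdd]) (use that in \<open>auto simp: S_def\<close>)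
  have mu0: "0 \<le> \<mu>"
  proof -
    obtain f where "cont f" "ip f f = 1" using ne by (auto simp: S_def)
    then show ?thesis using unit_le[of f] psdD(3)[OF K, of f] by simp
  qed
  have le: "ip (kop K f) f \<le> \<mu> * ip f f" if f: "cont f" for f
  proof (cases "ip f f = 0")
    case True
    have "(ip (kop K f) f)\<^sup>2 \<le> 0"
      using ip_CS[OF kop_cont[OF kc f] f] True by simp
    then show ?thesis using True by simp
  next
    case False
    with ip_nonneg[of f] have p: "ip f f > 0" by simp
    define c where "c = 1 / sqrt (ip f f)"
    have c2: "c * c * ip f f = 1" using p by (simp add: c_def)
    let ?g = "\<lambda>x. c * f x"
    have "ip ?g ?g = c * c * ip f f"
      by (simp add: ip_scale ip_commute[of f "\<lambda>x. c * f x"])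
    with c2 have "ip (kop K ?g) ?g \<le> \<mu>"
      by (intro unit_le continuous_on_mult_left f) simp
    also have "kop K ?g = (\<lambda>x. c * kop K f x)" by (rule ext, rule kop_scale)
    also have "ip (\<lambda>x. c * kop K f x) ?g = c * c * ip (kop K f) f"
      by (simp add: ip_scale ip_commute[of _ "\<lambda>x. c * f x"] ip_commute[of f])
    finally have "(c * c * ip (kop K f) f) * ip f f \<le> \<mu> * ip f f"
      by (rule mult_right_mono) (rule ip_nonneg)
    moreover have "(c * c * ip (kop K f) f) * ip f f = ip (kop K f) f * (c * c * ip f f)"
      by (simp add: mult_ac)
    ultimately show ?thesis using c2 by simp
  qed
  show ?thesis
  proof (cases "\<mu> = 0")
    case True
    show ?thesis
      by (rule that[of "\<lambda>_. 0" 0]) (use le True in \<open>auto simp: kop_def\<close>)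
  next
    case False
    with mu0 have mu: "\<mu> > 0" by simp
    have "\<exists>f. cont f \<and> ip f f = 1 \<and> \<mu> - inverse (real (Suc n)) < ip (kop K f) f" for n
    proof -
      have "\<mu> - inverse (real (Suc n)) < Sup S" unfolding \<mu>_def by simp
      then obtain v where "v \<in> S" "\<mu> - inverse (real (Suc n)) < v"
        unfolding less_cSup_iff[OF ne bdd] by blast
      then show ?thesis unfolding S_def by blast
    qed
    then obtain F where F: "\<And>n. cont (F n)" "\<And>n. ip (F n) (F n) = 1"
        "\<And>n. \<mu> - inverse (real (Suc n)) < ip (kop K (F n)) (F n)"
      by metis
    define G where "G n = kop K (F n)" for n
    have G: "cont (G n)" for n unfolding G_def by (rule kop_cont[OF kc F(1)])
    have Gb: "\<bar>G n x\<bar> \<le> 1 + C" if "x \<in> {a..b}" for n x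
    proof -
      have "\<bar>G n x\<bar>\<^sup>2 \<le> C"
        using kop_sq_le[OF kc F(1), of n x] C[OF that] F(2) by (simp add: G_def k2_def)
      then show ?thesis
        using zero_le_power2[of "\<bar>G n x\<bar> - 1"] zero_le_power2[of "\<bar>G n x\<bar>"]
        unfolding power2_diff power_one by linarith
    qed
    obtain g k where g: "continuous_on {a..b} g" and k: "strict_mono (k :: nat \<Rightarrow> nat)"
      and lim: "\<And>e. 0 < e \<Longrightarrow> \<exists>N. \<forall>n x. n \<ge> N \<and> x \<in> {a..b} \<longrightarrow> norm (G (k n) x - g x) < e"
    proof (rule Arzela_Ascoli[of "{a..b}" G "1 + C"])
      fix x e :: real assume x: "x \<in> {a..b}" and e: "0 < e"
      define d where "d y = ip (\<lambda>z. K x z - K y z) (\<lambda>z. K x z - K y z)" for y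
      have kx: "kcont (\<lambda>y z. K x z - K y z)"
        by (intro continuous_on_diff kc cont_snd kernel_row)
      have "cont d"
        unfolding d_def ip_def
        by (rule param_cont[of "\<lambda>y z. (K x z - K y z) * (K x z - K y z)", OF continuous_on_mult[OF kx kx]])
      moreover have "d x = 0" by (simp add: d_def ip_def)
      ultimately obtain \<delta> where \<delta>: "\<delta> > 0" "\<And>y. dist y x < \<delta> \<Longrightarrow> dist (d y) 0 < e\<^sup>2"
        unfolding continuous_on_iff using e by (metis UNIV_I zero_less_power)
      have "norm (G n x - G n y) < e" if "norm (x - y) < \<delta>" for n y
      proof -
        have "G n x - G n y = ip (\<lambda>z. K x z - K y z) (F n)"
          unfolding G_def kop_ip by (rule ip_diff[symmetric]) (intro kernel_row kc F)+
        then have "(G n x - G n y)\<^sup>2 \<le> d y * ip (F n) (F n)"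
          unfolding d_def
          by (simp only:) (rule ip_CS[OF continuous_on_diff[OF kernel_row[OF kc] kernel_row[OF kc]] F(1)])
        also have "\<dots> < e\<^sup>2"
          using \<delta>(2)[of y] that F(2) by (simp add: dist_real_def abs_minus_commute)
        finally have "\<bar>G n x - G n y\<bar>\<^sup>2 < e\<^sup>2" by simp
        from power_less_imp_less_base[OF this] show ?thesis using e by simp
      qed
      with \<delta>(1) show "\<exists>d>0. \<forall>n y. y \<in> {a..b} \<and> norm (x - y) < d \<longrightarrow> norm (G n x - G n y) < e"
        by blast
    qed (use Gb in auto)
    \<comment> \<open>the limit is extended by constants to the line\<close>
    define g' where "g' x = g (max a (min b x))" for x
    have g'c: "cont g'"
      unfolding g'_def
      by (rule continuous_on_compose2[OF g]) (use ab in \<open>auto intro!: continuous_intros\<close>)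
    have gg: "g' x = g x" if "x \<in> {a..b}" for x using that by (simp add: g'_def)
    have Glim: "(\<lambda>n. G (k n) x) \<longlonglongrightarrow> g' x" if "x \<in> {a..b}" for x
      using lim that unfolding gg[OF that] LIMSEQ_iff by blast
    define q where "q n = ip (G (k n)) (F (k n))" for n
    have "(\<lambda>n. \<mu> - inverse (real (Suc (k n)))) \<longlonglongrightarrow> \<mu> - 0"
      by (intro tendsto_intros LIMSEQ_subseq_LIMSEQ[OF LIMSEQ_inverse_real_of_nat k, unfolded comp_def])
    then have inv: "(\<lambda>n. \<mu> - inverse (real (Suc (k n)))) \<longlonglongrightarrow> \<mu>" by simp
    have qlim: "q \<longlonglongrightarrow> \<mu>"
    proof (rule seq_squeeze[OF _ _ inv tendsto_const])
      show "\<mu> - inverse (real (Suc (k n))) \<le> q n" for n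
        using F(3)[of "k n"] by (simp add: q_def G_def)
      show "q n \<le> \<mu>" for n
        using unit_le[OF F(1,2)] by (simp add: q_def G_def)
    qed
    have GG: "ip (G (k n)) (G (k n)) \<le> \<mu> * q n" for n
      using kop_norm_le[OF K le F(1) mu0] by (simp add: q_def G_def)
    have GG2: "(q n)\<^sup>2 \<le> ip (G (k n)) (G (k n))" for n
      using ip_CS[OF G F(1), of "k n" "k n"] F(2) by (simp add: q_def)
    \<comment> \<open>the limit is not the zero function, since its norm is \<open>\<mu>\<close>\<close>
    have GGlim: "(\<lambda>n. ip (G (k n)) (G (k n))) \<longlonglongrightarrow> \<mu>\<^sup>2"
      using seq_squeeze[OF GG2 GG tendsto_power[OF qlim, of 2]] tendsto_mult_left[OF qlim, of \<mu>]
      by (simp add: power2_eq_square)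
    have "(\<lambda>n. ip (G (k n)) (G (k n))) \<longlonglongrightarrow> ip g' g'"
      unfolding ip_def
    proof (rule integral_dominated_convergence[where w = "\<lambda>_. (1 + C) * (1 + C)"])
      show "AE x in M. (\<lambda>n. G (k n) x * G (k n) x) \<longlonglongrightarrow> g' x * g' x"
        by (rule AE_I2) (intro tendsto_mult Glim; simp)
      show "AE x in M. norm (G (k n) x * G (k n) x) \<le> (1 + C) * (1 + C)" for n
        by (rule AE_I2) (simp only: real_norm_def abs_mult, intro mult_mono' Gb abs_ge_zero; simp)
    qed (intro cont_integrable cont_measurable continuous_on_const continuous_on_mult G g'c)+
    with GGlim have g'n: "ip g' g' = \<mu>\<^sup>2" using LIMSEQ_unique by blast
    have eig: "kop K g' x = \<mu> * g' x" if x: "x \<in> {a..b}" for x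
    proof -
      have 1: "(\<lambda>n. kop K (G (k n)) x) \<longlonglongrightarrow> kop K g' x"
        unfolding kop_def
      proof (rule integral_dominated_convergence[where w = "\<lambda>y. \<bar>K x y\<bar> * (1 + C)"])
        show "AE y in M. (\<lambda>n. K x y * G (k n) y) \<longlonglongrightarrow> K x y * g' y"
          by (rule AE_I2) (intro tendsto_mult tendsto_const Glim; simp)
        show "AE y in M. norm (K x y * G (k n) y) \<le> \<bar>K x y\<bar> * (1 + C)" for n
          by (rule AE_I2) (simp only: real_norm_def abs_mult, intro mult_left_mono Gb abs_ge_zero; simp)
      qed (intro cont_integrable cont_measurable continuous_on_const continuous_on_mult
            continuous_on_rabs kernel_row kc G g'c)+
      define r where "r n = ip (\<lambda>x. G (k n) x + (- \<mu>) * F (k n) x) (\<lambda>x. G (k n) x + (- \<mu>) * F (k n) x)" for n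
      have r_le: "r n \<le> \<mu> * (\<mu> - q n)" for n
        unfolding r_def ip_expand[OF G F(1)] using GG[of n] F(2)
        by (simp add: q_def power2_eq_square algebra_simps)
      have "r \<longlonglongrightarrow> 0"
      proof (rule seq_squeeze[OF _ r_le tendsto_const])
        show "(\<lambda>n. \<mu> * (\<mu> - q n)) \<longlonglongrightarrow> 0"
          using tendsto_mult_left[OF tendsto_diff[OF tendsto_const qlim], of \<mu> \<mu>] by simp
        show "0 \<le> r n" for n unfolding r_def by (rule ip_nonneg)
      qed
      then have rl: "(\<lambda>n. sqrt (k2 x * r n)) \<longlonglongrightarrow> 0"
        using tendsto_real_sqrt[OF tendsto_mult_left[of r 0 sequentially "k2 x"]] by simp
      have kl: "kop K (G (k n)) x - \<mu> * G (k n) x = kop K (\<lambda>x. G (k n) x + (- \<mu>) * F (k n) x) x" for n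
        by (subst kop_lin[OF kc G F(1)]) (simp add: G_def)
      have "(\<lambda>n. kop K (G (k n)) x - \<mu> * G (k n) x) \<longlonglongrightarrow> 0"
      proof (rule Lim_null_comparison[OF always_eventually rl], rule allI)
        fix n
        have "(kop K (G (k n)) x - \<mu> * G (k n) x)\<^sup>2 \<le> k2 x * r n"
          unfolding kl k2_def r_def
          by (rule kop_sq_le[OF kc continuous_on_add[OF G continuous_on_mult_left[OF F(1)]]])
        then show "norm (kop K (G (k n)) x - \<mu> * G (k n) x) \<le> sqrt (k2 x * r n)"
          by (simp add: real_le_rsqrt)
      qed
      moreover have "(\<lambda>n. kop K (G (k n)) x - \<mu> * G (k n) x) \<longlonglongrightarrow> kop K g' x - \<mu> * g' x"
        by (intro tendsto_intros 1 Glim x)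
      ultimately have "kop K g' x - \<mu> * g' x = 0" using LIMSEQ_unique by blast
      then show ?thesis by simp
    qed
    define \<phi> where "\<phi> x = (1 / \<mu>\<^sup>2) * kop K g' x" for x
    have phi: "\<phi> x = (1 / \<mu>) * g' x" if "x \<in> {a<..<b}" for x
      using eig[of x] that mu by (simp add: \<phi>_def power2_eq_square)
    show ?thesis
    proof (rule that[of \<phi> \<mu>])
      show "cont \<phi>" unfolding \<phi>_def by (intro continuous_on_mult_left kop_cont[OF kc g'c])
      show "kop K \<phi> x = \<mu> * \<phi> x" for x
      proof -
        have "kop K \<phi> x = kop K (\<lambda>x. (1 / \<mu>) * g' x) x" by (rule kop_cong) (rule phi)
        also have "\<dots> = (1 / \<mu>) * kop K g' x" by (rule kop_scale)
        finally show ?thesis using mu by (simp add: \<phi>_def power2_eq_square)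
      qed
      have "ip \<phi> \<phi> = ip (\<lambda>x. (1 / \<mu>) * g' x) (\<lambda>x. (1 / \<mu>) * g' x)" by (rule ip_cong) (rule phi, assumption)+
      also have "\<dots> = (1 / \<mu>) * ((1 / \<mu>) * ip g' g')"
        by (simp only: ip_scale ip_commute[of g' "\<lambda>x. (1 / \<mu>) * g' x"])
      finally show "ip \<phi> \<phi> = 1" using mu by (simp add: g'n power2_eq_square)
    qed (use mu le in auto)
  qed
qed

end

section \<open>Deflation and the expansion in eigenfunctions\<close>

context real_interval begin

lemma kop_rank_one:
  assumes "kcont R" "cont \<phi>" "cont f"
  shows "kop (\<lambda>x y. R x y - c * \<phi> x * \<phi> y) f x = kop R f x - c * \<phi> x * ip \<phi> f"
proof -
  have "kop (\<lambda>x y. R x y - c * \<phi> x * \<phi> y) f x = ip (\<lambda>y. R x y - (c * \<phi> x) * \<phi> y) f"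
    by (simp add: kop_ip)
  also have "\<dots> = ip (R x) f - ip (\<lambda>y. (c * \<phi> x) * \<phi> y) f"
    by (rule ip_diff) (intro kernel_row continuous_on_mult_left assms)+
  also have "\<dots> = kop R f x - c * \<phi> x * ip \<phi> f"
    unfolding ip_scale kop_ip ..
  finally show ?thesis .
qed

lemma kcont_rank_one:
  assumes "kcont R" "cont \<phi>"
  shows "kcont (\<lambda>x y. R x y - c * \<phi> x * \<phi> y)"
  by (intro continuous_on_diff continuous_on_mult continuous_on_const cont_fst cont_snd assms)

lemma form_rank_one:
  assumes "kcont R" "cont \<phi>" "cont f"
  shows "ip (kop (\<lambda>x y. R x y - c * \<phi> x * \<phi> y) f) f = ip (kop R f) f - c * (ip \<phi> f)\<^sup>2"
proof -
  have "kop (\<lambda>x y. R x y - c * \<phi> x * \<phi> y) f = (\<lambda>x. kop R f x - (c * ip \<phi> f) * \<phi> x)"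
    by (rule ext, subst kop_rank_one[OF assms]) (simp only: mult_ac)
  then show ?thesis
    by (simp add: ip_diff[OF kop_cont[OF assms(1,3)] continuous_on_mult_left[OF assms(2)] assms(3)]
          ip_scale[of "c * ip \<phi> f"] power2_eq_square)
qed

lemma psd_rank_oneI:
  assumes R: "psd R" and \<phi>: "cont \<phi>"
    and le: "\<And>f. cont f \<Longrightarrow> c * (ip \<phi> f)\<^sup>2 \<le> ip (kop R f) f"
  shows "psd (\<lambda>x y. R x y - c * \<phi> x * \<phi> y)"
  unfolding psd_def
  using kcont_rank_one[OF psdD(1)[OF R] \<phi>] psdD(2)[OF R] le
  by (auto simp: form_rank_one[OF psdD(1)[OF R] \<phi>])

text \<open>Positivity survives the removal of an eigenfunction by Cauchy--Schwarz for the form: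
\<open>\<mu>\<^sup>2 \<langle>\<phi>, f\<rangle>\<^sup>2 = \<langle>R \<phi>, f\<rangle>\<^sup>2 \<le> \<mu> \<langle>R f, f\<rangle>\<close>.\<close>

lemma psd_deflate:
  assumes R: "psd R" and \<phi>: "cont \<phi>" and eig: "\<And>x. kop R \<phi> x = \<mu> * \<phi> x"
    and n: "\<mu> \<noteq> 0 \<Longrightarrow> ip \<phi> \<phi> = 1"
  shows "psd (\<lambda>x y. R x y - \<mu> * \<phi> x * \<phi> y)"
proof (rule psd_rank_oneI[OF R \<phi>])
  fix f assume f: "cont f"
  show "\<mu> * (ip \<phi> f)\<^sup>2 \<le> ip (kop R f) f"
  proof (cases "\<mu> = 0")
    case True
    then show ?thesis using psdD(3)[OF R f] by simp
  next
    case False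
    have kp: "kop R \<phi> = (\<lambda>x. \<mu> * \<phi> x)" using eig by (rule ext)
    have "(ip (kop R \<phi>) f)\<^sup>2 \<le> ip (kop R \<phi>) \<phi> * ip (kop R f) f"
      by (rule psd_CS[OF R \<phi> f])
    then have "\<mu> * (\<mu> * (ip \<phi> f)\<^sup>2) \<le> \<mu> * ip (kop R f) f"
      unfolding kp ip_scale using n[OF False] by (simp add: power2_eq_square mult_ac)
    moreover have "\<mu> > 0"
      using psdD(3)[OF R \<phi>] False n[OF False] unfolding kp ip_scale by simp
    ultimately show ?thesis by simp
  qed
qed

text \<open>If the kernel were negative at a diagonal point, it would be negative on a small square around it, and
the form would be negative at a tent function supported there.\<close>

lemma psd_diag:
  assumes R: "psd R" and x0: "x0 \<in> {a..b}"
  shows "0 \<le> R x0 x0"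
proof (rule ccontr)
  assume neg: "\<not> 0 \<le> R x0 x0"
  note kc = psdD(1)[OF R]
  obtain \<delta> where \<delta>: "\<delta> > 0" "\<And>p. dist p (x0, x0) < \<delta> \<Longrightarrow> dist (R (fst p) (snd p)) (R x0 x0) < - R x0 x0"
    using kc neg unfolding continuous_on_iff by (metis UNIV_I fst_conv neg_0_less_iff_less not_le snd_conv)
  have R0: "R x y < 0" if "\<bar>x - x0\<bar> < \<delta> / 2" "\<bar>y - x0\<bar> < \<delta> / 2" for x y
  proof -
    have "dist (x, y) (x0, x0) \<le> dist x x0 + dist y x0"
      unfolding dist_Pair_Pair by (rule sqrt_sum_squares_le_sum) auto
    also have "\<dots> < \<delta>" using that by (simp add: dist_real_def)
    finally show ?thesis using \<delta>(2)[of "(x, y)"] neg by (simp add: dist_real_def abs_if split: if_splits)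
  qed
  define f where "f y = max 0 (\<delta> / 2 - \<bar>y - x0\<bar>)" for y
  have f: "cont f" unfolding f_def by (intro continuous_intros)
  have f0: "f y \<ge> 0" for y by (simp add: f_def)
  have fpos: "\<bar>y - x0\<bar> < \<delta> / 2" if "f y \<noteq> 0" for y using that by (auto simp: f_def max_def split: if_splits)
  have neg1: "R x y * f y \<le> 0" if "f x \<noteq> 0" for x y
    using R0[OF fpos[OF that] fpos, of y] f0[of y] by (cases "f y = 0") (auto intro: mult_nonpos_nonneg less_imp_le)
  define h where "h = kop R f"
  have h: "cont h" unfolding h_def by (rule kop_cont[OF kc f])
  have h0: "h x * f x \<le> 0" for x
  proof (cases "f x = 0")
    case False
    have "h x \<le> 0" unfolding h_def kop_def
      using Bochner_Integration.integral_nonneg[of M "\<lambda>y. - (R x y * f y)"] neg1[OF False] by simp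
    then show ?thesis using f0[of x] by (rule mult_nonpos_nonneg)
  qed simp
  have "- (h x0 * f x0) = 0"
  proof (rule interval_measure_zero_imp_zero[OF ab _ _ _ x0, where f = "\<lambda>x. - (h x * f x)"])
    show "continuous_on {a..b} (\<lambda>x. - (h x * f x))"
      by (rule continuous_on_subset[OF continuous_on_minus[OF continuous_on_mult[OF h f]]]) simp
    have "ip h f \<ge> 0" unfolding h_def by (rule psdD(3)[OF R f])
    moreover have "0 \<le> (LINT x|M. - (h x * f x))" using h0 by (intro Bochner_Integration.integral_nonneg) auto
    ultimately show "(LINT x|M. - (h x * f x)) = 0" by (simp add: ip_def)
  qed (use h0 in simp)
  moreover have fx0: "f x0 > 0" using \<delta> by (simp add: f_def)
  ultimately have hx0: "h x0 = 0" by simp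
  have "- (R x0 x0 * f x0) = 0"
  proof (rule interval_measure_zero_imp_zero[OF ab _ _ _ x0, where f = "\<lambda>y. - (R x0 y * f y)"])
    show "continuous_on {a..b} (\<lambda>y. - (R x0 y * f y))"
      by (rule continuous_on_subset[OF continuous_on_minus[OF continuous_on_mult[OF kernel_row[OF kc] f]]]) simp
    show "(LINT y|M. - (R x0 y * f y)) = 0" using hx0 by (simp add: h_def kop_def)
  qed (use neg1 fx0 in auto)
  then show False using fx0 neg by auto
qed

text \<open>Cauchy--Schwarz between a point mass at \<open>x\<close> and a function: the kernel \<open>\<langle>R g, g\<rangle> R(x, y) - (R g)(x) (R g)(y)\<close> is positive by the usual
inequality, so its diagonal is nonnegative.\<close>

lemma psd_point_CS:
  assumes R: "psd R" and g: "cont g" and x: "x \<in> {a..b}"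
  shows "(kop R g x)\<^sup>2 \<le> R x x * ip (kop R g) g"
proof -
  note kc = psdD(1)[OF R]
  have gq: "0 \<le> ip (kop R g) g" by (rule psdD(3)[OF R g])
  let ?R = "\<lambda>x y. ip (kop R g) g * R x y"
  have op: "kop ?R f = (\<lambda>x. ip (kop R g) g * kop R f x)" for f
    unfolding kop_def by (simp add: mult.assoc)
  have "psd ?R"
    unfolding psd_def op ip_scale using psdD(2,3)[OF R] gq
    by (auto intro!: continuous_on_mult_left kc)
  then have "psd (\<lambda>x y. ?R x y - 1 * kop R g x * kop R g y)"
  proof (rule psd_rank_oneI[OF _ kop_cont[OF kc g]])
    show "1 * (ip (kop R g) f)\<^sup>2 \<le> ip (kop ?R f) f" if "cont f" for f
      unfolding op ip_scale using psd_CS[OF R g that] by simp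
  qed
  from psd_diag[OF this x] show ?thesis by (simp add: power2_eq_square mult_ac)
qed

lemma eigenvalue_sum_bound:
  assumes c: "\<And>k. cont (\<phi> k)" and n: "\<And>k. lam k * ip (\<phi> k) (\<phi> k) = lam k"
    and d: "\<And>x. x \<in> {a..b} \<Longrightarrow> (\<Sum>k<N. lam k * (\<phi> k x)\<^sup>2) \<le> C"
  shows "(\<Sum>k<N. lam k) \<le> (b - a) * C"
proof -
  have "(\<Sum>k<N. lam k) = (\<Sum>k<N. lam k * ip (\<phi> k) (\<phi> k))" by (simp add: n)
  also have "\<dots> = (LINT x|M. (\<Sum>k<N. lam k * (\<phi> k x)\<^sup>2))"
    unfolding ip_def power2_eq_square
    by (subst Bochner_Integration.integral_sum) (intro cont_integrable continuous_on_mult continuous_on_const c, simp)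
  also have "\<dots> \<le> (LINT x|M. C)"
  proof (rule integral_mono)
    show "integrable M (\<lambda>x. \<Sum>k<N. lam k * (\<phi> k x)\<^sup>2)"
      by (intro cont_integrable continuous_on_sum continuous_on_mult continuous_on_power continuous_on_const c)
    show "integrable M (\<lambda>_. C)" by (intro cont_integrable continuous_on_const)
  qed (use d in auto)
  finally show ?thesis using measure_interval_measure[of a b] ab by simp
qed

lemma cont_clamp:
  assumes "continuous_on {a..b} g"
  shows "cont (\<lambda>x. g (max a (min b x)))"
  by (rule continuous_on_compose2[OF assms]) (use ab in \<open>auto intro!: continuous_intros\<close>)

text \<open>Orthonormality is required only where the eigenvalue does not vanish, so that a kernel of finite rank
is covered. The bound on the diagonal gives absolute convergence and dominating constants.\<close>

definition mercer :: "(real \<Rightarrow> real \<Rightarrow> real) \<Rightarrow> (nat \<Rightarrow> real) \<Rightarrow> (nat \<Rightarrow> real \<Rightarrow> real) \<Rightarrow> bool" where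
  "mercer K lam \<phi> \<longleftrightarrow> (\<forall>n. cont (\<phi> n)) \<and> (\<forall>n. 0 \<le> lam n) \<and>
     (\<forall>n x. kop K (\<phi> n) x = lam n * \<phi> n x) \<and>
     (\<forall>i j. lam i \<noteq> 0 \<longrightarrow> lam j \<noteq> 0 \<longrightarrow> ip (\<phi> i) (\<phi> j) = (if i = j then 1 else 0)) \<and>
     (\<forall>N. \<forall>x\<in>{a..b}. (\<Sum>k<N. lam k * (\<phi> k x)\<^sup>2) \<le> K x x) \<and>
     (\<forall>x\<in>{a..b}. \<forall>y\<in>{a..b}. (\<lambda>k. lam k * \<phi> k x * \<phi> k y) sums K x y)"

text \<open>Eigenfunctions are removed one after another. The remainders \<open>R\<^sub>n\<close> are positive, hence their diagonals
are nonnegative; this bounds \<open>\<Sum> \<lambda>\<^sub>k\<close> and gives \<open>\<lambda>\<^sub>n \<longlonglongrightarrow> 0\<close>, while \<open>\<lambda>\<^sub>n\<close> bounds the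
form of \<open>R\<^sub>n\<close>. By \<open>psd_point_CS\<close> then \<open>(R\<^sub>n g)(x) \<longlonglongrightarrow> 0\<close> for every \<open>x\<close> and \<open>g\<close>. For fixed \<open>x\<close>
the series converges uniformly in \<open>y\<close>, so the limit \<open>D\<close> of \<open>R\<^sub>n(x, _)\<close> is continuous, and it is
orthogonal to every continuous function, in particular to itself.\<close>

theorem mercer_expansion:
  assumes K: "psd K"
  obtains lam \<phi> where "mercer K lam \<phi>"
proof -
  define good where "good R p \<longleftrightarrow> cont (snd p) \<and> 0 \<le> fst p \<and> (\<forall>x. kop R (snd p) x = fst p * snd p x) \<and>
     (fst p = 0 \<longrightarrow> snd p = (\<lambda>_. 0)) \<and> (fst p \<noteq> 0 \<longrightarrow> ip (snd p) (snd p) = 1) \<and>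
     (\<forall>f. cont f \<longrightarrow> ip (kop R f) f \<le> fst p * ip f f)" for R and p :: "real \<times> (real \<Rightarrow> real)"
  have "\<exists>p. psd R \<longrightarrow> good R p" for R
  proof (cases "psd R")
    case True
    then obtain \<mu> \<phi> where "good R (\<mu>, \<phi>)"
      by (rule psd_maximizer) (auto simp: good_def)
    then show ?thesis by blast
  qed auto
  then obtain pick where pick: "\<And>R. psd R \<Longrightarrow> good R (pick R)" by metis
  define Rs where "Rs = rec_nat K (\<lambda>_ R x y. R x y - fst (pick R) * snd (pick R) x * snd (pick R) y)"
  define lam where "lam n = fst (pick (Rs n))" for n
  define \<phi> where "\<phi> n = snd (pick (Rs n))" for n
  have Rs0: "Rs 0 = K" and RsS: "Rs (Suc n) = (\<lambda>x y. Rs n x y - lam n * \<phi> n x * \<phi> n y)" for n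
    by (simp_all add: Rs_def lam_def \<phi>_def)
  have step: "psd (Rs (Suc n))" if "psd (Rs n)" for n
    using pick[OF that] unfolding good_def RsS lam_def[symmetric] \<phi>_def[symmetric]
    by (intro psd_deflate[OF that]) auto
  have psd: "psd (Rs n)" for n
  proof (induction n)
    case 0
    show ?case unfolding Rs0 by (rule K)
  qed (rule step)
  note kc = psdD(1)[OF psd]
  have G: "good (Rs n) (lam n, \<phi> n)" for n
    using pick[OF psd[of n]] by (simp add: lam_def \<phi>_def)
  have c: "cont (\<phi> n)" and lam0: "0 \<le> lam n" and eig: "kop (Rs n) (\<phi> n) x = lam n * \<phi> n x"
    and z: "lam n = 0 \<Longrightarrow> \<phi> n = (\<lambda>_. 0)" and nrm: "lam n \<noteq> 0 \<Longrightarrow> ip (\<phi> n) (\<phi> n) = 1"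
    and le: "cont f \<Longrightarrow> ip (kop (Rs n) f) f \<le> lam n * ip f f" for n x f
    using G[of n] unfolding good_def fst_conv snd_conv by simp_all
  have eig': "kop (Rs n) (\<phi> n) = (\<lambda>x. lam n * \<phi> n x)" for n using eig by (rule ext)
  have Rs_eq: "Rs n x y = K x y - (\<Sum>k<n. lam k * \<phi> k x * \<phi> k y)" for n x y
    by (induction n) (simp_all add: Rs0 RsS)
  have lam_nrm: "lam n * ip (\<phi> n) (\<phi> n) = lam n" for n using nrm[of n] by (cases "lam n = 0") auto
  \<comment> \<open>an eigenfunction is annihilated by all later remainders, which is what makes the family orthogonal\<close>
  have kop_later: "kop (Rs (Suc (i + d))) (\<phi> i) = (\<lambda>_. 0)" for i d
  proof (induction d)
    case 0
    have "kop (Rs (Suc i)) (\<phi> i) x = lam i * \<phi> i x - lam i * \<phi> i x * ip (\<phi> i) (\<phi> i)" for x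
      unfolding RsS kop_rank_one[OF kc c c] eig ..
    moreover have "lam i * \<phi> i x * ip (\<phi> i) (\<phi> i) = lam i * \<phi> i x" for x
      by (cases "lam i = 0") (simp_all add: nrm)
    ultimately have "kop (Rs (Suc i)) (\<phi> i) x = 0" for x
      by simp
    then show ?case by auto
  next
    case (Suc d)
    let ?j = "Suc (i + d)"
    have "lam ?j * ip (\<phi> ?j) (\<phi> i) = ip (kop (Rs ?j) (\<phi> ?j)) (\<phi> i)"
      unfolding eig' ip_scale ..
    also have "\<dots> = ip (\<phi> ?j) (kop (Rs ?j) (\<phi> i))"
      by (rule kop_sym[OF kc psdD(2)[OF psd] c c])
    also have "\<dots> = 0" unfolding Suc.IH by (simp add: ip_def)
    finally have "lam ?j * \<phi> ?j x * ip (\<phi> ?j) (\<phi> i) = 0" for x by auto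
    then have "kop (Rs (Suc ?j)) (\<phi> i) x = 0" for x
      unfolding RsS[of ?j] kop_rank_one[OF kc c c] Suc.IH by simp
    then show ?case by auto
  qed
  have orth1: "lam j * ip (\<phi> j) (\<phi> i) = 0" if "i < j" for i j
  proof -
    obtain d where j: "j = Suc (i + d)" using \<open>i < j\<close> by (auto dest: less_imp_Suc_add)
    have "lam j * ip (\<phi> j) (\<phi> i) = ip (kop (Rs j) (\<phi> j)) (\<phi> i)"
      unfolding eig' ip_scale ..
    also have "\<dots> = ip (\<phi> j) (kop (Rs j) (\<phi> i))"
      by (rule kop_sym[OF kc psdD(2)[OF psd] c c])
    also have "\<dots> = 0" unfolding j kop_later by (simp add: ip_def)
    finally show ?thesis .
  qed
  have orth: "ip (\<phi> i) (\<phi> j) = (if i = j then 1 else 0)" if "lam i \<noteq> 0" "lam j \<noteq> 0" for i j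
    using orth1[of i j] orth1[of j i] nrm that ip_commute[of "\<phi> i" "\<phi> j"]
    by (cases i j rule: linorder_cases) auto
  have orth0: "ip (\<phi> k) (\<phi> i) = 0" if "k < i" for k i
    using orth1[OF that] z[of i] ip_commute[of "\<phi> i" "\<phi> k"] by (cases "lam i = 0") (auto simp: ip_def)
  have eigK: "kop K (\<phi> n) x = lam n * \<phi> n x" for n x
  proof -
    have "kop (Rs m) (\<phi> n) x = kop K (\<phi> n) x" if "m \<le> n" for m
      using that
    proof (induction m)
      case (Suc m)
      then show ?case
        unfolding RsS kop_rank_one[OF kc c c] using orth0[of m n] by simp
    qed (simp add: Rs0)
    from this[of n] eig show ?thesis by simp
  qed
  have diag: "(\<Sum>k<N. lam k * (\<phi> k x)\<^sup>2) \<le> K x x" if "x \<in> {a..b}" for N x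
    using psd_diag[OF psd[of N] that] by (simp add: Rs_eq power2_eq_square mult.assoc)
  obtain C where "\<And>x. x \<in> {a..b} \<Longrightarrow> \<bar>K x x\<bar> \<le> C"
    by (rule cont_bounded[OF kernel_compose[OF psdD(1)[OF K] continuous_on_id continuous_on_id]]) (rule that)
  then have C: "K x x \<le> C" if "x \<in> {a..b}" for x using that by (simp add: abs_le_iff)
  have C0: "0 \<le> C" using C[of a] psd_diag[OF K, of a] ab by simp
  have "(\<Sum>k<N. lam k) \<le> (b - a) * C" for N
    by (rule eigenvalue_sum_bound[OF c lam_nrm]) (use diag C in \<open>blast intro: order_trans\<close>)
  then have "summable lam" by (rule summableI_nonneg_bounded[OF lam0])
  then have lamlim: "lam \<longlonglongrightarrow> 0" by (rule summable_LIMSEQ_zero)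
  have sumsq: "summable (\<lambda>k. lam k * (\<phi> k x)\<^sup>2)" if "x \<in> {a..b}" for x
    by (rule summableI_nonneg_bounded[of _ "K x x"]) (use diag[OF that] lam0 in auto)
  have CS: "(\<Sum>k\<in>I. lam k * \<phi> k x * \<phi> k y)\<^sup>2 \<le> (\<Sum>k\<in>I. lam k * (\<phi> k x)\<^sup>2) * (\<Sum>k\<in>I. lam k * (\<phi> k y)\<^sup>2)" for I x y
  proof -
    have "lam k * \<phi> k x * \<phi> k y = (sqrt (lam k) * \<phi> k x) * (sqrt (lam k) * \<phi> k y)" for k
      using lam0[of k] by (simp add: algebra_simps)
    moreover have "lam k * (\<phi> k x)\<^sup>2 = (sqrt (lam k) * \<phi> k x)\<^sup>2" for k x
      using lam0[of k] by (simp add: power_mult_distrib)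
    ultimately show ?thesis by (simp only: Cauchy_Schwarz_ineq_sum)
  qed
  have summ: "summable (\<lambda>k. lam k * \<phi> k x * \<phi> k y)" if "x \<in> {a..b}" "y \<in> {a..b}" for x y
  proof (rule summable_comparison_test'[OF summable_add[OF sumsq[OF that(1)] sumsq[OF that(2)]]])
    fix n :: nat
    have "\<bar>\<phi> n x * \<phi> n y\<bar> \<le> (\<phi> n x)\<^sup>2 + (\<phi> n y)\<^sup>2"
      using zero_le_power2[of "\<bar>\<phi> n x\<bar> - \<bar>\<phi> n y\<bar>"] zero_le_power2[of "\<phi> n x"] zero_le_power2[of "\<phi> n y"]
      unfolding power2_diff abs_mult power2_abs by linarith
    from mult_left_mono[OF this lam0[of n]]
    show "norm (lam n * \<phi> n x * \<phi> n y) \<le> lam n * (\<phi> n x)\<^sup>2 + lam n * (\<phi> n y)\<^sup>2"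
      using lam0[of n] by (simp add: abs_mult algebra_simps)
  qed
  define V where "V x y = (\<Sum>k. lam k * \<phi> k x * \<phi> k y)" for x y
  have Vlim: "(\<lambda>n. \<Sum>k<n. lam k * \<phi> k x * \<phi> k y) \<longlonglongrightarrow> V x y" if "x \<in> {a..b}" "y \<in> {a..b}" for x y
    unfolding V_def by (rule summable_LIMSEQ[OF summ[OF that]])
  have VK: "V x y = K x y" if x: "x \<in> {a..b}" and y: "y \<in> {a..b}" for x y
  proof -
    define t where "t n = (\<Sum>k. lam k * (\<phi> k x)\<^sup>2) - (\<Sum>k<n. lam k * (\<phi> k x)\<^sup>2)" for n
    have tlim: "t \<longlonglongrightarrow> 0"
      using tendsto_diff[OF tendsto_const summable_LIMSEQ[OF sumsq[OF x]], of "\<Sum>k. lam k * (\<phi> k x)\<^sup>2"]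
      unfolding t_def by simp
    \<comment> \<open>Cauchy--Schwarz bounds the tail by its diagonal part at \<open>x\<close>, uniformly in \<open>y\<close>\<close>
    have unif: "(V x y - (\<Sum>k<n. lam k * \<phi> k x * \<phi> k y))\<^sup>2 \<le> t n * C" if y: "y \<in> {a..b}" for n y
    proof (rule LIMSEQ_le)
      show "(\<lambda>m. ((\<Sum>k<m. lam k * \<phi> k x * \<phi> k y) - (\<Sum>k<n. lam k * \<phi> k x * \<phi> k y))\<^sup>2)
          \<longlonglongrightarrow> (V x y - (\<Sum>k<n. lam k * \<phi> k x * \<phi> k y))\<^sup>2"
        by (intro tendsto_intros Vlim x y)
      show "(\<lambda>m. ((\<Sum>k<m. lam k * (\<phi> k x)\<^sup>2) - (\<Sum>k<n. lam k * (\<phi> k x)\<^sup>2)) * C) \<longlonglongrightarrow> t n * C"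
        unfolding t_def by (intro tendsto_intros summable_LIMSEQ sumsq x)
      show "\<exists>N. \<forall>m\<ge>N. ((\<Sum>k<m. lam k * \<phi> k x * \<phi> k y) - (\<Sum>k<n. lam k * \<phi> k x * \<phi> k y))\<^sup>2
          \<le> ((\<Sum>k<m. lam k * (\<phi> k x)\<^sup>2) - (\<Sum>k<n. lam k * (\<phi> k x)\<^sup>2)) * C"
      proof (intro exI allI impI)
        fix m assume m: "m \<ge> n"
        have d: "(\<Sum>k<m. f k) - (\<Sum>k<n. f k) = (\<Sum>k\<in>{n..<m}. f k)" for f :: "nat \<Rightarrow> real"
          using sum_diff_nat_ivl[of 0 n m f] m by (simp add: atLeast0LessThan)
        have "(\<Sum>k\<in>{n..<m}. lam k * (\<phi> k y)\<^sup>2) \<le> (\<Sum>k<m. lam k * (\<phi> k y)\<^sup>2)"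
          by (rule sum_mono2) (use lam0 in auto)
        also have "\<dots> \<le> C" using diag[OF y, of m] C[OF y] by simp
        finally have "(\<Sum>k\<in>{n..<m}. lam k * (\<phi> k y)\<^sup>2) \<le> C" .
        then show "((\<Sum>k<m. lam k * \<phi> k x * \<phi> k y) - (\<Sum>k<n. lam k * \<phi> k x * \<phi> k y))\<^sup>2
          \<le> ((\<Sum>k<m. lam k * (\<phi> k x)\<^sup>2) - (\<Sum>k<n. lam k * (\<phi> k x)\<^sup>2)) * C"
          unfolding d by (intro order_trans[OF CS] mult_left_mono sum_nonneg) (use lam0 in auto)
      qed
    qed
    have "uniform_limit {a..b} (\<lambda>n y. \<Sum>k<n. lam k * \<phi> k x * \<phi> k y) (V x) sequentially"
    proof (rule uniform_limitI)
      fix e :: real assume e: "0 < e"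
      have "(\<lambda>n. t n * C) \<longlonglongrightarrow> 0" using tendsto_mult_right[OF tlim, of C] by simp
      then have "\<forall>\<^sub>F n in sequentially. t n * C < e\<^sup>2" by (rule order_tendstoD) (use e in simp)
      then show "\<forall>\<^sub>F n in sequentially. \<forall>y\<in>{a..b}. dist (\<Sum>k<n. lam k * \<phi> k x * \<phi> k y) (V x y) < e"
      proof eventually_elim
        case (elim n)
        show ?case
        proof
          fix y assume "y \<in> {a..b}"
          from unif[OF this, of n] elim have "\<bar>V x y - (\<Sum>k<n. lam k * \<phi> k x * \<phi> k y)\<bar>\<^sup>2 < e\<^sup>2" by simp
          from power_less_imp_less_base[OF this] e
          show "dist (\<Sum>k<n. lam k * \<phi> k x * \<phi> k y) (V x y) < e" by (simp add: dist_real_def abs_minus_commute)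
        qed
      qed
    qed
    then have Vc: "continuous_on {a..b} (V x)"
      by (rule uniform_limit_theorem[rotated])
         (auto intro!: always_eventually continuous_on_sum continuous_on_mult continuous_on_const
            continuous_on_subset[OF c])
    define D where "D y = K x y - V x y" for y
    \<comment> \<open>the function \<open>D\<close> is only known to be continuous on the interval\<close>
    define g where "g y = D (max a (min b y))" for y
    have g: "cont g" unfolding g_def
      by (rule cont_clamp) (unfold D_def, intro continuous_on_diff Vc continuous_on_subset[OF kernel_row[OF psdD(1)[OF K]]] subset_UNIV)
    have gD: "g y = D y" if "y \<in> {a..b}" for y using that by (simp add: g_def)
    have "(\<lambda>n. kop (Rs n) g x) \<longlonglongrightarrow> (LINT y|M. D y * g y)"
      unfolding kop_def
    proof (rule integral_dominated_convergence[where w = "\<lambda>y. (\<bar>K x y\<bar> + C) * \<bar>g y\<bar>"])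
      show "(\<lambda>y. D y * g y) \<in> borel_measurable M"
        by (rule measurable_cong[THEN iffD1, OF _ cont_measurable[OF continuous_on_mult[OF g g]]]) (simp add: gD)
      show "(\<lambda>y. Rs n x y * g y) \<in> borel_measurable M" for n
        by (intro cont_measurable continuous_on_mult kernel_row kc g)
      show "integrable M (\<lambda>y. (\<bar>K x y\<bar> + C) * \<bar>g y\<bar>)"
        by (intro cont_integrable continuous_on_mult continuous_on_add continuous_on_rabs kernel_row psdD(1)[OF K] g continuous_on_const)
      show "AE y in M. (\<lambda>n. Rs n x y * g y) \<longlonglongrightarrow> D y * g y"
        by (rule AE_I2, unfold Rs_eq D_def) (intro tendsto_intros Vlim x, simp)
      show "AE y in M. norm (Rs n x y * g y) \<le> (\<bar>K x y\<bar> + C) * \<bar>g y\<bar>" for n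
      proof (rule AE_I2)
        fix y assume "y \<in> space M"
        then have y: "y \<in> {a..b}" by simp
        have "(\<Sum>k<n. lam k * \<phi> k x * \<phi> k y)\<^sup>2 \<le> C * C"
          using diag[OF x, of n] diag[OF y, of n] C[OF x] C[OF y]
          by (intro order_trans[OF CS] mult_mono C0 sum_nonneg) (use lam0 in auto)
        then have "\<bar>\<Sum>k<n. lam k * \<phi> k x * \<phi> k y\<bar> \<le> C"
          using C0 abs_le_square_iff[of "\<Sum>k<n. lam k * \<phi> k x * \<phi> k y" C] by (simp add: power2_eq_square)
        then have "\<bar>Rs n x y\<bar> \<le> \<bar>K x y\<bar> + C" unfolding Rs_eq by linarith
        then show "norm (Rs n x y * g y) \<le> (\<bar>K x y\<bar> + C) * \<bar>g y\<bar>"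
          by (simp add: abs_mult mult_right_mono)
      qed
    qed
    moreover have "(\<lambda>n. kop (Rs n) g x) \<longlonglongrightarrow> 0"
    proof (rule Lim_null_comparison[OF always_eventually])
      show "\<forall>n. norm (kop (Rs n) g x) \<le> sqrt (C * (lam n * ip g g))"
      proof
        fix n
        have "Rs n x x \<le> C"
          using C[OF x] sum_nonneg[of "{..<n}" "\<lambda>k. lam k * \<phi> k x * \<phi> k x"] lam0
          by (simp add: Rs_eq mult.assoc)
        moreover have "(kop (Rs n) g x)\<^sup>2 \<le> Rs n x x * ip (kop (Rs n) g) g"
          by (rule psd_point_CS[OF psd g x])
        ultimately have "(kop (Rs n) g x)\<^sup>2 \<le> C * (lam n * ip g g)"
          using mult_mono[OF _ le[OF g, of n] C0 psdD(3)[OF psd g, of n], of "Rs n x x"] by linarith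
        then show "norm (kop (Rs n) g x) \<le> sqrt (C * (lam n * ip g g))"
          by (simp add: real_le_rsqrt)
      qed
      show "(\<lambda>n. sqrt (C * (lam n * ip g g))) \<longlonglongrightarrow> 0"
        using tendsto_real_sqrt[OF tendsto_mult_left[OF tendsto_mult_right[OF lamlim, of "ip g g"], of C]] by simp
    qed
    ultimately have "(LINT y|M. D y * g y) = 0" using LIMSEQ_unique by blast
    then have "ip g g = 0"
      unfolding ip_def by (subst Bochner_Integration.integral_cong[OF refl, of M _ "\<lambda>y. D y * g y"]) (simp_all add: gD)
    from ip_eq_0[OF g this y] gD[OF y] show ?thesis by (simp add: D_def)
  qed
  have sums: "(\<lambda>k. lam k * \<phi> k x * \<phi> k y) sums K x y" if "x \<in> {a..b}" "y \<in> {a..b}" for x y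
    using summable_sums[OF summ[OF that]] VK[OF that] unfolding V_def by simp
  have "mercer K lam \<phi>"
    unfolding mercer_def
    by (intro conjI allI ballI impI c lam0 eigK orth diag sums)
  then show ?thesis by (rule that)
qed

end

section \<open>The Fredholm determinant as a product over the eigenvalues\<close>

lemma mult_le_mean_squares: "p * q \<le> (p\<^sup>2 + q\<^sup>2) / 2" for p q :: real
  using zero_le_power2[of "p - q"] by (simp add: power2_eq_square algebra_simps)

text \<open>Each set of \<open>n\<close> indices is the range of \<open>n!\<close> injections: this absorbs the factorial in Fredholm's
series.\<close>

lemma sum_injections_eq:
  fixes l :: "'a \<Rightarrow> real"
  assumes S: "finite S"
  shows "(\<Sum>\<kappa>\<in>{\<kappa>\<in>{..<n} \<rightarrow>\<^sub>E S. inj_on \<kappa> {..<n}}. \<Prod>i<n. l (\<kappa> i))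
    = fact n * (\<Sum>A | A \<subseteq> S \<and> card A = n. \<Prod>k\<in>A. l k)"
proof -
  let ?I = "{\<kappa>\<in>{..<n} \<rightarrow>\<^sub>E S. inj_on \<kappa> {..<n}}"
  let ?P = "{A. A \<subseteq> S \<and> card A = n}"
  have fI: "finite ?I" using finite_PiE[of "{..<n}" "\<lambda>_. S"] S by auto
  have fP: "finite ?P" using S by auto
  have im: "\<kappa> ` {..<n} \<in> ?P" if "\<kappa> \<in> ?I" for \<kappa>
    using that by (auto simp: card_image PiE_iff)
  have cardA: "card {\<kappa>\<in>?I. \<kappa> ` {..<n} = A} = fact n" if A: "A \<in> ?P" for A
  proof -
    have fA: "finite A" using A S finite_subset by blast
    have "{\<kappa>\<in>?I. \<kappa> ` {..<n} = A} = {\<kappa>\<in>{..<n} \<rightarrow>\<^sub>E A. inj_on \<kappa> {..<n}}"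
    proof (rule equalityI; rule subsetI)
      fix \<kappa> assume "\<kappa> \<in> {\<kappa>\<in>{..<n} \<rightarrow>\<^sub>E A. inj_on \<kappa> {..<n}}"
      then have k: "\<kappa> \<in> {..<n} \<rightarrow>\<^sub>E A" "inj_on \<kappa> {..<n}" by auto
      then have "\<kappa> ` {..<n} = A"
        using card_image[OF k(2)] A fA k(1) by (intro card_subset_eq) (auto simp: PiE_iff)
      moreover have "\<kappa> \<in> {..<n} \<rightarrow>\<^sub>E S" using k(1) A by (auto simp: PiE_iff)
      ultimately show "\<kappa> \<in> {\<kappa>\<in>?I. \<kappa> ` {..<n} = A}" using k(2) by simp
    next
      fix \<kappa> assume "\<kappa> \<in> {\<kappa>\<in>?I. \<kappa> ` {..<n} = A}"
      then show "\<kappa> \<in> {\<kappa>\<in>{..<n} \<rightarrow>\<^sub>E A. inj_on \<kappa> {..<n}}" by (auto simp: PiE_iff)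
    qed
    also have "card \<dots> = card A ^ (card {..<n} - card {..<n}) * prod ((-) (card A)) {0..<card {..<n}}"
      by (rule card_inj_on_subset_funcset) (use fA in auto)
    also have "\<dots> = fact n" using A by (simp add: fact_prod_rev)
    finally show ?thesis .
  qed
  have "(\<Sum>\<kappa>\<in>?I. \<Prod>i<n. l (\<kappa> i)) = (\<Sum>\<kappa>\<in>?I. \<Prod>k\<in>\<kappa> ` {..<n}. l k)"
    by (intro sum.cong refl) (simp add: prod.reindex)
  also have "\<dots> = (\<Sum>A\<in>?P. \<Sum>\<kappa>\<in>{\<kappa>\<in>?I. \<kappa> ` {..<n} = A}. \<Prod>k\<in>\<kappa> ` {..<n}. l k)"
    by (rule sum.group[symmetric, OF fI fP]) (use im in auto)
  also have "\<dots> = (\<Sum>A\<in>?P. \<Sum>\<kappa>\<in>{\<kappa>\<in>?I. \<kappa> ` {..<n} = A}. \<Prod>k\<in>A. l k)"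
    by (intro sum.cong refl) auto
  also have "\<dots> = (\<Sum>A\<in>?P. fact n * (\<Prod>k\<in>A. l k))"
    by (intro sum.cong refl) (simp only: sum_constant cardA of_nat_fact)
  finally show ?thesis by (simp add: sum_distrib_left)
qed

lemma prod_one_plus_eq_injections:
  fixes l :: "'a \<Rightarrow> real"
  assumes S: "finite S"
  shows "(\<lambda>n. z ^ n / fact n * (\<Sum>\<kappa>\<in>{\<kappa>\<in>{..<n} \<rightarrow>\<^sub>E S. inj_on \<kappa> {..<n}}. \<Prod>i<n. l (\<kappa> i)))
     sums (\<Prod>k\<in>S. 1 + z * l k)"
proof -
  let ?f = "\<lambda>n. z ^ n * (\<Sum>A | A \<subseteq> S \<and> card A = n. \<Prod>k\<in>A. l k)"
  have "?f n = 0" if "n \<notin> {..card S}" for n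
  proof -
    have "{A. A \<subseteq> S \<and> card A = n} = {}"
      using that card_mono[OF S] by force
    then show ?thesis by (simp only: sum.empty mult_zero_right)
  qed
  then have "?f sums (\<Sum>n\<le>card S. ?f n)" by (intro sums_finite) auto
  also have "(\<Sum>n\<le>card S. ?f n) = (\<Sum>n\<le>card S. \<Sum>A\<in>{A\<in>Pow S. card A = n}. z ^ card A * (\<Prod>k\<in>A. l k))"
    by (simp add: sum_distrib_left)
  also have "\<dots> = (\<Sum>A\<in>Pow S. z ^ card A * (\<Prod>k\<in>A. l k))"
    by (rule sum.group) (use S card_mono[OF S] in auto)
  also have "\<dots> = (\<Prod>k\<in>S. z * l k + 1)"
    unfolding prod_add[OF S] by (simp add: prod.distrib)
  finally show ?thesis
    unfolding sum_injections_eq[OF S] by (simp add: add.commute)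
qed

context real_interval begin

definition fredholm_coeff :: "nat \<Rightarrow> (real \<Rightarrow> real \<Rightarrow> real) \<Rightarrow> real" where
  "fredholm_coeff n K = (LINT x|Pi\<^sub>M {..<n} (\<lambda>_. M). Determinant.det (Matrix.mat n n (\<lambda>(i, j). K (x i) (x j))))"

lemma product_sigma_finite_M: "product_sigma_finite (\<lambda>_::nat. M)"
proof -
  interpret finite_measure M by (rule finite_interval_measure)
  show ?thesis by standard
qed

lemma det_mat_left:
  "Determinant.det (Matrix.mat n n (\<lambda>(i, j). A i j)) =
    (\<Sum>p | p permutes {..<n}. signof p * (\<Prod>i<n. A (p i) i))" for A :: "nat \<Rightarrow> nat \<Rightarrow> real"
proof -
  have "Determinant.det (Matrix.mat n n (\<lambda>(i, j). A i j)) = (\<Sum>p | p permutes {0..<n}.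
     signof p * (\<Prod>i = 0..<n. Matrix.mat n n (\<lambda>(i, j). A i j) $$ (p i, i)))"
    by (subst mat_det_left_def[where n = n]) auto
  also have "\<dots> = (\<Sum>p | p permutes {0..<n}. signof p * (\<Prod>i = 0..<n. A (p i) i))"
    by (intro sum.cong prod.cong arg_cong2[of _ _ _ _ "(*)"] refl) (auto dest: permutes_in_image)
  finally show ?thesis by (simp only: atLeast0LessThan)
qed

text \<open>Expand the determinant over permutations \<open>p\<close> and each entry over \<open>k\<close>. After the substitution
\<open>j = p i\<close> in one factor the integral splits into inner products of eigenfunctions, and the sum over \<open>p\<close>
becomes the determinant of the matrix with entries \<open>1\<close> where \<open>\<kappa> i = \<kappa> j\<close> and \<open>0\<close> elsewhere. That is
the identity matrix if \<open>\<kappa>\<close> is injective and has two equal rows otherwise.\<close>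

lemma fredholm_coeff_finite_rank:
  assumes I: "finite I" and c: "\<And>k. cont (\<phi> k)"
    and orth: "\<And>i j. i \<in> I \<Longrightarrow> j \<in> I \<Longrightarrow> ip (\<phi> i) (\<phi> j) = (if i = j then 1 else 0)"
  shows "fredholm_coeff n (\<lambda>x y. \<Sum>k\<in>I. l k * \<phi> k x * \<phi> k y) =
    (\<Sum>\<kappa>\<in>{\<kappa>\<in>{..<n} \<rightarrow>\<^sub>E I. inj_on \<kappa> {..<n}}. \<Prod>i<n. l (\<kappa> i))"
proof -
  interpret product_sigma_finite "\<lambda>_::nat. M" by (rule product_sigma_finite_M)
  let ?P = "{p. p permutes {..<n}}"
  let ?PM = "Pi\<^sub>M {..<n} (\<lambda>_. M)"
  let ?F = "{..<n} \<rightarrow>\<^sub>E I"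
  let ?g = "\<lambda>p \<kappa> x. \<Prod>j<n. \<phi> (\<kappa> (Hilbert_Choice.inv p j)) (x j) * \<phi> (\<kappa> j) (x j)"
  have fP: "finite ?P" by (simp add: finite_permutations)
  have fF: "finite ?F" using I by (simp add: finite_PiE)
  have expand: "Determinant.det (Matrix.mat n n (\<lambda>(i, j). \<Sum>k\<in>I. l k * \<phi> k (x i) * \<phi> k (x j)))
     = (\<Sum>p\<in>?P. \<Sum>\<kappa>\<in>?F. signof p * (\<Prod>i<n. l (\<kappa> i)) * ?g p \<kappa> x)" for x
  proof -
    have "(\<Prod>i<n. \<Sum>k\<in>I. l k * \<phi> k (x (p i)) * \<phi> k (x i)) = (\<Sum>\<kappa>\<in>?F. (\<Prod>i<n. l (\<kappa> i)) * ?g p \<kappa> x)"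
      if p: "p permutes {..<n}" for p
    proof -
      have "(\<Prod>i<n. \<Sum>k\<in>I. l k * \<phi> k (x (p i)) * \<phi> k (x i))
          = (\<Sum>\<kappa>\<in>?F. \<Prod>i<n. l (\<kappa> i) * \<phi> (\<kappa> i) (x (p i)) * \<phi> (\<kappa> i) (x i))"
        by (rule prod_sum_PiE) (use I in auto)
      also have "\<dots> = (\<Sum>\<kappa>\<in>?F. (\<Prod>i<n. l (\<kappa> i)) * ?g p \<kappa> x)"
      proof (rule sum.cong[OF refl])
        fix \<kappa>
        have "(\<Prod>i<n. \<phi> (\<kappa> i) (x (p i))) = (\<Prod>j<n. \<phi> (\<kappa> (Hilbert_Choice.inv p j)) (x j))"
          using prod.permute[OF p, of "\<lambda>j. \<phi> (\<kappa> (Hilbert_Choice.inv p j)) (x j)"] permutes_inverses(2)[OF p]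
          by (simp add: comp_def)
        then show "(\<Prod>i<n. l (\<kappa> i) * \<phi> (\<kappa> i) (x (p i)) * \<phi> (\<kappa> i) (x i)) = (\<Prod>i<n. l (\<kappa> i)) * ?g p \<kappa> x"
          by (simp add: prod.distrib mult.assoc)
      qed
      finally show ?thesis .
    qed
    then show ?thesis
      unfolding det_mat_left by (intro sum.cong refl) (simp add: sum_distrib_left mult.assoc)
  qed
  have int_ij: "integrable M (\<lambda>x. \<phi> i x * \<phi> j x)" for i j
    by (intro cont_integrable continuous_on_mult c)
  have int_g: "integrable ?PM (?g p \<kappa>)" for p \<kappa>
    by (rule product_integrable_prod) (auto intro: int_ij)
  have val: "integral\<^sup>L ?PM (?g p \<kappa>) = (\<Prod>i<n. if \<kappa> i = \<kappa> (p i) then 1 else 0)"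
    if p: "p permutes {..<n}" and \<kappa>: "\<kappa> \<in> ?F" for p \<kappa>
  proof -
    have "integral\<^sup>L ?PM (?g p \<kappa>) = (\<Prod>j<n. LINT x|M. \<phi> (\<kappa> (Hilbert_Choice.inv p j)) x * \<phi> (\<kappa> j) x)"
      by (rule product_integral_prod) (auto intro: int_ij)
    also have "\<dots> = (\<Prod>j<n. if \<kappa> (Hilbert_Choice.inv p j) = \<kappa> j then 1 else 0)"
    proof (rule prod.cong[OF refl])
      fix j assume j: "j \<in> {..<n}"
      have "Hilbert_Choice.inv p j \<in> {..<n}" using permutes_in_image[OF permutes_inv[OF p]] j by simp
      then show "(LINT x|M. \<phi> (\<kappa> (Hilbert_Choice.inv p j)) x * \<phi> (\<kappa> j) x) = (if \<kappa> (Hilbert_Choice.inv p j) = \<kappa> j then 1 else 0)"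
        using orth[OF PiE_mem[OF \<kappa>] PiE_mem[OF \<kappa> j]] unfolding ip_def by blast
    qed
    also have "\<dots> = (\<Prod>i<n. if \<kappa> i = \<kappa> (p i) then 1 else 0)"
      using prod.permute[OF p, of "\<lambda>j. if \<kappa> (Hilbert_Choice.inv p j) = \<kappa> j then 1 else (0::real)"] permutes_inverses(2)[OF p]
      by (simp add: comp_def)
    finally show ?thesis .
  qed
  have dets: "(\<Sum>p\<in>?P. signof p * (\<Prod>i<n. if \<kappa> i = \<kappa> (p i) then 1 else 0)) = (if inj_on \<kappa> {..<n} then 1 else 0 :: real)" for \<kappa>
  proof -
    let ?A = "Matrix.mat n n (\<lambda>(i, j). if \<kappa> j = \<kappa> i then 1 else (0::real))"
    have "(\<Sum>p\<in>?P. signof p * (\<Prod>i<n. if \<kappa> i = \<kappa> (p i) then 1 else 0)) = Determinant.det ?A"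
      by (simp add: det_mat_left)
    also have "\<dots> = (if inj_on \<kappa> {..<n} then 1 else 0)"
    proof (cases "inj_on \<kappa> {..<n}")
      case True
      then have "?A = 1\<^sub>m n" by (intro eq_matI) (auto dest: inj_onD)
      then show ?thesis using True by simp
    next
      case False
      then obtain i j where ij: "i < n" "j < n" "i \<noteq> j" "\<kappa> i = \<kappa> j" by (auto simp: inj_on_def)
      have "Determinant.det ?A = 0"
        by (rule det_identical_rows[of _ n i j]) (use ij in \<open>auto intro!: eq_vecI\<close>)
      then show ?thesis using False by simp
    qed
    finally show ?thesis .
  qed
  have "fredholm_coeff n (\<lambda>x y. \<Sum>k\<in>I. l k * \<phi> k x * \<phi> k y) =
     (LINT x|?PM. (\<Sum>p\<in>?P. \<Sum>\<kappa>\<in>?F. signof p * (\<Prod>i<n. l (\<kappa> i)) * ?g p \<kappa> x))"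
    unfolding fredholm_coeff_def expand ..
  also have "\<dots> = (\<Sum>p\<in>?P. LINT x|?PM. (\<Sum>\<kappa>\<in>?F. signof p * (\<Prod>i<n. l (\<kappa> i)) * ?g p \<kappa> x))"
    by (rule Bochner_Integration.integral_sum) (intro Bochner_Integration.integrable_sum integrable_mult_right int_g)
  also have "\<dots> = (\<Sum>p\<in>?P. \<Sum>\<kappa>\<in>?F. LINT x|?PM. signof p * (\<Prod>i<n. l (\<kappa> i)) * ?g p \<kappa> x)"
    by (intro sum.cong refl Bochner_Integration.integral_sum integrable_mult_right int_g)
  also have "\<dots> = (\<Sum>p\<in>?P. \<Sum>\<kappa>\<in>?F. signof p * (\<Prod>i<n. l (\<kappa> i)) * (\<Prod>i<n. if \<kappa> i = \<kappa> (p i) then 1 else 0))"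
    by (intro sum.cong refl) (subst integral_mult_right_zero, subst val; simp)
  also have "\<dots> = (\<Sum>\<kappa>\<in>?F. \<Sum>p\<in>?P. (\<Prod>i<n. l (\<kappa> i)) * (signof p * (\<Prod>i<n. if \<kappa> i = \<kappa> (p i) then 1 else 0)))"
    by (subst sum.swap) (simp only: mult_ac)
  also have "\<dots> = (\<Sum>\<kappa>\<in>?F. (\<Prod>i<n. l (\<kappa> i)) * (if inj_on \<kappa> {..<n} then 1 else 0))"
    unfolding sum_distrib_left[symmetric] dets ..
  also have "\<dots> = (\<Sum>\<kappa>\<in>{\<kappa>\<in>?F. inj_on \<kappa> {..<n}}. \<Prod>i<n. l (\<kappa> i))"
    by (subst sum.inter_filter[OF fF]) (intro sum.cong refl, simp)
  finally show ?thesis .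
qed

lemma fredholm_coeff_tendsto:
  assumes K: "kcont K" and D: "\<And>N. kcont (D N)"
    and lim: "\<And>x y. x \<in> {a<..<b} \<Longrightarrow> y \<in> {a<..<b} \<Longrightarrow> (\<lambda>N. D N x y) \<longlonglongrightarrow> K x y"
    and bd: "\<And>N x y. x \<in> {a<..<b} \<Longrightarrow> y \<in> {a<..<b} \<Longrightarrow> \<bar>D N x y\<bar> \<le> C"
  shows "(\<lambda>N. fredholm_coeff n (D N)) \<longlonglongrightarrow> fredholm_coeff n K"
  unfolding fredholm_coeff_def
proof (rule integral_dominated_convergence[where w = "\<lambda>x. (\<Sum>p | p permutes {..<n}. C ^ n) * (\<Prod>i<n. 1)"])
  interpret product_sigma_finite "\<lambda>_::nat. M" by (rule product_sigma_finite_M)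
  let ?PM = "Pi\<^sub>M {..<n} (\<lambda>_. M)"
  have id: "(\<lambda>x. x) \<in> measurable M borel"
    by (rule cont_measurable[OF continuous_on_id])
  have comp: "(\<lambda>x. x i) \<in> borel_measurable ?PM" if "i < n" for i
  proof -
    have "(\<lambda>x. x i) \<in> measurable ?PM M" by (rule measurable_component_singleton) (use that in simp)
    from measurable_compose[OF this id] show ?thesis .
  qed
  have ms: "(\<lambda>x. Determinant.det (Matrix.mat n n (\<lambda>(i, j). R (x i) (x j)))) \<in> borel_measurable ?PM"
    if R: "kcont R" for R
    unfolding det_mat_left
  proof (intro borel_measurable_sum borel_measurable_times borel_measurable_const borel_measurable_prod)
    fix p i assume p: "p \<in> {p. p permutes {..<n}}" and i: "i \<in> {..<n}"
    have Rm: "(\<lambda>q. R (fst q) (snd q)) \<in> borel_measurable (borel \<Otimes>\<^sub>M borel)"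
      using borel_measurable_continuous_onI[OF R] by (simp add: borel_prod)
    have "p i < n" using permutes_in_image[of p "{..<n}" i] p i by simp
    with i have "(\<lambda>x. (x (p i), x i)) \<in> measurable ?PM (borel \<Otimes>\<^sub>M borel)"
      by (intro measurable_Pair comp) auto
    from measurable_compose[OF this Rm] show "(\<lambda>x. R (x (p i)) (x i)) \<in> borel_measurable ?PM" by simp
  qed
  show "(\<lambda>x. Determinant.det (Matrix.mat n n (\<lambda>(i, j). K (x i) (x j)))) \<in> borel_measurable ?PM" by (rule ms[OF K])
  show "(\<lambda>x. Determinant.det (Matrix.mat n n (\<lambda>(i, j). D N (x i) (x j)))) \<in> borel_measurable ?PM" for N by (rule ms[OF D])
  have "integrable ?PM (\<lambda>x. \<Prod>i<n. 1 :: real)"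
    by (rule product_integrable_prod) (auto intro!: cont_integrable continuous_on_const)
  then show "integrable ?PM (\<lambda>x. (\<Sum>p | p permutes {..<n}. C ^ n) * (\<Prod>i<n. 1))"
    by (rule integrable_mult_right)
  have sp: "x i \<in> {a<..<b}" if "x \<in> space ?PM" "i < n" for x i
    using that by (auto simp: space_PiM PiE_iff)
  have pi: "p i < n" if "p permutes {..<n}" "i < n" for p i
    using permutes_in_image[OF that(1), of i] that(2) by simp
  show "AE x in ?PM. (\<lambda>N. Determinant.det (Matrix.mat n n (\<lambda>(i, j). D N (x i) (x j))))
      \<longlonglongrightarrow> Determinant.det (Matrix.mat n n (\<lambda>(i, j). K (x i) (x j)))"
    unfolding det_mat_left
    by (intro AE_I2 tendsto_sum tendsto_mult tendsto_const tendsto_prod lim sp) (auto intro: pi)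
  show "AE x in ?PM. norm (Determinant.det (Matrix.mat n n (\<lambda>(i, j). D N (x i) (x j))))
      \<le> (\<Sum>p | p permutes {..<n}. C ^ n) * (\<Prod>i<n. 1)" for N
  proof (rule AE_I2)
    fix x assume x: "x \<in> space ?PM"
    have "norm (signof p * (\<Prod>i<n. D N (x (p i)) (x i))) \<le> C ^ n" if p: "p permutes {..<n}" for p
    proof -
      have "norm (signof p * (\<Prod>i<n. D N (x (p i)) (x i))) = (\<Prod>i<n. \<bar>D N (x (p i)) (x i)\<bar>)"
        by (simp add: abs_mult abs_prod sign_def)
      also have "\<dots> \<le> (\<Prod>i<n. C)"
        by (intro prod_mono conjI bd sp[OF x] abs_ge_zero) (auto intro: pi[OF p])
      finally show ?thesis by simp
    qed
    then show "norm (Determinant.det (Matrix.mat n n (\<lambda>(i, j). D N (x i) (x j))))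
      \<le> (\<Sum>p | p permutes {..<n}. C ^ n) * (\<Prod>i<n. 1)"
      unfolding det_mat_left by (simp only: prod.neutral_const mult_1_right) (intro order_trans[OF norm_sum] sum_mono; simp)
  qed
qed

lemma mercerD:
  assumes "mercer K lam \<phi>"
  shows "cont (\<phi> n)" "0 \<le> lam n" "kop K (\<phi> n) x = lam n * \<phi> n x"
    "lam i \<noteq> 0 \<Longrightarrow> lam j \<noteq> 0 \<Longrightarrow> ip (\<phi> i) (\<phi> j) = (if i = j then 1 else 0)"
    "x \<in> {a..b} \<Longrightarrow> (\<Sum>k<N. lam k * (\<phi> k x)\<^sup>2) \<le> K x x"
    "x \<in> {a..b} \<Longrightarrow> y \<in> {a..b} \<Longrightarrow> (\<lambda>k. lam k * \<phi> k x * \<phi> k y) sums K x y"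
  using assms unfolding mercer_def by blast+

lemma mercer_bound:
  assumes m: "mercer K lam \<phi>" and K: "kcont K"
  obtains C where "0 \<le> C" "\<And>N x y. x \<in> {a..b} \<Longrightarrow> y \<in> {a..b} \<Longrightarrow> \<bar>\<Sum>k<N. lam k * \<phi> k x * \<phi> k y\<bar> \<le> C"
    "\<And>N. (\<Sum>k<N. lam k) \<le> C"
proof -
  note c = mercerD(1)[OF m] and lam0 = mercerD(2)[OF m] and diag = mercerD(5)[OF m]
  obtain C where "\<And>x. x \<in> {a..b} \<Longrightarrow> \<bar>K x x\<bar> \<le> C"
    by (rule cont_bounded[OF kernel_compose[OF K continuous_on_id continuous_on_id]]) (rule that)
  then have C: "K x x \<le> C" if "x \<in> {a..b}" for x using that by (simp add: abs_le_iff)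
  have C0: "0 \<le> C" using C[of a] diag[of a 0] ab by simp
  have 1: "\<bar>\<Sum>k<N. lam k * \<phi> k x * \<phi> k y\<bar> \<le> C" if x: "x \<in> {a..b}" and y: "y \<in> {a..b}" for N x y
  proof -
    have "\<bar>\<Sum>k<N. lam k * \<phi> k x * \<phi> k y\<bar> \<le> (\<Sum>k<N. (lam k * (\<phi> k x)\<^sup>2 + lam k * (\<phi> k y)\<^sup>2) / 2)"
    proof (rule order_trans[OF sum_abs], rule sum_mono)
      fix k
      have "\<bar>\<phi> k x * \<phi> k y\<bar> \<le> ((\<phi> k x)\<^sup>2 + (\<phi> k y)\<^sup>2) / 2"
        using mult_le_mean_squares[of "\<bar>\<phi> k x\<bar>" "\<bar>\<phi> k y\<bar>"] by (simp add: abs_mult)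
      from mult_left_mono[OF this lam0[of k]]
      show "\<bar>lam k * \<phi> k x * \<phi> k y\<bar> \<le> (lam k * (\<phi> k x)\<^sup>2 + lam k * (\<phi> k y)\<^sup>2) / 2"
        using lam0[of k] by (simp add: abs_mult algebra_simps)
    qed
    also have "\<dots> = ((\<Sum>k<N. lam k * (\<phi> k x)\<^sup>2) + (\<Sum>k<N. lam k * (\<phi> k y)\<^sup>2)) / 2"
      by (induction N) (simp_all add: add_divide_distrib)
    also have "\<dots> \<le> C"
      using add_mono[OF order_trans[OF diag[OF x, of N] C[OF x]] order_trans[OF diag[OF y, of N] C[OF y]]] by simp
    finally show ?thesis .
  qed
  have lam_nrm: "lam k * ip (\<phi> k) (\<phi> k) = lam k" for k using mercerD(4)[OF m, of k k] by (cases "lam k = 0") auto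
  have 2: "(\<Sum>k<N. lam k) \<le> (b - a) * C" for N
    by (rule eigenvalue_sum_bound[OF c lam_nrm]) (use diag C in \<open>blast intro: order_trans\<close>)
  show ?thesis
  proof (rule that[of "max C ((b - a) * C)"])
    show "0 \<le> max C ((b - a) * C)" using C0 by simp
    show "\<bar>\<Sum>k<N. lam k * \<phi> k x * \<phi> k y\<bar> \<le> max C ((b - a) * C)" if "x \<in> {a..b}" "y \<in> {a..b}" for N x y
      using 1[OF that, of N] by linarith
    show "(\<Sum>k<N. lam k) \<le> max C ((b - a) * C)" for N
      using 2[of N] by linarith
  qed
qed

text \<open>The partial sums of the expansion have finite rank, so their determinants are finite products. The
coefficients converge by dominated convergence. The \<open>n\<close>-th one is \<open>n!\<close> times an elementary symmetric sum
of eigenvalues, hence at most \<open>C\<^sup>n\<close> with \<open>C\<close> a bound for the trace, and this majorant is summable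
against \<open>\<bar>\<sigma>\<bar>\<^sup>n / n!\<close>, so that Tannery's theorem applies.\<close>

theorem mercer_fredholm_det:
  assumes m: "mercer K lam \<phi>" and K: "kcont K"
  shows "(\<lambda>N. \<Prod>k<N. 1 - \<sigma> * lam k) \<longlonglongrightarrow> fredholm_det a b K \<sigma>" and "summable lam"
proof -
  note lam0 = mercerD(2)[OF m] and c = mercerD(1)[OF m]
  obtain C where C: "0 \<le> C" "\<And>N x y. x \<in> {a..b} \<Longrightarrow> y \<in> {a..b} \<Longrightarrow> \<bar>\<Sum>k<N. lam k * \<phi> k x * \<phi> k y\<bar> \<le> C"
    "\<And>N. (\<Sum>k<N. lam k) \<le> C"
    using mercer_bound[OF m K] by blast
  show "summable lam" by (rule summableI_nonneg_bounded[OF lam0 C(3)])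
  define I where "I N = {k. k < N \<and> lam k \<noteq> 0}" for N
  have fin: "finite (I N)" for N by (simp add: I_def)
  have Isum: "(\<Sum>k<N. lam k * f k) = (\<Sum>k\<in>I N. lam k * f k)" for N and f :: "nat \<Rightarrow> real"
    by (rule sum.mono_neutral_right) (auto simp: I_def)
  define D where "D N x y = (\<Sum>k\<in>I N. lam k * \<phi> k x * \<phi> k y)" for N x y
  have D_eq: "D N x y = (\<Sum>k<N. lam k * \<phi> k x * \<phi> k y)" for N x y
    unfolding D_def mult.assoc Isum ..
  define E where "E N n = (\<Sum>\<kappa>\<in>{\<kappa>\<in>{..<n} \<rightarrow>\<^sub>E I N. inj_on \<kappa> {..<n}}. \<Prod>i<n. lam (\<kappa> i))" for N n :: nat
  have E_fred: "fredholm_coeff n (D N) = E N n" for N n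
    unfolding E_def D_def
    by (rule fredholm_coeff_finite_rank[OF fin c], rule mercerD(4)[OF m]) (auto simp: I_def)
  have kD: "kcont (D N)" for N
    unfolding D_def by (intro continuous_on_sum continuous_on_mult continuous_on_const cont_fst cont_snd c)
  have Elim: "(\<lambda>N. E N n) \<longlonglongrightarrow> fredholm_coeff n K" for n
    unfolding E_fred[symmetric]
  proof (rule fredholm_coeff_tendsto[OF K kD])
    show "(\<lambda>N. D N x y) \<longlonglongrightarrow> K x y" if "x \<in> {a<..<b}" "y \<in> {a<..<b}" for x y
      using mercerD(6)[OF m, of x y] that unfolding D_eq sums_def by simp
    show "\<bar>D N x y\<bar> \<le> C" if "x \<in> {a<..<b}" "y \<in> {a<..<b}" for N x y
      unfolding D_eq by (rule C(2)) (use that in auto)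
  qed
  have E0: "0 \<le> E N n" and EC: "E N n \<le> C ^ n" for N n
  proof -
    show "0 \<le> E N n" unfolding E_def by (intro sum_nonneg prod_nonneg) (use lam0 in auto)
    have "E N n \<le> (\<Sum>\<kappa>\<in>{..<n} \<rightarrow>\<^sub>E I N. \<Prod>i<n. lam (\<kappa> i))"
      unfolding E_def by (rule sum_mono2) (auto intro!: prod_nonneg lam0 finite_PiE fin)
    also have "\<dots> = (\<Prod>i<n. \<Sum>k\<in>I N. lam k)"
      by (rule prod_sum_PiE[symmetric]) (auto simp: fin)
    also have "\<dots> \<le> C ^ n"
      using C(3)[of N] Isum[of "\<lambda>_. 1" N] by (simp add: power_mono sum_nonneg lam0)
    finally show "E N n \<le> C ^ n" .
  qed
  let ?a = "\<lambda>n N. (- \<sigma>) ^ n / fact n * E N n"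
  have prod: "(\<lambda>n. ?a n N) sums (\<Prod>k<N. 1 - \<sigma> * lam k)" for N
  proof -
    have "(\<lambda>n. ?a n N) sums (\<Prod>k\<in>I N. 1 + (- \<sigma>) * lam k)"
      unfolding E_def by (rule prod_one_plus_eq_injections[OF fin])
    also have "(\<Prod>k\<in>I N. 1 + (- \<sigma>) * lam k) = (\<Prod>k<N. 1 + (- \<sigma>) * lam k)"
      by (rule prod.mono_neutral_left) (auto simp: I_def)
    finally show ?thesis by simp
  qed
  have "(\<lambda>N. \<Sum>n. ?a n N) \<longlonglongrightarrow> (\<Sum>n. (- \<sigma>) ^ n / fact n * fredholm_coeff n K)"
  proof (rule tannerys_theorem[THEN conjunct2, THEN conjunct2])
    show "(\<lambda>N. ?a n N) \<longlonglongrightarrow> (- \<sigma>) ^ n / fact n * fredholm_coeff n K" for n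
      by (rule tendsto_mult_left[OF Elim])
    show "\<forall>\<^sub>F (n, N) in sequentially \<times>\<^sub>F sequentially. norm (?a n N) \<le> (\<bar>\<sigma>\<bar> * C) ^ n /\<^sub>R fact n"
    proof (rule always_eventually, clarify)
      fix n N
      have "norm (?a n N) = \<bar>\<sigma>\<bar> ^ n / fact n * E N n"
        using E0[of N n] by (simp add: abs_mult power_abs)
      also have "\<dots> \<le> \<bar>\<sigma>\<bar> ^ n / fact n * C ^ n"
        by (rule mult_left_mono[OF EC]) simp
      finally show "norm (?a n N) \<le> (\<bar>\<sigma>\<bar> * C) ^ n /\<^sub>R fact n"
        by (simp add: power_mult_distrib field_simps)
    qed
    show "summable (\<lambda>n. (\<bar>\<sigma>\<bar> * C) ^ n /\<^sub>R fact n)" by (rule summable_exp_generic)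
  qed simp
  then show "(\<lambda>N. \<Prod>k<N. 1 - \<sigma> * lam k) \<longlonglongrightarrow> fredholm_det a b K \<sigma>"
    unfolding fredholm_det_def fredholm_coeff_def[symmetric] sums_unique[OF prod, symmetric] .
qed

end

section \<open>The sine kernel\<close>

text \<open>The kernel is a superposition of cosines with positive weight; continuity and positivity both follow
from this.\<close>

lemma sine_kernel_integral:
  assumes "0 \<le> s"
  shows "sine_kernel s x y = (1 / pi) * (LINT \<xi>|interval_measure_on 0 s. cos (\<xi> * (x - y)))"
proof -
  have "(LINT \<xi>|interval_measure_on 0 s. cos (\<xi> * (x - y))) = integral {0..s} (\<lambda>\<xi>. cos (\<xi> * (x - y)))"
    by (rule integral_interval_measure_HK) (intro continuous_intros)
  also have "\<dots> = (if x = y then s else sin (s * (x - y)) / (x - y))"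
  proof (cases "x = y")
    case False
    have "((\<lambda>\<xi>. cos (\<xi> * (x - y))) has_integral sin (s * (x - y)) / (x - y) - sin (0 * (x - y)) / (x - y)) {0..s}"
      by (rule fundamental_theorem_of_calculus[OF assms])
         (use False in \<open>auto intro!: derivative_eq_intros simp: has_real_derivative_iff_has_vector_derivative[symmetric]\<close>)
    then show ?thesis using False by (simp add: integral_unique)
  qed (use assms in simp)
  finally show ?thesis by (simp add: sine_kernel_def)
qed

interpretation std: real_interval "-1" 1
  by unfold_locales simp

definition cos_transform :: "(real \<Rightarrow> real) \<Rightarrow> real \<Rightarrow> real" where
  "cos_transform f \<xi> = (LINT x|interval_measure_on (-1) 1. cos (\<xi> * x) * f x)"

definition sin_transform :: "(real \<Rightarrow> real) \<Rightarrow> real \<Rightarrow> real" where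
  "sin_transform f \<xi> = (LINT x|interval_measure_on (-1) 1. sin (\<xi> * x) * f x)"

text \<open>The squared modulus of the Fourier transform of \<open>f\<close> restricted to \<open>(-1, 1)\<close>.\<close>

definition energy :: "(real \<Rightarrow> real) \<Rightarrow> real \<Rightarrow> real" where
  "energy f \<xi> = (cos_transform f \<xi>)\<^sup>2 + (sin_transform f \<xi>)\<^sup>2"

lemma cos_pair: "continuous_on UNIV (\<lambda>p::real\<times>real. cos (fst p * snd p))"
  and sin_pair: "continuous_on UNIV (\<lambda>p::real\<times>real. sin (fst p * snd p))"
  by (intro continuous_intros)+

lemma cont_transform:
  assumes "continuous_on UNIV f"
  shows "continuous_on UNIV (cos_transform f)" "continuous_on UNIV (sin_transform f)"
    "continuous_on UNIV (energy f)"
proof -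
  show 1: "continuous_on UNIV (cos_transform f)"
    unfolding cos_transform_def
    by (rule param_cont[of "\<lambda>\<xi> x. cos (\<xi> * x) * f x", OF continuous_on_mult[OF cos_pair cont_snd[OF assms]]])
  show 2: "continuous_on UNIV (sin_transform f)"
    unfolding sin_transform_def
    by (rule param_cont[of "\<lambda>\<xi> x. sin (\<xi> * x) * f x", OF continuous_on_mult[OF sin_pair cont_snd[OF assms]]])
  show "continuous_on UNIV (energy f)"
    unfolding energy_def by (intro continuous_on_add continuous_on_power 1 2)
qed

lemma sine_kernel_continuous:
  assumes "0 \<le> s"
  shows "continuous_on UNIV (\<lambda>p. sine_kernel s (fst p) (snd p))"
proof -
  have "continuous_on UNIV (\<lambda>t. sine_kernel s t 0)"
    unfolding sine_kernel_integral[OF assms] diff_0_right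
    by (intro continuous_on_mult_left param_cont[of "\<lambda>t \<xi>. cos (\<xi> * t)"] continuous_intros)
  then have "continuous_on UNIV (\<lambda>p::real\<times>real. sine_kernel s (fst p - snd p) 0)"
    by (rule continuous_on_compose2[OF _ continuous_on_diff[OF continuous_on_fst continuous_on_snd]])
       (auto intro: continuous_on_id)
  moreover have "sine_kernel s (x - y) 0 = sine_kernel s x y" for x y
    by (simp add: sine_kernel_def)
  ultimately show ?thesis by simp
qed

lemma sine_kernel_form:
  assumes s: "0 \<le> s" and f: "continuous_on UNIV f"
  shows "std.ip (std.kop (sine_kernel s) f) f = (1 / pi) * integral {0..s} (energy f)"
proof -
  let ?M = "interval_measure_on (-1) 1" and ?N = "interval_measure_on 0 s"
  let ?C = "cos_transform f" and ?S = "sin_transform f"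
  note ct = cont_transform[OF f]
  have intM: "integrable ?M (\<lambda>x. g x * f x)" if "continuous_on UNIV g" for g :: "real \<Rightarrow> real"
    by (intro std.cont_integrable continuous_on_mult that f)
  have cc: "continuous_on UNIV (\<lambda>x. cos (\<xi> * x))" "continuous_on UNIV (\<lambda>x. sin (\<xi> * x))" for \<xi> :: real
    by (intro continuous_intros)+
  have inner: "(LINT y|?M. cos (\<xi> * (x - y)) * f y) = cos (\<xi> * x) * ?C \<xi> + sin (\<xi> * x) * ?S \<xi>" for x \<xi>
  proof -
    have "(LINT y|?M. cos (\<xi> * (x - y)) * f y)
        = (LINT y|?M. cos (\<xi> * x) * (cos (\<xi> * y) * f y) + sin (\<xi> * x) * (sin (\<xi> * y) * f y))"
      by (intro Bochner_Integration.integral_cong refl) (simp add: right_diff_distrib cos_diff algebra_simps)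
    also have "\<dots> = cos (\<xi> * x) * ?C \<xi> + sin (\<xi> * x) * ?S \<xi>"
      by (subst Bochner_Integration.integral_add)
         (auto intro!: integrable_mult_right intM cc simp: cos_transform_def sin_transform_def)
    finally show ?thesis .
  qed
  have kop: "std.kop (sine_kernel s) f x = (1 / pi) * (LINT \<xi>|?N. cos (\<xi> * x) * ?C \<xi> + sin (\<xi> * x) * ?S \<xi>)" for x
  proof -
    have "std.kop (sine_kernel s) f x = (LINT y|?M. (1 / pi) * (LINT \<xi>|?N. cos (\<xi> * (x - y)) * f y))"
      unfolding std.kop_def sine_kernel_integral[OF s] by (simp only: integral_mult_left_zero mult.assoc)
    also have "\<dots> = (1 / pi) * (LINT y|?M. LINT \<xi>|?N. cos (\<xi> * (x - y)) * f y)"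
      by (rule integral_mult_right_zero)
    also have "(LINT y|?M. LINT \<xi>|?N. cos (\<xi> * (x - y)) * f y) = (LINT \<xi>|?N. LINT y|?M. cos (\<xi> * (x - y)) * f y)"
      by (rule interval_measure_swap) (intro continuous_on_mult cont_fst f continuous_intros)
    finally show ?thesis by (simp only: inner)
  qed
  have "std.ip (std.kop (sine_kernel s) f) f
      = (LINT x|?M. (1 / pi) * (LINT \<xi>|?N. (cos (\<xi> * x) * ?C \<xi> + sin (\<xi> * x) * ?S \<xi>) * f x))"
    unfolding std.ip_def kop by (simp only: integral_mult_left_zero mult.assoc)
  also have "\<dots> = (1 / pi) * (LINT x|?M. LINT \<xi>|?N. (cos (\<xi> * x) * ?C \<xi> + sin (\<xi> * x) * ?S \<xi>) * f x)"
    by (rule integral_mult_right_zero)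
  also have "(LINT x|?M. LINT \<xi>|?N. (cos (\<xi> * x) * ?C \<xi> + sin (\<xi> * x) * ?S \<xi>) * f x)
     = (LINT \<xi>|?N. LINT x|?M. (cos (\<xi> * x) * ?C \<xi> + sin (\<xi> * x) * ?S \<xi>) * f x)"
    by (rule interval_measure_swap)
       (intro continuous_on_mult continuous_on_add cont_fst cont_snd f ct; intro continuous_intros)
  also have "\<dots> = (LINT \<xi>|?N. energy f \<xi>)"
  proof (intro Bochner_Integration.integral_cong refl)
    fix \<xi>
    have "(LINT x|?M. (cos (\<xi> * x) * ?C \<xi> + sin (\<xi> * x) * ?S \<xi>) * f x)
       = (LINT x|?M. ?C \<xi> * (cos (\<xi> * x) * f x) + ?S \<xi> * (sin (\<xi> * x) * f x))"
      by (intro Bochner_Integration.integral_cong refl) (simp add: algebra_simps)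
    also have "\<dots> = ?C \<xi> * ?C \<xi> + ?S \<xi> * ?S \<xi>"
      by (subst Bochner_Integration.integral_add)
         (auto intro!: integrable_mult_right intM cc simp: cos_transform_def sin_transform_def)
    finally show "(LINT x|?M. (cos (\<xi> * x) * ?C \<xi> + sin (\<xi> * x) * ?S \<xi>) * f x) = energy f \<xi>"
      by (simp add: energy_def power2_eq_square)
  qed
  also have "\<dots> = integral {0..s} (energy f)"
    by (rule integral_interval_measure_HK[OF continuous_on_subset[OF ct(3) subset_UNIV]])
  finally show ?thesis .
qed

lemma sine_kernel_psd:
  assumes s: "0 \<le> s"
  shows "std.psd (sine_kernel s)"
  unfolding std.psd_def
proof (intro conjI allI impI)
  show "continuous_on UNIV (\<lambda>p. sine_kernel s (fst p) (snd p))" by (rule sine_kernel_continuous[OF s])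
  show "sine_kernel s x y = sine_kernel s y x" for x y
  proof -
    have "cos (\<xi> * (x - y)) = cos (\<xi> * (y - x))" for \<xi>
      using cos_minus[of "\<xi> * (x - y)"] by (simp add: algebra_simps)
    then show ?thesis unfolding sine_kernel_integral[OF s] by simp
  qed
  show "0 \<le> std.ip (std.kop (sine_kernel s) f) f" if "continuous_on UNIV f" for f
    unfolding sine_kernel_form[OF s that]
    by (intro mult_nonneg_nonneg Henstock_Kurzweil_Integration.integral_nonneg integrable_continuous_real
          continuous_on_subset[OF cont_transform(3)[OF that] subset_UNIV]) (auto simp: energy_def)
qed

lemma integral_cos_int:
  "(LINT x|interval_measure_on (-1) 1. cos ((real i - real j) * pi * x)) = (if i = j then 2 else 0)"
proof (cases "i = j")
  case True
  then show ?thesis using measure_interval_measure[of "-1" 1] by simp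
next
  case False
  let ?m = "(real i - real j) * pi"
  have m: "?m \<noteq> 0" using False by simp
  have sn: "sin ?m = 0"
    using sin_zero_iff_int2[of ?m] by (auto intro!: exI[of _ "int i - int j"])
  have "((\<lambda>x. cos (?m * x)) has_integral sin (?m * 1) / ?m - sin (?m * (-1)) / ?m) {-1..1}"
    by (rule fundamental_theorem_of_calculus)
       (use m in \<open>auto intro!: derivative_eq_intros simp: has_real_derivative_iff_has_vector_derivative[symmetric]\<close>)
  then have "integral {-1..1} (\<lambda>x. cos (?m * x)) = 0"
    using sn by (simp add: integral_unique)
  then show ?thesis
    using False by (subst integral_interval_measure_HK) (auto intro!: continuous_intros)
qed

lemma integral_sin_odd: "(LINT x|interval_measure_on (-1) 1. sin (m * x)) = 0"
proof -
  have "integral {-1..1} (\<lambda>x. sin (m * x)) = integral {-1..1} (\<lambda>x. sin (m * (- x)))"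
    using Henstock_Kurzweil_Integration.integral_reflect_real[of 1 "-1" "\<lambda>x. sin (m * x)"] by simp
  then have "integral {-1..1} (\<lambda>x. sin (m * x)) = 0" by simp
  then show ?thesis
    by (subst integral_interval_measure_HK) (auto intro!: continuous_intros)
qed

text \<open>Bessel's inequality for the exponentials with frequencies \<open>c + j \<pi>\<close>, which are orthogonal on
\<open>(-1, 1)\<close> for every shift \<open>c\<close>. Up to a factor \<open>1/2\<close> the functions \<open>p\<^sub>j\<close> and \<open>q\<^sub>j\<close> are the real and
imaginary parts of the \<open>j\<close>-th exponential multiplied by its Fourier coefficient.\<close>

lemma energy_bessel:
  assumes f: "continuous_on UNIV f"
  shows "(\<Sum>j<n. energy f (c + real j * pi)) \<le> 2 * std.ip f f"
proof -
  let ?M = "interval_measure_on (-1) 1"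
  define w where "w j = c + real j * pi" for j
  define C where "C j = cos_transform f (w j)" for j
  define S where "S j = sin_transform f (w j)" for j
  define p where "p j x = C j * cos (w j * x) + S j * sin (w j * x)" for j x
  define q where "q j x = C j * sin (w j * x) - S j * cos (w j * x)" for j x
  have pc: "continuous_on UNIV (p j)" and qc: "continuous_on UNIV (q j)" for j
    unfolding p_def q_def by (intro continuous_intros)+
  have int: "integrable ?M g" if "continuous_on UNIV g" for g :: "real \<Rightarrow> real"
    by (rule std.cont_integrable[OF that])
  have fp: "(LINT x|?M. f x * p j x) = energy f (w j)" for j
  proof -
    have "(LINT x|?M. f x * p j x) = (LINT x|?M. C j * (cos (w j * x) * f x) + S j * (sin (w j * x) * f x))"
      by (intro Bochner_Integration.integral_cong refl) (simp add: p_def algebra_simps)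
    also have "\<dots> = C j * C j + S j * S j"
      by (subst Bochner_Integration.integral_add)
         (auto intro!: integrable_mult_right int continuous_on_mult f continuous_intros
           simp: C_def S_def cos_transform_def sin_transform_def)
    finally show ?thesis by (simp add: energy_def C_def S_def power2_eq_square)
  qed
  have pq: "(LINT x|?M. p i x * p j x + q i x * q j x) = (if i = j then 2 * energy f (w j) else 0)" for i j
  proof -
    have "p i x * p j x + q i x * q j x = (C i * C j + S i * S j) * cos ((real i - real j) * pi * x)
        + (S i * C j - C i * S j) * sin ((real i - real j) * pi * x)" for x
    proof -
      have e: "(real i - real j) * pi * x = w i * x - w j * x" by (simp add: w_def algebra_simps)
      show ?thesis unfolding e cos_diff sin_diff p_def q_def by (simp add: algebra_simps)
    qed
    then have "(LINT x|?M. p i x * p j x + q i x * q j x)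
      = (LINT x|?M. (C i * C j + S i * S j) * cos ((real i - real j) * pi * x)
        + (S i * C j - C i * S j) * sin ((real i - real j) * pi * x))" by simp
    also have "\<dots> = (C i * C j + S i * S j) * (LINT x|?M. cos ((real i - real j) * pi * x))
        + (S i * C j - C i * S j) * (LINT x|?M. sin ((real i - real j) * pi * x))"
      by (subst Bochner_Integration.integral_add)
         (auto intro!: integrable_mult_right int continuous_intros)
    also have "\<dots> = (if i = j then 2 * energy f (w j) else 0)"
      unfolding integral_cos_int integral_sin_odd by (simp add: energy_def C_def S_def power2_eq_square)
    finally show ?thesis .
  qed
  let ?E = "\<Sum>j<n. energy f (w j)"
  have "0 \<le> (LINT x|?M. (f x - (1/2) * (\<Sum>j<n. p j x))\<^sup>2 + ((1/2) * (\<Sum>j<n. q j x))\<^sup>2)"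
    by (intro Bochner_Integration.integral_nonneg) simp
  also have "\<dots> = (LINT x|?M. f x * f x - (\<Sum>j<n. f x * p j x) +
       (1/4) * (\<Sum>i<n. \<Sum>j<n. p i x * p j x + q i x * q j x))"
    by (intro Bochner_Integration.integral_cong refl)
       (simp add: power2_eq_square sum_product sum.distrib sum_distrib_left[symmetric] algebra_simps)
  also have "\<dots> = (LINT x|?M. f x * f x) - (\<Sum>j<n. LINT x|?M. f x * p j x)
     + (1/4) * (\<Sum>i<n. \<Sum>j<n. LINT x|?M. p i x * p j x + q i x * q j x)"
  proof -
    define r where "r i j x = p i x * p j x + q i x * q j x" for i j x
    have 1: "integrable ?M (\<lambda>x. f x * f x)" "\<And>j. integrable ?M (\<lambda>x. f x * p j x)"
      "\<And>i j. integrable ?M (r i j)"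
      unfolding r_def by (intro int continuous_on_mult continuous_on_add f pc qc)+
    show ?thesis
      unfolding r_def[symmetric] by (simp add: 1)
  qed
  also have "\<dots> = std.ip f f - ?E + (1/4) * (2 * ?E)"
    unfolding fp pq by (simp add: std.ip_def sum_distrib_left)
  finally show ?thesis by (simp add: w_def)
qed

lemma energy_even: "energy f (- \<xi>) = energy f \<xi>"
  by (simp add: energy_def cos_transform_def sin_transform_def)

lemma integral_shift_sum:
  fixes g :: "real \<Rightarrow> real"
  assumes g: "continuous_on UNIV g" and h: "0 \<le> h"
  shows "integral {c..c + real n * h} g = (\<Sum>j<n. integral {0..h} (\<lambda>\<theta>. g (\<theta> + (c + real j * h))))"
proof (induction n)
  case (Suc n)
  let ?d = "c + real n * h"
  have "integral {0..h} (\<lambda>\<theta>. g (\<theta> + ?d)) = integral {0 + ?d..h + ?d} g"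
    using integral_shift[of 0 ?d h g] continuous_on_subset[OF g] by (simp add: comp_def)
  moreover have "integral {c..?d} g + integral {?d..?d + h} g = integral {c..?d + h} g"
    by (rule Henstock_Kurzweil_Integration.integral_combine)
       (use h in \<open>auto intro!: integrable_continuous_real continuous_on_subset[OF g]\<close>)
  moreover have "?d + h = c + real (Suc n) * h" by (simp add: algebra_simps)
  ultimately show ?case using Suc by (simp only: sum.lessThan_Suc add_0 add.commute[of h])
qed simp

text \<open>Bessel's inequality holds on every shifted grid of frequencies of step \<open>\<pi>\<close>. Integrating it over the
shift \<open>\<theta> \<in> [0, \<pi>]\<close> bounds the integral of the energy over \<open>[-N\<pi>, N\<pi>]\<close> by \<open>2\<pi> \<parallel>f\<parallel>\<^sup>2\<close>, and the energy
is even, so the integral over \<open>[0, s]\<close> is at most \<open>\<pi> \<parallel>f\<parallel>\<^sup>2\<close>.\<close>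

lemma sine_kernel_le_one:
  assumes s: "0 \<le> s" and f: "continuous_on UNIV f"
  shows "std.ip (std.kop (sine_kernel s) f) f \<le> std.ip f f"
proof -
  note ec = cont_transform(3)[OF f]
  have ei: "energy f integrable_on {x..y}" for x y
    by (intro integrable_continuous_real continuous_on_subset[OF ec]) auto
  obtain N where N: "s \<le> real N * pi"
    using real_arch_simple[of "s / pi"] by (auto simp: field_simps)
  let ?A = "real N * pi"
  have "integral {-?A..?A} (energy f) = (\<Sum>j<2*N. integral {0..pi} (\<lambda>\<theta>. energy f (\<theta> + (- ?A + real j * pi))))"
  proof -
    have "- ?A + real (2 * N) * pi = ?A" by simp
    with integral_shift_sum[OF ec, of pi "- ?A" "2 * N"] show ?thesis by (simp only: pi_ge_zero)
  qed
  also have "\<dots> = integral {0..pi} (\<lambda>\<theta>. \<Sum>j<2*N. energy f (\<theta> + (- ?A + real j * pi)))"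
    by (rule Henstock_Kurzweil_Integration.integral_sum[symmetric])
       (auto intro!: integrable_continuous_real continuous_on_compose2[OF ec] continuous_intros)
  also have "\<dots> \<le> integral {0..pi} (\<lambda>\<theta>. 2 * std.ip f f)"
  proof (rule integral_le)
    show "(\<lambda>\<theta>. \<Sum>j<2*N. energy f (\<theta> + (- ?A + real j * pi))) integrable_on {0..pi}"
      by (auto intro!: integrable_continuous_real continuous_on_sum continuous_on_compose2[OF ec] continuous_intros)
    show "(\<Sum>j<2*N. energy f (\<theta> + (- ?A + real j * pi))) \<le> 2 * std.ip f f" for \<theta>
      using energy_bessel[OF f, of "\<theta> + - ?A" "2 * N"] by (simp only: add.assoc)
  qed (intro integrable_continuous_real continuous_on_const)
  finally have 1: "integral {-?A..?A} (energy f) \<le> 2 * pi * std.ip f f" by (simp add: mult_ac)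
  have "integral {-?A..0} (energy f) = integral {0..?A} (\<lambda>x. energy f (- x))"
    using Henstock_Kurzweil_Integration.integral_reflect_real[of 0 "- ?A" "energy f"] by simp
  then have "integral {-?A..0} (energy f) = integral {0..?A} (energy f)" by (simp add: energy_even)
  moreover have "integral {-?A..0} (energy f) + integral {0..?A} (energy f) = integral {-?A..?A} (energy f)"
    by (rule Henstock_Kurzweil_Integration.integral_combine) (auto intro: ei)
  ultimately have 2: "integral {0..?A} (energy f) \<le> pi * std.ip f f" using 1 by simp
  have "integral {0..s} (energy f) \<le> integral {0..?A} (energy f)"
    by (rule integral_subset_le) (use N in \<open>auto intro: ei simp: energy_def\<close>)
  with 2 have "integral {0..s} (energy f) \<le> pi * std.ip f f" by simp
  then show ?thesis unfolding sine_kernel_form[OF s f] by (simp add: field_simps)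
qed

theorem sine_kernel_eigenvalue_le_1:
  assumes s: "0 \<le> s" and m: "std.mercer (sine_kernel s) lam \<phi>"
  shows "lam n \<le> 1"
proof (cases "lam n = 0")
  case False
  then have n: "std.ip (\<phi> n) (\<phi> n) = 1" using std.mercerD(4)[OF m] by simp
  have "std.kop (sine_kernel s) (\<phi> n) = (\<lambda>x. lam n * \<phi> n x)"
    by (rule ext, rule std.mercerD(3)[OF m])
  then show ?thesis
    using sine_kernel_le_one[OF s std.mercerD(1)[OF m, of n]] n by (simp add: std.ip_scale)
qed simp

section \<open>The limiting distribution of \<open>\<lambda> (1 - \<lambda>)\<close>\<close>

definition log_quot :: "real \<Rightarrow> real \<Rightarrow> real" where
  "log_quot t y = (if y = 0 then t else ln (1 + t * y) / y)"

lemma log_quot_continuous: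
  assumes "0 \<le> t"
  shows "continuous_on {0..} (log_quot t)"
  unfolding continuous_on_eq_continuous_within
proof
  fix y :: real assume y: "y \<in> {0..}"
  show "continuous (at y within {0..}) (log_quot t)"
  proof (cases "y = 0")
    case True
    have "((\<lambda>y. ln (1 + t * y)) has_field_derivative t) (at 0)"
      by (auto intro!: derivative_eq_intros)
    then have "((\<lambda>y. ln (1 + t * y) / y) \<longlongrightarrow> t) (at 0)"
      unfolding has_field_derivative_iff by simp
    then have "(log_quot t \<longlongrightarrow> t) (at 0)"
      by (rule Lim_transform_eventually) (auto simp: log_quot_def eventually_at_filter)
    then have "isCont (log_quot t) 0" by (simp add: isCont_def log_quot_def)
    then show ?thesis unfolding True by (rule continuous_at_imp_continuous_at_within)
  next
    case False
    with y have y0: "y > 0" by simp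
    have "1 + t * y > 0" using y0 assms by (simp add: add_pos_nonneg)
    then have iC: "isCont (\<lambda>y. ln (1 + t * y) / y) y" using False by (auto intro!: continuous_intros)
    have ev: "\<forall>\<^sub>F y in nhds y. ln (1 + t * y) / y = log_quot t y"
    proof (rule eventually_mono)
      show "\<forall>\<^sub>F y in nhds y. y \<in> {0<..}" using y0 by (intro eventually_nhds_in_open) auto
    qed (simp add: log_quot_def)
    from isCont_cong[OF ev] iC have "isCont (log_quot t) y" by simp
    then show ?thesis by (rule continuous_at_imp_continuous_at_within)
  qed
qed

text \<open>The derivative of the difference is the remainder \<open>(-y)\<^bsup>k+1\<^esup> / (1 + y)\<close> of a geometric sum, and the mean
value theorem applies.\<close>

lemma log_taylor_bound:
  fixes x :: real
  assumes x: "0 \<le> x"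
  shows "\<bar>ln (1 + x) - (\<Sum>j\<le>k. (-1) ^ j * x ^ Suc j / real (Suc j))\<bar> \<le> x ^ (k + 2)"
proof (cases "x = 0")
  case False
  with x have x: "x > 0" by simp
  define R where "R x = ln (1 + x) - (\<Sum>j\<le>k. (-1) ^ j * x ^ Suc j / real (Suc j))" for x :: real
  have der: "(R has_real_derivative 1 / (1 + y) - (\<Sum>j\<le>k. (- y) ^ j)) (at y)" if "0 \<le> y" for y
  proof -
    have 1: "((\<lambda>x. (-1) ^ j * x ^ Suc j / real (Suc j)) has_real_derivative (- y) ^ j) (at y)" for j
    proof -
      have "((\<lambda>x. (-1) ^ j * x ^ Suc j / real (Suc j)) has_real_derivative (-1) ^ j * (real (Suc j) * y ^ j) / real (Suc j)) (at y)"
        using DERIV_cdivide[OF DERIV_cmult[OF DERIV_pow[of "Suc j" y]], of "(-1)^j" "real (Suc j)"] by simp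
      also have "(-1) ^ j * (real (Suc j) * y ^ j) / real (Suc j) = (- y) ^ j"
        by (simp add: power_minus[of y] del: of_nat_Suc)
      finally show ?thesis .
    qed
    have 2: "((\<lambda>x. \<Sum>j\<le>k. (-1) ^ j * x ^ Suc j / real (Suc j)) has_real_derivative (\<Sum>j\<le>k. (- y) ^ j)) (at y)"
      by (rule DERIV_sum) (rule 1)
    have 3: "((\<lambda>x. ln (1 + x)) has_real_derivative 1 / (1 + y)) (at y)"
      using that by (auto intro!: derivative_eq_intros)
    show ?thesis unfolding R_def by (rule DERIV_diff[OF 3 2])
  qed
  have "\<exists>z. 0 < z \<and> z < x \<and> R x - R 0 = (x - 0) * (1 / (1 + z) - (\<Sum>j\<le>k. (- z) ^ j))"
    by (rule MVT2[OF x]) (use der in auto)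
  then obtain z where z: "0 < z" "z < x" "R x - R 0 = x * (1 / (1 + z) - (\<Sum>j\<le>k. (- z) ^ j))" by auto
  have "(1 + z) * (\<Sum>j\<le>k. (- z) ^ j) = 1 - (- z) ^ Suc k"
    using sum_gp_basic[of "- z" k] by simp
  then have D: "1 / (1 + z) - (\<Sum>j\<le>k. (- z) ^ j) = (- z) ^ Suc k / (1 + z)"
    using z(1) by (simp add: field_simps)
  have "\<bar>(- z) ^ Suc k / (1 + z)\<bar> = z ^ Suc k / (1 + z)"
    using z(1) by (simp add: abs_mult power_abs)
  also have "\<dots> \<le> z ^ Suc k / 1" using z(1) by (intro divide_left_mono) auto
  also have "\<dots> \<le> x ^ Suc k" using z by (simp only: div_by_1, intro power_mono) auto
  finally have "x * \<bar>(- z) ^ Suc k / (1 + z)\<bar> \<le> x * x ^ Suc k"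
    using x by (intro mult_left_mono) auto
  moreover have "\<bar>R x\<bar> = x * \<bar>(- z) ^ Suc k / (1 + z)\<bar>"
  proof -
    have "R x = x * ((- z) ^ Suc k / (1 + z))" using z(3) unfolding D by (simp add: R_def)
    then show ?thesis using x by (simp only: abs_mult abs_of_pos)
  qed
  ultimately show ?thesis by (simp add: R_def)
qed simp

text \<open>The parameter \<open>t = -(\<sigma> + \<sigma>') = -\<sigma>\<sigma>'\<close> of the pair \<open>\<sigma> = 1 - e\<^sup>v\<close>, \<open>\<sigma>' = 1 - e\<^sup>-\<^sup>v\<close>.\<close>

definition pair_param :: "real \<Rightarrow> real" where
  "pair_param v = exp v + exp (- v) - 2"

lemma pair_param_nonneg: "0 \<le> pair_param v"
proof -
  have "pair_param v = (exp v - 1)\<^sup>2 / exp v"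
    by (simp add: pair_param_def exp_minus field_simps power2_eq_square)
  then show ?thesis by simp
qed

lemma pair_factorisation:
  "(1 - (1 - exp v) * x) * (1 - (1 - exp (- v)) * x) = 1 + pair_param v * (x * (1 - x))"
proof -
  have "(1 - (1 - exp v) * x) * (1 - (1 - exp (- v)) * x)
      = (1 - x)\<^sup>2 + x\<^sup>2 * (exp v * exp (- v)) + x * (1 - x) * (exp v + exp (- v))"
    unfolding power2_eq_square by (simp only: algebra_simps)
  also have "exp v * exp (- v) = 1" by (simp add: mult_exp_exp)
  finally show ?thesis by (simp add: pair_param_def power2_eq_square algebra_simps)
qed

lemma pair_param_deriv: "(pair_param has_real_derivative exp v - exp (- v)) (at v)"
  unfolding pair_param_def by (auto intro!: derivative_eq_intros)

lemma log_quot_pair_param_deriv: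
  assumes y: "0 \<le> y"
  shows "((\<lambda>v. log_quot (pair_param v) y) has_real_derivative (exp v - exp (- v)) / (1 + pair_param v * y)) (at v)"
proof (cases "y = 0")
  case True
  then show ?thesis using pair_param_deriv[of v] by (simp add: log_quot_def)
next
  case False
  have pos: "0 < 1 + pair_param v * y" using mult_nonneg_nonneg[OF pair_param_nonneg y, of v] by linarith
  have "((\<lambda>v. 1 + pair_param v * y) has_real_derivative (exp v - exp (- v)) * y) (at v)"
    by (auto intro!: derivative_eq_intros pair_param_deriv)
  from DERIV_cdivide[OF DERIV_chain2[OF DERIV_ln_divide[OF pos] this], of y]
  show ?thesis using False by (simp add: log_quot_def)
qed

text \<open>Both sides vanish at \<open>v = 0\<close>, so it suffices to compare derivatives in \<open>v\<close>. Differentiation under the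
integral leaves \<open>(e\<^sup>v - e\<^sup>-\<^sup>v) / (P Q)\<close>, where \<open>P\<close> and \<open>Q\<close> are the two linear factors of
\<open>1 + t x(1 - x)\<close>; this is the derivative of \<open>ln P - ln Q\<close> in \<open>x\<close>, and the integral is \<open>2v\<close>.\<close>

lemma integral_log_quot:
  "integral {0..1} (\<lambda>x. log_quot (pair_param v) (x * (1 - x))) = v\<^sup>2"
proof -
  define J where "J v = integral {0..1} (\<lambda>x. log_quot (pair_param v) (x * (1 - x)))" for v
  define f' where "f' v x = (exp v - exp (- v)) / (1 + pair_param v * (x * (1 - x)))" for v x :: real
  have y0: "0 \<le> x * (1 - x)" if "x \<in> {0..1}" for x :: real using that by simp
  have pos: "0 < 1 + pair_param v * (x * (1 - x))" if "x \<in> {0..1}" for v x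
    using mult_nonneg_nonneg[OF pair_param_nonneg[of v] y0[OF that]] by linarith
  have J': "(J has_real_derivative 2 * v) (at v)" for v
  proof -
    have "((\<lambda>v. integral (cbox 0 1) (\<lambda>x. log_quot (pair_param v) (x * (1 - x)))) has_field_derivative
        integral (cbox 0 1) (f' v)) (at v within UNIV)"
    proof (rule leibniz_rule_field_derivative)
      fix v x :: real assume "x \<in> cbox 0 1"
      then have x: "x \<in> {0..1}" by simp
      show "((\<lambda>v. log_quot (pair_param v) (x * (1 - x))) has_field_derivative f' v x) (at v within UNIV)"
        unfolding f'_def by (rule log_quot_pair_param_deriv[OF y0[OF x]])
    next
      fix v :: real
      show "(\<lambda>x. log_quot (pair_param v) (x * (1 - x))) integrable_on cbox 0 1"
        unfolding box_real
        by (intro integrable_continuous_real continuous_on_compose2[OF log_quot_continuous[OF pair_param_nonneg]] continuous_intros) auto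
    next
      have "continuous_on (UNIV \<times> {0..1}) (\<lambda>p. f' (fst p) (snd p))"
        unfolding f'_def pair_param_def
      proof (intro continuous_intros ballI)
        fix p :: "real \<times> real" assume "p \<in> UNIV \<times> {0..1}"
        then show "1 + (exp (fst p) + exp (- fst p) - 2) * (snd p * (1 - snd p)) \<noteq> 0"
          using pos[of "snd p" "fst p"] unfolding pair_param_def by auto
      qed
      then show "continuous_on (UNIV \<times> cbox 0 1) (\<lambda>(v, x). f' v x)"
        by (simp add: case_prod_beta')
    qed auto
    moreover have "integral (cbox 0 1) (f' v) = 2 * v"
    proof -
      define P where "P x = 1 - x + x * exp v" for x
      define Q where "Q x = 1 - x + x * exp (- v)" for x
      have PQpos: "0 < P x" "0 < Q x" if "x \<in> {0..1}" for x
        unfolding P_def Q_def using that by (cases "x = 0"; simp add: add_nonneg_pos)+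
      have PQ: "P x * Q x = 1 + pair_param v * (x * (1 - x))" for x
      proof -
        have "P x * Q x = (1 - (1 - exp v) * x) * (1 - (1 - exp (- v)) * x)"
          by (simp add: P_def Q_def algebra_simps)
        then show ?thesis by (simp only: pair_factorisation)
      qed
      have "(f' v has_integral ((ln (P 1) - ln (Q 1)) - (ln (P 0) - ln (Q 0)))) {0..1}"
      proof (rule fundamental_theorem_of_calculus)
        fix x :: real assume x: "x \<in> {0..1}"
        have "((\<lambda>x. ln (P x) - ln (Q x)) has_real_derivative (exp v - 1) / P x - (exp (- v) - 1) / Q x) (at x)"
          unfolding P_def Q_def using PQpos[OF x]
          by (auto intro!: derivative_eq_intros simp: P_def Q_def)
        moreover have "(exp v - 1) / P x - (exp (- v) - 1) / Q x = f' v x"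
        proof -
          have "(exp v - 1) / P x - (exp (- v) - 1) / Q x = ((exp v - 1) * Q x - (exp (- v) - 1) * P x) / (P x * Q x)"
            using PQpos[OF x] by (simp add: field_simps)
          also have "(exp v - 1) * Q x - (exp (- v) - 1) * P x = exp v - exp (- v)"
            unfolding P_def Q_def by (simp only: algebra_simps)
          finally show ?thesis unfolding f'_def PQ .
        qed
        ultimately have "((\<lambda>x. ln (P x) - ln (Q x)) has_real_derivative f' v x) (at x)" by simp
        then show "((\<lambda>x. ln (P x) - ln (Q x)) has_vector_derivative f' v x) (at x within {0..1})"
          by (simp add: has_real_derivative_iff_has_vector_derivative has_vector_derivative_at_within)
      qed simp
      then have "(f' v has_integral (2 * v)) {0..1}" by (simp add: P_def Q_def)
      then show ?thesis by (simp add: integral_unique)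
    qed
    ultimately show ?thesis unfolding J_def[abs_def] by simp
  qed
  have "((\<lambda>v. J v - v\<^sup>2) has_real_derivative 0) (at v)" for v
    using DERIV_diff[OF J' DERIV_pow[of 2 v]] by simp
  then have "J v - v\<^sup>2 = J 0 - 0\<^sup>2" by (intro DERIV_isconst_all) auto
  moreover have "log_quot (pair_param 0) y = 0" for y by (simp add: log_quot_def pair_param_def)
  then have "J 0 = 0" by (simp add: J_def)
  ultimately show ?thesis by (simp add: J_def)
qed

lemma integral_logit:
  fixes x y :: real
  assumes "0 < x" "x \<le> y" "y < 1"
  shows "((\<lambda>x. 1 / (x * (1 - x))) has_integral (ln (y / (1 - y)) - ln (x / (1 - x)))) {x..y}"
proof -
  have "((\<lambda>x. 1 / (x * (1 - x))) has_integral ((ln y - ln (1 - y)) - (ln x - ln (1 - x)))) {x..y}"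
  proof (rule fundamental_theorem_of_calculus[OF assms(2)])
    fix z assume "z \<in> {x..y}"
    then have z: "0 < z" "z < 1" using assms by auto
    have "((\<lambda>x. ln x - ln (1 - x)) has_real_derivative 1 / (z * (1 - z))) (at z)"
      using z by (auto intro!: derivative_eq_intros simp: field_simps)
    then show "((\<lambda>x. ln x - ln (1 - x)) has_vector_derivative 1 / (z * (1 - z))) (at z within {x..y})"
      by (simp add: has_real_derivative_iff_has_vector_derivative has_vector_derivative_at_within)
  qed
  then show ?thesis using assms by (simp add: ln_div)
qed

lemma parabola_strict_mono:
  fixes x y :: real
  assumes "x < y" "y \<le> 1 / 2"
  shows "x * (1 - x) < y * (1 - y)"
proof -
  have "y * (1 - y) - x * (1 - x) = (y - x) * (1 - x - y)" by (simp add: algebra_simps)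
  also have "\<dots> > 0" using assms by simp
  finally show ?thesis by simp
qed

text \<open>In the application \<open>H s n = \<lambda>\<^sub>n (1 - \<lambda>\<^sub>n)\<close> and \<open>L = ln\<close>. Weighting the point mass at \<open>h\<close> by \<open>h\<close> keeps the
total mass of order \<open>L\<close>, although the eigenvalues accumulate at \<open>0\<close>; the weight turns the
limiting density \<open>dx / (x(1 - x))\<close> into Lebesgue measure on \<open>[0, 1]\<close>.\<close>

locale plunge_density =
  fixes H :: "real \<Rightarrow> nat \<Rightarrow> real" and L :: "real \<Rightarrow> real"
  assumes H0: "0 \<le> H s n" and H1: "H s n \<le> 1 / 4" and Hsum: "summable (H s)"
    and Lpos: "\<forall>\<^sub>F s in at_top. 0 < L s"
    and log_lim: "0 < t \<Longrightarrow> ((\<lambda>s. (\<Sum>n. ln (1 + t * H s n)) / L s) \<longlongrightarrow>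
         (1 / pi\<^sup>2) * integral {0..1} (\<lambda>x. log_quot t (x * (1 - x)))) at_top"
begin

definition avg :: "(real \<Rightarrow> real) \<Rightarrow> real \<Rightarrow> real" where
  "avg g s = (\<Sum>n. H s n * g (H s n)) / L s"

definition avg_lim :: "(real \<Rightarrow> real) \<Rightarrow> real" where
  "avg_lim g = (1 / pi\<^sup>2) * integral {0..1} (\<lambda>x. g (x * (1 - x)))"

definition limit_law :: "(real \<Rightarrow> real) \<Rightarrow> bool" where
  "limit_law g \<longleftrightarrow> continuous_on {0..1/4} g \<and> (avg g \<longlongrightarrow> avg_lim g) at_top"

lemma parabola_range: "x \<in> {0..1} \<Longrightarrow> x * (1 - x) \<in> {0..1/4::real}"
  using zero_le_power2[of "x - 1/2"] mult_nonneg_nonneg[of x "1 - x"]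
  by (simp add: power2_eq_square algebra_simps)

lemma parabola_continuous:
  fixes g :: "real \<Rightarrow> real"
  assumes "continuous_on {0..1/4} g"
  shows "continuous_on {0..1::real} (\<lambda>x. g (x * (1 - x)))"
  by (rule continuous_on_compose2[OF assms]) (auto intro!: continuous_intros parabola_range simp del: atLeastAtMost_iff)

lemma parabola_integrable:
  fixes g :: "real \<Rightarrow> real"
  assumes "continuous_on {0..1/4} g"
  shows "(\<lambda>x. g (x * (1 - x))) integrable_on {0..1::real}"
  by (rule integrable_continuous_real[OF parabola_continuous[OF assms]])

lemma avg_summable:
  assumes "continuous_on {0..1/4} g"
  shows "summable (\<lambda>n. H s n * g (H s n))"
proof -
  have "bounded (g ` {0..1/4})"
    by (intro compact_imp_bounded compact_continuous_image[OF assms]) simp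
  then obtain B where "\<forall>y\<in>g ` {0..1/4}. norm y \<le> B" unfolding bounded_iff by blast
  then have B: "\<bar>g y\<bar> \<le> B" if "y \<in> {0..1/4}" for y using that by simp
  show ?thesis
  proof (rule summable_comparison_test'[OF summable_mult[OF Hsum[of s], of B]])
    fix n :: nat
    have "\<bar>g (H s n)\<bar> \<le> B" by (rule B) (use H0 H1 in auto)
    from mult_left_mono[OF this H0[of s n]] show "norm (H s n * g (H s n)) \<le> B * H s n"
      using H0[of s n] by (simp add: abs_mult mult.commute)
  qed
qed

lemma avg_lin:
  assumes "continuous_on {0..1/4} f" "continuous_on {0..1/4} g"
  shows "avg (\<lambda>y. f y + c * g y) s = avg f s + c * avg g s"
proof -
  have "(\<Sum>n. H s n * (f (H s n) + c * g (H s n))) = (\<Sum>n. H s n * f (H s n) + c * (H s n * g (H s n)))"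
    by (simp add: algebra_simps)
  also have "\<dots> = (\<Sum>n. H s n * f (H s n)) + c * (\<Sum>n. H s n * g (H s n))"
    unfolding suminf_add[OF avg_summable[OF assms(1)] summable_mult[OF avg_summable[OF assms(2)]], symmetric]
      suminf_mult[OF avg_summable[OF assms(2)]] ..
  finally show ?thesis by (simp add: avg_def add_divide_distrib)
qed

lemma avg_lim_lin:
  assumes "continuous_on {0..1/4} f" "continuous_on {0..1/4} g"
  shows "avg_lim (\<lambda>y. f y + c * g y) = avg_lim f + c * avg_lim g"
proof -
  have "((\<lambda>x. c * g (x * (1 - x))) integrable_on {0..1})"
    using integrable_on_cmult_left[OF parabola_integrable[OF assms(2)], of c] by simp
  from Henstock_Kurzweil_Integration.integral_add[OF parabola_integrable[OF assms(1)] this]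
  show ?thesis unfolding avg_lim_def by (simp add: algebra_simps)
qed

lemma limit_law_lin:
  assumes "limit_law f" "limit_law g"
  shows "limit_law (\<lambda>y. f y + c * g y)"
proof -
  have c: "continuous_on {0..1/4} f" "continuous_on {0..1/4} g" using assms by (auto simp: limit_law_def)
  have "avg (\<lambda>y. f y + c * g y) = (\<lambda>s. avg f s + c * avg g s)" by (rule ext) (rule avg_lin[OF c])
  then show ?thesis
    using assms unfolding limit_law_def by (auto simp: avg_lim_lin[OF c] intro!: continuous_intros tendsto_intros)
qed

lemma limit_law_log_quot:
  assumes "0 < t"
  shows "limit_law (log_quot t)"
proof -
  have "H s n * log_quot t (H s n) = ln (1 + t * H s n)" for s n by (simp add: log_quot_def)
  then have "avg (log_quot t) = (\<lambda>s. (\<Sum>n. ln (1 + t * H s n)) / L s)" by (simp add: avg_def fun_eq_iff)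
  then show ?thesis
    using log_lim[OF assms] continuous_on_subset[OF log_quot_continuous, of t "{0..1/4}"] assms
    by (simp add: limit_law_def avg_lim_def)
qed

lemma limit_law_zero: "limit_law (\<lambda>_. 0)"
  using limit_law_lin[OF limit_law_log_quot[of 1] limit_law_log_quot[of 1], of "-1"] by simp

text \<open>For \<open>0 \<le> h \<le> 1/4\<close> one has \<open>h \<le> (5/4) ln (1 + h)\<close>, and the case \<open>t = 1\<close> of the hypothesis bounds
the sum of the logarithms.\<close>

lemma mass_bound:
  obtains C where "0 < C" "\<forall>\<^sub>F s in at_top. (\<Sum>n. H s n) / L s \<le> C"
proof -
  let ?l = "avg_lim (log_quot 1)"
  have "(avg (log_quot 1) \<longlongrightarrow> ?l) at_top" using limit_law_log_quot[of 1] by (simp add: limit_law_def)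
  then have "\<forall>\<^sub>F s in at_top. avg (log_quot 1) s < \<bar>?l\<bar> + 1" by (rule order_tendstoD) simp
  then have "\<forall>\<^sub>F s in at_top. (\<Sum>n. H s n) / L s \<le> 5 / 4 * (\<bar>?l\<bar> + 1)"
    using Lpos
  proof eventually_elim
    case (elim s)
    have "(\<Sum>n. H s n) \<le> (\<Sum>n. 5 / 4 * (H s n * log_quot 1 (H s n)))"
    proof (rule suminf_le[OF _ Hsum])
      fix n
      let ?h = "H s n"
      have h: "0 \<le> ?h" "?h \<le> 1 / 4" using H0 H1 by auto
      have "ln (inverse (1 + ?h)) \<le> inverse (1 + ?h) - 1" by (rule ln_le_minus_one) (use h in simp)
      moreover have "ln (inverse (1 + ?h)) = - ln (1 + ?h)" by (rule ln_inverse)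
      moreover have "inverse (1 + ?h) - 1 = - (?h / (1 + ?h))" using h by (simp add: field_simps)
      ultimately have "?h / (1 + ?h) \<le> ln (1 + ?h)" by linarith
      moreover have "?h / (5 / 4) \<le> ?h / (1 + ?h)" using h by (intro divide_left_mono) auto
      ultimately have "?h / (5 / 4) \<le> ln (1 + ?h)" by (rule order_trans[rotated])
      then show "?h \<le> 5 / 4 * (?h * log_quot 1 ?h)" by (cases "?h = 0") (simp_all add: log_quot_def)
      show "summable (\<lambda>n. 5 / 4 * (H s n * log_quot 1 (H s n)))"
        by (intro summable_mult avg_summable continuous_on_subset[OF log_quot_continuous]) auto
    qed
    also have "\<dots> = 5 / 4 * (\<Sum>n. H s n * log_quot 1 (H s n))"
      by (intro suminf_mult avg_summable continuous_on_subset[OF log_quot_continuous]) auto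
    finally have "(\<Sum>n. H s n) / L s \<le> 5 / 4 * avg (log_quot 1) s"
      using elim(2) by (simp add: avg_def field_simps)
    then show ?case using elim(1) by simp
  qed
  then show ?thesis by (rule that[rotated]) simp
qed

lemma limit_law_uniform_closure:
  assumes g: "continuous_on {0..1/4} g"
    and approx: "\<And>e. 0 < e \<Longrightarrow> \<exists>f. limit_law f \<and> (\<forall>y\<in>{0..1/4}. \<bar>g y - f y\<bar> \<le> e)"
  shows "limit_law g"
  unfolding limit_law_def
proof (intro conjI g tendstoI)
  obtain C where C: "0 < C" "\<forall>\<^sub>F s in at_top. (\<Sum>n. H s n) / L s \<le> C" by (rule mass_bound)
  fix e :: real assume e: "0 < e"
  define d where "d = e / 2 / (C + 1)"
  have d: "0 < d" using e C by (simp add: d_def)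
  have "C + 1 \<noteq> 0" using C by simp
  then have "d * (C + 1) = e / 2" using d_def nonzero_eq_divide_eq by blast
  then have dC: "d * C + d = e / 2" by (simp add: distrib_left)
  from approx[OF d] obtain f where f: "limit_law f" and "\<forall>y\<in>{0..1/4}. \<bar>g y - f y\<bar> \<le> d" by (elim exE conjE)
  then have fg: "\<bar>g y - f y\<bar> \<le> d" if "y \<in> {0..1/4}" for y using that by blast
  have fc: "continuous_on {0..1/4} f" using f[unfolded limit_law_def] by (rule conjunct1)
  have lim: "\<bar>avg_lim g - avg_lim f\<bar> \<le> d"
  proof -
    have "avg_lim g - avg_lim f = (1 / pi\<^sup>2) * integral {0..1} (\<lambda>x. g (x * (1 - x)) - f (x * (1 - x)))"
      unfolding avg_lim_def
      by (subst Henstock_Kurzweil_Integration.integral_diff[OF parabola_integrable[OF g] parabola_integrable[OF fc]])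
         (rule right_diff_distrib[symmetric])
    also have "\<bar>\<dots>\<bar> \<le> 1 * d"
      unfolding abs_mult
    proof (rule mult_mono)
      have "1 \<le> pi\<^sup>2" using pi_ge_two by (intro one_le_power) linarith
      then show "\<bar>1 / pi\<^sup>2\<bar> \<le> 1" by simp
      have "norm (integral {0..1} (\<lambda>x. g (x * (1 - x)) - f (x * (1 - x)))) \<le> d * (1 - 0)"
      proof (rule integral_bound)
        show "continuous_on {0..1} (\<lambda>x. g (x * (1 - x)) - f (x * (1 - x)))"
          by (intro continuous_on_diff parabola_continuous g fc)
        show "norm (g (x * (1 - x)) - f (x * (1 - x))) \<le> d" if "x \<in> {0..1}" for x
          unfolding real_norm_def by (rule fg[OF parabola_range[OF that]])
      qed simp
      then show "\<bar>integral {0..1} (\<lambda>x. g (x * (1 - x)) - f (x * (1 - x)))\<bar> \<le> d" by simp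
    qed auto
    finally show ?thesis by simp
  qed
  have "\<forall>\<^sub>F s in at_top. dist (avg f s) (avg_lim f) < e / 2"
    using f e unfolding limit_law_def tendsto_iff by (metis half_gt_zero)
  with C(2) Lpos show "\<forall>\<^sub>F s in at_top. dist (avg g s) (avg_lim g) < e"
  proof eventually_elim
    case (elim s)
    have "\<bar>avg g s - avg f s\<bar> \<le> d * C"
    proof -
      have "\<bar>(\<Sum>n. H s n * g (H s n)) - (\<Sum>n. H s n * f (H s n))\<bar> = \<bar>\<Sum>n. H s n * (g (H s n) - f (H s n))\<bar>"
        unfolding suminf_diff[OF avg_summable[OF g] avg_summable[OF fc]] right_diff_distrib ..
      also have "\<dots> \<le> (\<Sum>n. d * H s n)"
      proof -
        have le: "\<bar>H s n * (g (H s n) - f (H s n))\<bar> \<le> d * H s n" for n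
        proof -
          have "\<bar>g (H s n) - f (H s n)\<bar> \<le> d" by (rule fg) (use H0 H1 in auto)
          from mult_left_mono[OF this H0[of s n]] show ?thesis
            using H0[of s n] by (simp add: abs_mult mult.commute)
        qed
        have su: "summable (\<lambda>n. \<bar>H s n * (g (H s n) - f (H s n))\<bar>)"
          by (rule summable_comparison_test'[OF summable_mult[OF Hsum[of s], of d]]) (use le in auto)
        have "\<bar>\<Sum>n. H s n * (g (H s n) - f (H s n))\<bar> \<le> (\<Sum>n. \<bar>H s n * (g (H s n) - f (H s n))\<bar>)"
          by (rule summable_rabs[OF su])
        also have "\<dots> \<le> (\<Sum>n. d * H s n)"
          by (rule suminf_le[OF le su summable_mult[OF Hsum]])
        finally show ?thesis .
      qed
      also have "\<dots> = d * (\<Sum>n. H s n)" by (rule suminf_mult[OF Hsum])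
      finally have "\<bar>(\<Sum>n. H s n * g (H s n)) - (\<Sum>n. H s n * f (H s n))\<bar> / L s \<le> d * ((\<Sum>n. H s n) / L s)"
        using elim(2) by (simp add: divide_right_mono)
      also have "\<dots> \<le> d * C" using elim(1) d by (intro mult_left_mono) auto
      finally show ?thesis using elim(2) by (simp add: avg_def diff_divide_distrib[symmetric])
    qed
    then show ?case using lim elim(3) dC d unfolding dist_real_def by linarith
  qed
qed

text \<open>By induction on \<open>k\<close>: subtract from \<open>ln (1 + t y) / y\<close> the terms of its Taylor polynomial of degree below
\<open>k\<close> and divide by the coefficient of \<open>y\<^sup>k\<close>, which is of order \<open>t\<^bsup>k+1\<^esup>\<close>. The remainder is of order
\<open>t\<^bsup>k+2\<^esup>\<close>, so the quotient differs from \<open>y\<^sup>k\<close> by at most \<open>(k + 1) t\<close> uniformly.\<close>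

lemma limit_law_power: "limit_law (\<lambda>y. y ^ k)"
proof (induction k rule: less_induct)
  case (less k)
  have part: "limit_law (\<lambda>y. log_quot t y - (\<Sum>j<m. (-1) ^ j * t ^ Suc j / real (Suc j) * y ^ j))"
    if "0 < t" "m \<le> k" for t m
    using that(2)
  proof (induction m)
    case 0
    then show ?case using limit_law_log_quot[OF that(1)] by simp
  next
    case (Suc m)
    then have "m < k" "m \<le> k" by auto
    from limit_law_lin[OF Suc.IH[OF this(2)] less.IH[OF this(1)], of "- ((-1) ^ m * t ^ Suc m / real (Suc m))"]
    show ?case by (simp add: diff_diff_eq algebra_simps del: of_nat_Suc power_Suc)
  qed
  show ?case
  proof (rule limit_law_uniform_closure)
    show "continuous_on {0..1/4} (\<lambda>y::real. y ^ k)" by (intro continuous_intros)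
    fix e :: real assume e: "0 < e"
    define t where "t = e / real (Suc k)"
    have t: "0 < t" using e by (simp add: t_def)
    define c where "c = (-1) ^ k * real (Suc k) / t ^ Suc k"
    define r where "r y = log_quot t y - (\<Sum>j<k. (-1) ^ j * t ^ Suc j / real (Suc j) * y ^ j)" for y
    have rg: "limit_law (\<lambda>y. c * r y)"
      using limit_law_lin[OF limit_law_zero part[OF t order_refl], of c] unfolding r_def by simp
    have "\<bar>y ^ k - c * r y\<bar> \<le> e" if y: "y \<in> {0..1/4}" for y
    proof (cases "y = 0")
      case True
      have "c * r 0 = 0 ^ k"
      proof (cases k)
        case 0
        then show ?thesis using t by (simp add: c_def r_def log_quot_def)
      next
        case (Suc m)
        have "(\<Sum>j<k. (-1) ^ j * t ^ Suc j / real (Suc j) * 0 ^ j) = t"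
          unfolding Suc by (subst sum.lessThan_Suc_shift) simp
        then show ?thesis using Suc by (simp add: r_def log_quot_def)
      qed
      then show ?thesis using True e by simp
    next
      case False
      with y have y0: "0 < y" "y \<le> 1 / 4" by auto
      define E where "E = ln (1 + t * y) - (\<Sum>j\<le>k. (-1) ^ j * (t * y) ^ Suc j / real (Suc j))"
      have E: "\<bar>E\<bar> \<le> (t * y) ^ (k + 2)"
        unfolding E_def by (rule log_taylor_bound) (use t y0 in simp)
      have "y * r y = ln (1 + t * y) - (\<Sum>j<k. (-1) ^ j * (t * y) ^ Suc j / real (Suc j))"
        using False by (simp add: r_def log_quot_def right_diff_distrib sum_distrib_left power_mult_distrib mult_ac)
      also have "\<dots> = E + (-1) ^ k * (t * y) ^ Suc k / real (Suc k)"
        unfolding E_def by (simp add: lessThan_Suc_atMost[symmetric])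
      finally have yr: "y * r y = E + (-1) ^ k * (t * y) ^ Suc k / real (Suc k)" .
      have "c * ((-1) ^ k * (t * y) ^ Suc k / real (Suc k)) = y ^ Suc k"
      proof -
        have "((-1) ^ k * (-1) ^ k :: real) = 1" by (simp flip: power_add)
        then show ?thesis using t unfolding c_def power_mult_distrib
          by (simp add: field_simps del: of_nat_Suc power_Suc)
      qed
      then have "y * (c * r y) = c * E + y * y ^ k"
        using yr by (metis distrib_left mult.left_commute power_Suc)
      then have "y * (y ^ k - c * r y) = - (c * E)" by (simp add: algebra_simps)
      then have "y * \<bar>y ^ k - c * r y\<bar> = \<bar>c\<bar> * \<bar>E\<bar>"
        using y0 by (metis abs_minus_cancel abs_mult abs_of_pos)
      also have "\<dots> \<le> \<bar>c\<bar> * (t * y) ^ (k + 2)" by (rule mult_left_mono[OF E]) simp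
      also have "\<dots> = real (Suc k) * t * (y * y ^ Suc k)"
      proof -
        have ac: "\<bar>c\<bar> = real (Suc k) / t ^ Suc k"
          unfolding c_def abs_divide abs_mult using t by (simp add: power_abs del: of_nat_Suc power_Suc)
        have ty: "(t * y) ^ (k + 2) = t ^ Suc k * (t * (y * y ^ Suc k))"
          by (simp add: power_mult_distrib mult_ac)
        have "t ^ Suc k \<noteq> 0" using t by simp
        then show ?thesis unfolding ac ty by (simp del: of_nat_Suc power_Suc)
      qed
      also have "\<dots> \<le> real (Suc k) * t * (y * 1)"
        using y0 t by (intro mult_left_mono power_le_one) auto
      also have "\<dots> = y * e" by (simp add: t_def)
      finally show ?thesis using y0 by simp
    qed
    then show "\<exists>f. limit_law f \<and> (\<forall>y\<in>{0..1/4}. \<bar>y ^ k - f y\<bar> \<le> e)" using rg by blast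
  qed
qed

lemma limit_law_continuous:
  assumes g: "continuous_on {0..1/4} g"
  shows "limit_law g"
proof (rule limit_law_uniform_closure[OF g])
  fix e :: real assume "0 < e"
  then obtain p where p: "real_polynomial_function p" "\<And>y. y \<in> {0..1/4} \<Longrightarrow> \<bar>g y - p y\<bar> < e"
    using Stone_Weierstrass_real_polynomial_function[of "{0..1/4}" g e] g by auto
  from p(1) obtain a n where pa: "p = (\<lambda>x. \<Sum>i\<le>n. a i * x ^ i)" unfolding real_polynomial_function_iff_sum by auto
  have "limit_law (\<lambda>x. \<Sum>i\<le>m. a i * x ^ i)" for m
  proof (induction m)
    case 0
    from limit_law_lin[OF limit_law_zero limit_law_power[of 0], of "a 0"] show ?case by simp
  next
    case (Suc m)
    from limit_law_lin[OF this limit_law_power[of "Suc m"], of "a (Suc m)"] show ?case by simp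
  qed
  then show "\<exists>f. limit_law f \<and> (\<forall>y\<in>{0..1/4}. \<bar>g y - f y\<bar> \<le> e)"
    using p(2) pa by (intro exI[of _ p]) (auto intro: less_imp_le)
qed

lemma finite_above:
  assumes "0 < \<alpha>"
  shows "finite {n. \<alpha> < H s n}"
proof -
  have "\<forall>\<^sub>F n in sequentially. H s n < \<alpha>"
    using order_tendstoD(2)[OF summable_LIMSEQ_zero[OF Hsum] assms] .
  then obtain N where "\<And>n. n \<ge> N \<Longrightarrow> H s n < \<alpha>" unfolding eventually_sequentially by blast
  then have "n < N" if "\<alpha> < H s n" for n using that by (meson not_less order_less_asym)
  then have "{n. \<alpha> < H s n} \<subseteq> {..<N}" by auto
  then show ?thesis by (rule finite_subset) simp
qed

text \<open>The test function \<open>g\<close> is a trapezoid divided by \<open>y\<close>. The trapezoid is at most the indicator of the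
window between \<open>p(1 - p)\<close> and \<open>q(1 - q)\<close>, and it equals \<open>1\<close> on the smaller window given by \<open>p'\<close>
and \<open>q'\<close>, whose preimage under \<open>x \<mapsto> x(1 - x)\<close> consists of \<open>[p', q']\<close> and its reflection. Each
contributes the integral of \<open>1 / (x(1 - x))\<close>, a difference of logits.\<close>

theorem plunge_count:
  assumes p: "0 < p" "p < p'" "p' \<le> q'" "q' < q" "q \<le> 1 / 2"
    and c: "c < 2 / pi\<^sup>2 * (ln (q' / (1 - q')) - ln (p' / (1 - p')))"
  shows "\<forall>\<^sub>F s in at_top. c * L s \<le> real (card {n. p * (1 - p) < H s n \<and> H s n < q * (1 - q)})"
proof -
  note mono = parabola_strict_mono
  define \<alpha> \<alpha>' \<beta>' \<beta> where ab: "\<alpha> = p * (1 - p)" "\<alpha>' = p' * (1 - p')" "\<beta>' = q' * (1 - q')" "\<beta> = q * (1 - q)"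
  have ord: "0 < \<alpha>" "\<alpha> < \<alpha>'" "\<beta>' < \<beta>"
    using p mono[of p p'] mono[of q' q] by (auto simp: ab)
  define \<psi> where "\<psi> y = max 0 (min 1 (min ((y - \<alpha>) / (\<alpha>' - \<alpha>)) ((\<beta> - y) / (\<beta> - \<beta>'))))" for y
  \<comment> \<open>the maximum keeps the quotient continuous at \<open>0\<close>; below \<open>\<alpha>\<close> the numerator vanishes\<close>
  define g where "g y = \<psi> y / max y \<alpha>" for y
  have gc: "continuous_on {0..1/4} g"
    unfolding g_def \<psi>_def using ord by (auto intro!: continuous_intros)
  have gchi: "y * g y = \<psi> y" if "0 \<le> y" for y
  proof (cases "y \<le> \<alpha>")
    case True
    then have "(y - \<alpha>) / (\<alpha>' - \<alpha>) \<le> 0" using ord by (simp add: divide_nonpos_pos)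
    then have "\<psi> y = 0" unfolding \<psi>_def by linarith
    then show ?thesis by (simp add: g_def)
  next
    case False
    then show ?thesis using ord by (simp add: g_def max_def)
  qed
  have chi01: "0 \<le> \<psi> y" "\<psi> y \<le> 1" for y by (auto simp: \<psi>_def)
  have chi_supp: "\<alpha> < y \<and> y < \<beta>" if "\<psi> y \<noteq> 0" for y
  proof -
    have "0 < (y - \<alpha>) / (\<alpha>' - \<alpha>)" "0 < (\<beta> - y) / (\<beta> - \<beta>')" using that unfolding \<psi>_def by linarith+
    then show ?thesis using ord by (simp add: zero_less_divide_iff)
  qed
  have g0: "0 \<le> g y" for y unfolding g_def using ord chi01 by (intro divide_nonneg_nonneg) auto
  have g1: "1 / (x * (1 - x)) \<le> g (x * (1 - x))" if "\<alpha>' \<le> x * (1 - x)" "x * (1 - x) \<le> \<beta>'" for x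
  proof -
    let ?y = "x * (1 - x)"
    have "1 \<le> (?y - \<alpha>) / (\<alpha>' - \<alpha>)" "1 \<le> (\<beta> - ?y) / (\<beta> - \<beta>')" using that ord by (auto simp: le_divide_eq)
    then have "\<psi> ?y = 1" unfolding \<psi>_def by linarith
    moreover have "max ?y \<alpha> = ?y" using that ord by simp
    ultimately show ?thesis by (simp add: g_def)
  qed
  have gi: "(\<lambda>x. g (x * (1 - x))) integrable_on {x..y}" if "0 \<le> x" "y \<le> 1" for x y
    by (rule integrable_on_subinterval[OF parabola_integrable[OF gc]]) (use that in auto)
  have lower: "ln (w / (1 - w)) - ln (v / (1 - v)) \<le> integral {x..y} (\<lambda>x. g (x * (1 - x)))"
    if vw: "0 < v" "v \<le> w" "w < 1" "0 \<le> x" "x \<le> v" "w \<le> y" "y \<le> 1"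
      and r: "\<And>z. z \<in> {v..w} \<Longrightarrow> \<alpha>' \<le> z * (1 - z) \<and> z * (1 - z) \<le> \<beta>'" for v w x y
  proof -
    have I: "((\<lambda>x. 1 / (x * (1 - x))) has_integral (ln (w / (1 - w)) - ln (v / (1 - v)))) {v..w}"
      by (rule integral_logit) (use vw in auto)
    have "integral {v..w} (\<lambda>x. 1 / (x * (1 - x))) \<le> integral {v..w} (\<lambda>x. g (x * (1 - x)))"
      by (rule integral_le) (use I gi vw r g1 in \<open>auto intro: has_integral_integrable\<close>)
    also have "\<dots> \<le> integral {x..y} (\<lambda>x. g (x * (1 - x)))"
      by (rule integral_subset_le) (use vw gi g0 in auto)
    finally show ?thesis using integral_unique[OF I] by simp
  qed
  have r1: "\<alpha>' \<le> z * (1 - z) \<and> z * (1 - z) \<le> \<beta>'" if "z \<in> {p'..q'}" for z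
    using that mono[of p' z] mono[of z q'] p unfolding ab by (cases "z = p'"; cases "z = q'") auto
  have 1: "ln (q' / (1 - q')) - ln (p' / (1 - p')) \<le> integral {0..1/2} (\<lambda>x. g (x * (1 - x)))"
    by (rule lower[OF _ _ _ _ _ _ _ r1]) (use p in auto)
  have 2: "ln ((1 - p') / (1 - (1 - p'))) - ln ((1 - q') / (1 - (1 - q'))) \<le> integral {1/2..1} (\<lambda>x. g (x * (1 - x)))"
  proof (rule lower)
    show "\<alpha>' \<le> z * (1 - z) \<and> z * (1 - z) \<le> \<beta>'" if "z \<in> {1 - q'..1 - p'}" for z
      using r1[of "1 - z"] that by (simp add: mult.commute)
  qed (use p in auto)
  have "integral {0..1/2} (\<lambda>x. g (x * (1 - x))) + integral {1/2..1} (\<lambda>x. g (x * (1 - x))) = integral {0..1} (\<lambda>x. g (x * (1 - x)))"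
    by (rule Henstock_Kurzweil_Integration.integral_combine) (use gi in auto)
  moreover have "ln ((1 - p') / (1 - (1 - p'))) - ln ((1 - q') / (1 - (1 - q'))) = ln (q' / (1 - q')) - ln (p' / (1 - p'))"
    using p by (simp add: ln_div)
  moreover have "2 * D \<le> I" if "A + B = I" "D' = D" "D \<le> A" "D' \<le> B" for A B D D' I :: real
    using that by linarith
  ultimately have "2 * (ln (q' / (1 - q')) - ln (p' / (1 - p'))) \<le> integral {0..1} (\<lambda>x. g (x * (1 - x)))"
    using 1 2 by blast
  then have "(1 / pi\<^sup>2) * (2 * (ln (q' / (1 - q')) - ln (p' / (1 - p')))) \<le> avg_lim g"
    unfolding avg_lim_def by (rule mult_left_mono) simp
  moreover have "(1 / pi\<^sup>2) * (2 * D) = 2 / pi\<^sup>2 * D" for D by simp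
  ultimately have "c < avg_lim g" using c by (simp only: less_le_trans)
  moreover have "(avg g \<longlongrightarrow> avg_lim g) at_top" using limit_law_continuous[OF gc] by (simp add: limit_law_def)
  ultimately have "\<forall>\<^sub>F s in at_top. c < avg g s" using order_tendstoD(1) by blast
  then show ?thesis using Lpos
  proof eventually_elim
    case (elim s)
    let ?A = "{n. \<alpha> < H s n \<and> H s n < \<beta>}"
    have fin: "finite ?A" by (rule finite_subset[OF _ finite_above[OF ord(1), of s]]) auto
    have "(\<Sum>n. H s n * g (H s n)) = (\<Sum>n. \<psi> (H s n))" by (simp add: gchi H0)
    also have "\<dots> = (\<Sum>n\<in>?A. \<psi> (H s n))" by (rule suminf_finite[OF fin]) (use chi_supp in auto)
    also have "\<dots> \<le> (\<Sum>n\<in>?A. 1)" by (rule sum_mono) (rule chi01)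
    finally have "avg g s * L s \<le> real (card ?A)" using elim(2) by (simp add: avg_def)
    moreover have "c * L s \<le> avg g s * L s" using elim by simp
    ultimately show ?case unfolding ab by simp
  qed
qed

end

section \<open>Multiplicities of the eigenvalues of \<open>S_op\<close>\<close>

lemma nontrivial_relation:
  fixes c :: "nat \<Rightarrow> 'a \<Rightarrow> complex"
  assumes I: "finite I" and k: "card I < k"
  shows "\<exists>d. (\<exists>i<k. d i \<noteq> 0) \<and> (\<forall>n\<in>I. (\<Sum>i<k. d i * c i n) = 0)"
proof -
  obtain h where h: "bij_betw h {0..<card I} I" using ex_bij_betw_nat_finite[OF I] by blast
  \<comment> \<open>padding with zero rows makes the coefficient matrix square and singular\<close>
  define A where "A = Matrix.mat k k (\<lambda>(r, i). if r < card I then c i (h r) else (0::complex))"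
  have A: "A \<in> carrier_mat k k" by (simp add: A_def)
  have "Determinant.det A = 0"
    unfolding det_def'[OF A]
  proof (rule sum.neutral, rule ballI)
    fix p assume "p \<in> {p. p permutes {0..<k}}"
    then have "p (card I) < k" using permutes_in_image[of p "{0..<k}" "card I"] k by simp
    then have "A $$ (card I, p (card I)) = 0" using k by (simp add: A_def)
    then have "(\<Prod>i = 0..<k. A $$ (i, p i)) = 0" using k by (intro prod_zero) auto
    then show "signof p * (\<Prod>i = 0..<k. A $$ (i, p i)) = 0" by simp
  qed
  then obtain v where v: "v \<in> carrier_vec k" "v \<noteq> 0\<^sub>v k" "A *\<^sub>v v = 0\<^sub>v k"
    using det_0_iff_vec_prod_zero_field[OF A] by blast
  have ex: "\<exists>i<k. vec_index v i \<noteq> 0"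
  proof (rule ccontr)
    assume "\<not> (\<exists>i<k. vec_index v i \<noteq> 0)"
    then have "v = 0\<^sub>v k" using v(1) by (intro eq_vecI) auto
    with v(2) show False by simp
  qed
  have "(\<Sum>i<k. vec_index v i * c i n) = 0" if n: "n \<in> I" for n
  proof -
    have "n \<in> h ` {0..<card I}" using h n by (simp add: bij_betw_def)
    then obtain r where r: "r < card I" "h r = n" by auto
    have rk: "r < k" using r(1) k by simp
    have "vec_index (A *\<^sub>v v) r = (\<Sum>i = 0..<k. A $$ (r, i) * vec_index v i)"
      using v(1) A rk by (simp add: scalar_prod_def)
    also have "\<dots> = (\<Sum>i = 0..<k. vec_index v i * c i n)"
      by (intro sum.cong refl) (use rk r in \<open>auto simp: A_def\<close>)
    finally show ?thesis using v(3) rk by (simp add: atLeast0LessThan)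
  qed
  with ex show ?thesis by blast
qed

context real_interval begin

definition eigenspace :: "(real \<Rightarrow> real \<Rightarrow> real) \<Rightarrow> real \<Rightarrow> (real \<Rightarrow> complex) set" where
  "eigenspace K \<mu> = {f \<in> L2 M. AE x in M. (LINT y|M. of_real (K x y) * f y) = of_real \<mu> * f x}"

lemma L2_integrable:
  assumes "f \<in> L2 M"
  shows "integrable M f"
proof -
  interpret finite_measure M by (rule finite_interval_measure)
  have f: "f \<in> borel_measurable M" "integrable M (\<lambda>x. (cmod (f x))\<^sup>2)" using assms by (auto simp: L2_def)
  show ?thesis
  proof (rule Bochner_Integration.integrable_bound[OF _ f(1)])
    show "integrable M (\<lambda>x. 1 + (cmod (f x))\<^sup>2)" using f(2) by simp
    have "y \<le> 1 + y\<^sup>2" if "0 \<le> y" for y :: real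
      using zero_le_power2[of "y - 1"] zero_le_power2[of y] unfolding power2_diff power_one by linarith
    then show "AE x in M. norm (f x) \<le> norm (1 + (cmod (f x))\<^sup>2)"
      by (intro AE_I2) (simp add: abs_of_nonneg)
  qed
qed

lemma cont_of_real_measurable: "cont g \<Longrightarrow> (\<lambda>x. complex_of_real (g x)) \<in> borel_measurable M"
  by (rule measurable_compose[OF cont_measurable borel_measurable_of_real])

lemma cont_mult_integrable:
  fixes f :: "real \<Rightarrow> complex"
  assumes g: "cont g" and f: "integrable M f"
  shows "integrable M (\<lambda>x. of_real (g x) * f x)"
proof -
  obtain B where B: "0 \<le> B" "\<And>x. x \<in> {a..b} \<Longrightarrow> \<bar>g x\<bar> \<le> B" by (rule cont_bounded[OF g]) blast
  show ?thesis
  proof (rule Bochner_Integration.integrable_bound)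
    show "integrable M (\<lambda>x. B * norm (f x))" using f by simp
    show "(\<lambda>x. complex_of_real (g x) * f x) \<in> borel_measurable M"
      by (rule borel_measurable_times[OF cont_of_real_measurable[OF g] borel_measurable_integrable[OF f]])
    show "AE x in M. norm (complex_of_real (g x) * f x) \<le> norm (B * norm (f x))"
      by (rule AE_I2) (use B in \<open>auto simp: norm_mult abs_mult intro!: mult_right_mono\<close>)
  qed
qed

lemma mercer_level_finite:
  assumes m: "mercer K lam \<phi>" and K: "kcont K" and e: "0 < e"
  shows "finite {n. e < lam n}"
proof -
  have "\<forall>\<^sub>F n in sequentially. lam n < e"
    using order_tendstoD(2)[OF summable_LIMSEQ_zero[OF mercer_fredholm_det(2)[OF m K]] e] .
  then obtain N where "\<And>n. n \<ge> N \<Longrightarrow> lam n < e" unfolding eventually_sequentially by blast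
  then have "n < N" if "e < lam n" for n using that by (meson not_less order_less_asym)
  then have "{n. e < lam n} \<subseteq> {..<N}" by auto
  then show ?thesis by (rule finite_subset) simp
qed

text \<open>Integrating the expansion of \<open>K\<close> against \<open>f\<close> gives \<open>\<mu> f = \<Sum> \<lambda>\<^sub>n \<langle>f, \<phi>\<^sub>n\<rangle> \<phi>\<^sub>n\<close>, and pairing this with
\<open>\<phi>\<^sub>n\<close> gives \<open>(\<mu> - \<lambda>\<^sub>n) \<langle>f, \<phi>\<^sub>n\<rangle> = 0\<close> whenever \<open>\<lambda>\<^sub>n \<noteq> 0\<close>. Only the finitely many indices with
\<open>\<lambda>\<^sub>n = \<mu>\<close> survive.\<close>

lemma eigenfunction_expansion:
  assumes m: "mercer K lam \<phi>" and K: "kcont K" and mu: "0 < \<mu>" and f: "f \<in> eigenspace K \<mu>"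
  shows "AE x in M. f x = (\<Sum>n | lam n = \<mu>. (LINT y|M. of_real (\<phi> n y) * f y) * of_real (\<phi> n x))"
proof -
  note c = mercerD(1)[OF m]
  have fL: "f \<in> L2 M" and eig: "AE x in M. (LINT y|M. of_real (K x y) * f y) = of_real \<mu> * f x"
    using f by (auto simp: eigenspace_def)
  have fi: "integrable M f" by (rule L2_integrable[OF fL])
  define q where "q n = (LINT y|M. of_real (\<phi> n y) * f y)" for n
  define T where "T x = (LINT y|M. of_real (K x y) * f y)" for x
  have phif: "integrable M (\<lambda>y. of_real (\<phi> n y) * f y)" for n by (rule cont_mult_integrable[OF c fi])
  obtain C where C: "0 \<le> C" "\<And>N x y. x \<in> {a..b} \<Longrightarrow> y \<in> {a..b} \<Longrightarrow> \<bar>\<Sum>k<N. lam k * \<phi> k x * \<phi> k y\<bar> \<le> C"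
    "\<And>N. (\<Sum>k<N. lam k) \<le> C"
    by (rule mercer_bound[OF m K]) (rule that)
  define T' where "T' N x = (\<Sum>k<N. of_real (lam k * \<phi> k x) * q k)" for N x
  have T'_eq: "T' N x = (LINT y|M. of_real (\<Sum>k<N. lam k * \<phi> k x * \<phi> k y) * f y)" for N x
  proof -
    have "(LINT y|M. of_real (\<Sum>k<N. lam k * \<phi> k x * \<phi> k y) * f y)
       = (LINT y|M. (\<Sum>k<N. of_real (lam k * \<phi> k x) * (of_real (\<phi> k y) * f y)))"
      by (simp add: sum_distrib_right mult.assoc)
    also have "\<dots> = (\<Sum>k<N. LINT y|M. of_real (lam k * \<phi> k x) * (of_real (\<phi> k y) * f y))"
      by (rule Bochner_Integration.integral_sum) (rule integrable_mult_right[OF phif])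
    also have "\<dots> = T' N x" unfolding T'_def q_def by (intro sum.cong refl integral_mult_right_zero)
    finally show ?thesis ..
  qed
  have Tlim: "(\<lambda>N. T' N x) \<longlonglongrightarrow> T x" if x: "x \<in> {a<..<b}" for x
    unfolding T'_eq T_def
  proof (rule integral_dominated_convergence[where w = "\<lambda>y. C * norm (f y)"])
    show "(\<lambda>y. complex_of_real (K x y) * f y) \<in> borel_measurable M"
      by (rule borel_measurable_integrable[OF cont_mult_integrable[OF kernel_row[OF K] fi]])
    show "(\<lambda>y. complex_of_real (\<Sum>k<N. lam k * \<phi> k x * \<phi> k y) * f y) \<in> borel_measurable M" for N
      by (intro borel_measurable_integrable cont_mult_integrable fi continuous_on_sum continuous_on_mult continuous_on_const c)
    show "integrable M (\<lambda>y. C * norm (f y))" using fi by simp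
    show "AE y in M. (\<lambda>N. complex_of_real (\<Sum>k<N. lam k * \<phi> k x * \<phi> k y) * f y) \<longlonglongrightarrow> complex_of_real (K x y) * f y"
    proof (rule AE_I2)
      fix y assume y: "y \<in> space M"
      have "(\<lambda>N. \<Sum>k<N. lam k * \<phi> k x * \<phi> k y) \<longlonglongrightarrow> K x y"
        using mercerD(6)[OF m, of x y] x y unfolding sums_def by simp
      then show "(\<lambda>N. complex_of_real (\<Sum>k<N. lam k * \<phi> k x * \<phi> k y) * f y) \<longlonglongrightarrow> complex_of_real (K x y) * f y"
        by (intro tendsto_mult_right tendsto_of_real)
    qed
    show "AE y in M. norm (complex_of_real (\<Sum>k<N. lam k * \<phi> k x * \<phi> k y) * f y) \<le> C * norm (f y)" for N
      by (rule AE_I2, unfold norm_mult norm_of_real, rule mult_right_mono[OF C(2)]) (use x in auto)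
  qed
  have T'_bound: "norm (T' N x) \<le> C * (LINT y|M. norm (f y))" if x: "x \<in> {a<..<b}" for N x
  proof -
    have "norm (T' N x) \<le> (LINT y|M. norm (of_real (\<Sum>k<N. lam k * \<phi> k x * \<phi> k y) * f y))"
      unfolding T'_eq by (rule integral_norm_bound)
    also have "\<dots> \<le> (LINT y|M. C * norm (f y))"
    proof (rule integral_mono)
      show "integrable M (\<lambda>y. norm (complex_of_real (\<Sum>k<N. lam k * \<phi> k x * \<phi> k y) * f y))"
        by (intro integrable_norm cont_mult_integrable fi continuous_on_sum continuous_on_mult continuous_on_const c)
      show "integrable M (\<lambda>y. C * norm (f y))" using fi by simp
      show "norm (complex_of_real (\<Sum>k<N. lam k * \<phi> k x * \<phi> k y) * f y) \<le> C * norm (f y)" if "y \<in> space M" for y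
        unfolding norm_mult norm_of_real by (rule mult_right_mono[OF C(2)]) (use x that in auto)
    qed
    finally show ?thesis by simp
  qed
  have T'_meas: "T' N \<in> borel_measurable M" for N
    unfolding T'_def
    by (intro borel_measurable_sum borel_measurable_times borel_measurable_const cont_of_real_measurable continuous_on_mult_left c)
  have T_meas: "T \<in> borel_measurable M"
    by (rule borel_measurable_LIMSEQ_metric[OF T'_meas Tlim]) simp
  have coeff: "(of_real \<mu> - of_real (lam n)) * q n = 0" if n: "lam n \<noteq> 0" for n
  proof -
    obtain B where B: "0 \<le> B" "\<And>x. x \<in> {a..b} \<Longrightarrow> \<bar>\<phi> n x\<bar> \<le> B" by (rule cont_bounded[OF c]) blast
    have "(\<lambda>N. LINT x|M. of_real (\<phi> n x) * T' N x) \<longlonglongrightarrow> (LINT x|M. of_real (\<phi> n x) * T x)"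
    proof (rule integral_dominated_convergence[where w = "\<lambda>_. B * (C * (LINT y|M. norm (f y)))"])
      show "AE x in M. (\<lambda>N. complex_of_real (\<phi> n x) * T' N x) \<longlonglongrightarrow> complex_of_real (\<phi> n x) * T x"
        by (rule AE_I2) (intro tendsto_mult_left Tlim, simp)
      show "AE x in M. norm (complex_of_real (\<phi> n x) * T' N x) \<le> B * (C * (LINT y|M. norm (f y)))" for N
        by (rule AE_I2, unfold norm_mult norm_of_real, rule mult_mono[OF B(2) T'_bound B(1)]) auto
    qed (intro borel_measurable_times cont_of_real_measurable c continuous_on_mult_left T_meas T'_meas cont_integrable continuous_on_const)+
    moreover have "(LINT x|M. of_real (\<phi> n x) * T x) = of_real \<mu> * q n"
    proof -
      have "(LINT x|M. of_real (\<phi> n x) * T x) = (LINT x|M. of_real \<mu> * (of_real (\<phi> n x) * f x))"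
      proof (rule integral_cong_AE)
        show "AE x in M. complex_of_real (\<phi> n x) * T x = of_real \<mu> * (of_real (\<phi> n x) * f x)"
          using eig by eventually_elim (simp add: T_def)
      qed (intro borel_measurable_times cont_of_real_measurable c continuous_on_mult_left T_meas borel_measurable_const borel_measurable_integrable[OF fi])+
      then show ?thesis unfolding q_def by simp
    qed
    moreover have "(LINT x|M. of_real (\<phi> n x) * T' N x) = of_real (lam n) * q n" if N: "n < N" for N
    proof -
      have pp: "(LINT x|M. of_real (\<phi> n x * \<phi> k x)) = complex_of_real (ip (\<phi> n) (\<phi> k))" for k
        unfolding ip_def by (rule integral_of_real) (intro cont_integrable continuous_on_mult c)
      have "(LINT x|M. of_real (\<phi> n x) * T' N x) = (LINT x|M. (\<Sum>k<N. (of_real (lam k) * q k) * of_real (\<phi> n x * \<phi> k x)))"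
        unfolding T'_def sum_distrib_left by (intro Bochner_Integration.integral_cong refl sum.cong) (simp add: mult_ac)
      also have "\<dots> = (\<Sum>k<N. LINT x|M. (of_real (lam k) * q k) * of_real (\<phi> n x * \<phi> k x))"
        by (rule Bochner_Integration.integral_sum)
           (intro integrable_mult_right integrable_of_real cont_integrable continuous_on_mult c)
      also have "\<dots> = (\<Sum>k<N. (of_real (lam k) * q k) * of_real (ip (\<phi> n) (\<phi> k)))"
        by (simp only: integral_mult_right_zero pp)
      also have "\<dots> = (\<Sum>k<N. if k = n then of_real (lam n) * q n else 0)"
      proof (rule sum.cong[OF refl])
        fix k
        show "(of_real (lam k) * q k) * of_real (ip (\<phi> n) (\<phi> k)) = (if k = n then of_real (lam n) * q n else 0)"
          using mercerD(4)[OF m n, of k] by (cases "lam k = 0") (use n in auto)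
      qed
      also have "\<dots> = of_real (lam n) * q n" using N by simp
      finally show ?thesis .
    qed
    then have "(\<lambda>N. LINT x|M. of_real (\<phi> n x) * T' N x) \<longlonglongrightarrow> of_real (lam n) * q n"
      by (intro tendsto_eventually) (auto simp: eventually_sequentially intro!: exI[of _ "Suc n"])
    ultimately have "of_real \<mu> * q n = of_real (lam n) * q n" using LIMSEQ_unique by metis
    then show ?thesis by (simp add: algebra_simps)
  qed
  have fin: "finite {n. lam n = \<mu>}"
    by (rule finite_subset[OF _ mercer_level_finite[OF m K, of "\<mu> / 2"]]) (use mu in auto)
  have T_eq: "T x = (\<Sum>n | lam n = \<mu>. of_real (lam n * \<phi> n x) * q n)" if x: "x \<in> {a<..<b}" for x
  proof -
    have "(\<lambda>n. of_real (lam n * \<phi> n x) * q n) sums T x" using Tlim[OF x] unfolding sums_def T'_def .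
    moreover have "(\<lambda>n. of_real (lam n * \<phi> n x) * q n) sums (\<Sum>n | lam n = \<mu>. of_real (lam n * \<phi> n x) * q n)"
    proof (rule sums_finite[OF fin])
      fix n assume "n \<notin> {n. lam n = \<mu>}"
      then show "of_real (lam n * \<phi> n x) * q n = 0" using coeff[of n] by (cases "lam n = 0") auto
    qed
    ultimately show ?thesis by (rule sums_unique2)
  qed
  show ?thesis
    using eig AE_space
  proof eventually_elim
    case (elim x)
    have "of_real \<mu> * f x = (\<Sum>n | lam n = \<mu>. of_real (lam n * \<phi> n x) * q n)"
      using elim T_eq[of x] by (simp add: T_def)
    also have "\<dots> = of_real \<mu> * (\<Sum>n | lam n = \<mu>. q n * of_real (\<phi> n x))"
      unfolding sum_distrib_left by (intro sum.cong refl) (simp add: mult_ac)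
    finally have "of_real \<mu> * f x = of_real \<mu> * (\<Sum>n | lam n = \<mu>. q n * of_real (\<phi> n x))" .
    then show ?case using mu by (simp add: q_def)
  qed
qed

text \<open>The eigenfunctions in the expansion are independent, and by \<open>eigenfunction_expansion\<close> more
functions than that are dependent. In particular the supremum defining the dimension is attained.\<close>

lemma eigenspace_dim:
  assumes m: "mercer K lam \<phi>" and K: "kcont K" and mu: "0 < \<mu>"
  shows "L2_dim M (eigenspace K \<mu>) = card {n. lam n = \<mu>}"
  unfolding L2_dim_def
proof (rule cSup_eq_maximum)
  note c = mercerD(1)[OF m]
  let ?I = "{n. lam n = \<mu>}"
  have fin: "finite ?I"
    by (rule finite_subset[OF _ mercer_level_finite[OF m K, of "\<mu> / 2"]]) (use mu in auto)
  obtain h where h: "bij_betw h {0..<card ?I} ?I" using ex_bij_betw_nat_finite[OF fin] by blast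
  have hI: "lam (h i) = \<mu>" if "i < card ?I" for i using h that unfolding bij_betw_def by auto
  have inj: "h i = h j \<longleftrightarrow> i = j" if "i < card ?I" "j < card ?I" for i j
    using h that unfolding bij_betw_def by (auto dest: inj_onD)
  let ?e = "\<lambda>i x. complex_of_real (\<phi> (h i) x)"
  have mem: "?e i \<in> eigenspace K \<mu>" if i: "i < card ?I" for i
    unfolding eigenspace_def L2_def
  proof (intro CollectI conjI)
    show "?e i \<in> borel_measurable M" by (intro cont_of_real_measurable c continuous_on_mult_left)
    show "integrable M (\<lambda>x. (cmod (?e i x))\<^sup>2)"
      unfolding norm_of_real power2_abs by (intro cont_integrable continuous_on_power c)
    show "AE x in M. (LINT y|M. of_real (K x y) * ?e i y) = of_real \<mu> * ?e i x"
    proof (rule AE_I2)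
      fix x
      have "(LINT y|M. complex_of_real (K x y) * ?e i y) = (LINT y|M. complex_of_real (K x y * \<phi> (h i) y))" by simp
      also have "\<dots> = of_real (kop K (\<phi> (h i)) x)"
        unfolding kop_def by (rule integral_of_real) (intro cont_integrable continuous_on_mult kernel_row K c)
      finally show "(LINT y|M. of_real (K x y) * ?e i y) = of_real \<mu> * ?e i x"
        using mercerD(3)[OF m, of "h i" x] hI[OF i] by simp
    qed
  qed
  have indep: "L2_independent M (card ?I) ?e"
    unfolding L2_independent_def
  proof (intro allI impI)
    fix d i assume d: "AE x in M. (\<Sum>i<card ?I. d i * ?e i x) = 0" and i: "i < card ?I"
    have pp: "(LINT x|M. of_real (\<phi> (h j) x * \<phi> (h i) x)) = (if j = i then 1 else 0 :: complex)" if j: "j < card ?I" for j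
    proof -
      have "(LINT x|M. of_real (\<phi> (h j) x * \<phi> (h i) x)) = complex_of_real (ip (\<phi> (h j)) (\<phi> (h i)))"
        unfolding ip_def by (rule integral_of_real) (intro cont_integrable continuous_on_mult c)
      then show ?thesis using mercerD(4)[OF m, of "h j" "h i"] hI[OF i] hI[OF j] inj[OF j i] mu by simp
    qed
    have "0 = (LINT x|M. (\<Sum>j<card ?I. d j * ?e j x) * ?e i x)"
    proof -
      have "(LINT x|M. (\<Sum>j<card ?I. d j * ?e j x) * ?e i x) = (LINT x|M. 0)"
      proof (rule integral_cong_AE)
        show "AE x in M. (\<Sum>j<card ?I. d j * ?e j x) * ?e i x = 0" using d by eventually_elim simp
      qed (intro borel_measurable_times borel_measurable_sum borel_measurable_const cont_of_real_measurable c continuous_on_mult_left)+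
      then show ?thesis by simp
    qed
    also have "\<dots> = (LINT x|M. (\<Sum>j<card ?I. d j * of_real (\<phi> (h j) x * \<phi> (h i) x)))"
      by (simp add: sum_distrib_right mult.assoc)
    also have "\<dots> = (\<Sum>j<card ?I. LINT x|M. d j * of_real (\<phi> (h j) x * \<phi> (h i) x))"
      by (rule Bochner_Integration.integral_sum)
         (intro integrable_mult_right integrable_of_real cont_integrable continuous_on_mult c)
    also have "\<dots> = (\<Sum>j<card ?I. d j * (if j = i then 1 else 0))"
      by (intro sum.cong refl) (subst integral_mult_right_zero, subst pp, auto)
    also have "\<dots> = (\<Sum>j\<in>{..<card ?I}. if j = i then d j else 0)" by (intro sum.cong refl) simp
    also have "\<dots> = d i" using i unfolding sum.delta[OF finite_lessThan] by simp
    finally show "d i = 0" by simp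
  qed
  show "card ?I \<in> {k. \<exists>\<phi>. (\<forall>i<k. \<phi> i \<in> eigenspace K \<mu>) \<and> L2_independent M k \<phi>}"
    by (intro CollectI exI[of _ ?e] conjI allI impI indep mem)
  fix k assume "k \<in> {k. \<exists>\<phi>. (\<forall>i<k. \<phi> i \<in> eigenspace K \<mu>) \<and> L2_independent M k \<phi>}"
  then obtain g where g: "\<And>i. i < k \<Longrightarrow> g i \<in> eigenspace K \<mu>" and ind: "L2_independent M k g" by blast
  show "k \<le> card ?I"
  proof (rule ccontr)
    assume "\<not> k \<le> card ?I"
    then have "card ?I < k" by simp
    define q where "q i n = (LINT y|M. of_real (\<phi> n y) * g i y)" for i n
    obtain d where d: "\<exists>i<k. d i \<noteq> 0" "\<And>n. n \<in> ?I \<Longrightarrow> (\<Sum>i<k. d i * q i n) = 0"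
      using nontrivial_relation[OF fin \<open>card ?I < k\<close>, of q] by blast
    have "AE x in M. \<forall>i\<in>{..<k}. g i x = (\<Sum>n\<in>?I. q i n * of_real (\<phi> n x))"
      by (rule AE_finite_allI) (use eigenfunction_expansion[OF m K mu g] in \<open>auto simp: q_def\<close>)
    then have "AE x in M. (\<Sum>i<k. d i * g i x) = 0"
    proof eventually_elim
      case (elim x)
      have "(\<Sum>i<k. d i * g i x) = (\<Sum>i<k. \<Sum>n\<in>?I. d i * q i n * of_real (\<phi> n x))"
        by (intro sum.cong refl) (use elim in \<open>simp add: sum_distrib_left mult.assoc\<close>)
      also have "\<dots> = (\<Sum>n\<in>?I. (\<Sum>i<k. d i * q i n) * of_real (\<phi> n x))"
        by (subst sum.swap) (simp add: sum_distrib_right)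
      also have "\<dots> = 0" using d(2) by (intro sum.neutral) auto
      finally show ?case .
    qed
    with ind have "\<forall>i<k. d i = 0" unfolding L2_independent_def by blast
    with d(1) show False by blast
  qed
qed

end

lemma interval_measure_affine:
  fixes F :: "real \<Rightarrow> real"
  assumes l: "0 < l"
  shows "(LINT x|interval_measure_on 0 l. F (2 * x / l - 1)) = (l / 2) * (LINT u|interval_measure_on (-1) 1. F u)"
proof -
  have "(LINT u|interval_measure_on (-1) 1. F u) = (LINT u|lborel. indicator {-1<..<1} u *\<^sub>R F u)"
    unfolding integral_interval_measure set_lebesgue_integral_def ..
  also have "\<dots> = \<bar>2 / l\<bar> *\<^sub>R (LINT x|lborel. indicator {-1<..<1} (-1 + 2 / l * x) *\<^sub>R F (-1 + 2 / l * x))"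
    by (rule lborel_integral_real_affine) (use l in simp)
  also have "(\<lambda>x. indicator {-1<..<1} (-1 + 2 / l * x) *\<^sub>R F (-1 + 2 / l * x)) = (\<lambda>x. indicator {0<..<l} x *\<^sub>R F (2 * x / l - 1))"
  proof
    fix x
    have "-1 < -1 + 2 / l * x \<longleftrightarrow> 0 < x" using l by (simp add: zero_less_mult_iff zero_less_divide_iff)
    moreover have "-1 + 2 / l * x < 1 \<longleftrightarrow> x < l" using l by (simp add: field_simps)
    moreover have "-1 + 2 / l * x = 2 * x / l - 1" by simp
    ultimately show "indicator {-1<..<1} (-1 + 2 / l * x) *\<^sub>R F (-1 + 2 / l * x) = indicator {0<..<l} x *\<^sub>R F (2 * x / l - 1)"
      by (auto simp: indicator_def)
  qed
  also have "(LINT x|lborel. indicator {0<..<l} x *\<^sub>R F (2 * x / l - 1)) = (LINT x|interval_measure_on 0 l. F (2 * x / l - 1))"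
    unfolding integral_interval_measure set_lebesgue_integral_def ..
  finally show ?thesis using l by (simp add: field_simps)
qed

lemma sine_kernel_nsinc:
  assumes l: "0 < l"
  shows "nsinc (x - y) = (2 / l) * sine_kernel (pi * l / 2) (2 * x / l - 1) (2 * y / l - 1)"
proof (cases "x = y")
  case False
  have D: "(2 * x / l - 1) - (2 * y / l - 1) = 2 * (x - y) / l" by (simp add: diff_divide_distrib right_diff_distrib)
  have ne: "2 * x / l - 1 \<noteq> 2 * y / l - 1" using False l by simp
  have 1: "pi * l / 2 * (2 * (x - y) / l) = pi * (x - y)" using l by simp
  have 2: "2 / l * (A / (pi * (2 * d / l))) = A / (pi * d)" for A d using l by simp
  have "sine_kernel (pi * l / 2) (2 * x / l - 1) (2 * y / l - 1) = sin (pi * (x - y)) / (pi * (2 * (x - y) / l))"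
    using ne unfolding sine_kernel_def D 1 by (simp only: if_False)
  moreover have "nsinc (x - y) = sin (pi * (x - y)) / (pi * (x - y))"
    using False by (simp add: nsinc_def)
  ultimately show ?thesis by (simp only: 2)
qed (use l in \<open>simp add: nsinc_def sine_kernel_def\<close>)

text \<open>The affine map of \<open>(0, l)\<close> onto \<open>(-1, 1)\<close> carries the kernel of \<open>S_op\<close> to the sine kernel with
\<open>s = \<pi> l / 2\<close>; the factor \<open>sqrt (2 / l)\<close> preserves the norm.\<close>

lemma mercer_rescale:
  assumes l: "0 < l" and m: "std.mercer (sine_kernel (pi * l / 2)) lam \<phi>"
  shows "real_interval.mercer 0 l (\<lambda>x y. nsinc (x - y)) lam (\<lambda>n x. sqrt (2 / l) * \<phi> n (2 * x / l - 1))"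
    "continuous_on UNIV (\<lambda>p. nsinc (fst p - snd p))"
proof -
  interpret J: real_interval 0 l by unfold_locales (rule l)
  let ?s = "pi * l / 2"
  let ?A = "\<lambda>x. 2 * x / l - 1"
  let ?\<psi> = "\<lambda>n x. sqrt (2 / l) * \<phi> n (?A x)"
  note sk = sine_kernel_nsinc[OF l]
  have s0: "0 \<le> ?s" using l by simp
  have r2: "sqrt (2 / l) * sqrt (2 / l) = 2 / l" using l by simp
  have Ac: "continuous_on UNIV ?A" using l by (auto intro!: continuous_intros)
  have AI: "?A x \<in> {-1..1}" if "x \<in> {0..l}" for x using that l by (simp add: field_simps)
  show "J.mercer (\<lambda>x y. nsinc (x - y)) lam ?\<psi>"
    unfolding J.mercer_def
  proof (intro conjI allI ballI impI)
    show "continuous_on UNIV (?\<psi> n)" for n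
      by (intro continuous_on_mult_left continuous_on_compose2[OF std.mercerD(1)[OF m] Ac]) simp
    show "0 \<le> lam n" for n by (rule std.mercerD(2)[OF m])
    show "J.kop (\<lambda>x y. nsinc (x - y)) (?\<psi> n) x = lam n * ?\<psi> n x" for n x
    proof -
      have "J.kop (\<lambda>x y. nsinc (x - y)) (?\<psi> n) x
        = (LINT y|interval_measure_on 0 l. (2 / l * sqrt (2 / l)) * (sine_kernel ?s (?A x) (?A y) * \<phi> n (?A y)))"
        unfolding J.kop_def sk by (simp only: mult_ac)
      also have "\<dots> = (2 / l * sqrt (2 / l)) * (LINT y|interval_measure_on 0 l. sine_kernel ?s (?A x) (?A y) * \<phi> n (?A y))"
        by (rule integral_mult_right_zero)
      also have "(LINT y|interval_measure_on 0 l. sine_kernel ?s (?A x) (?A y) * \<phi> n (?A y))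
         = (l / 2) * std.kop (sine_kernel ?s) (\<phi> n) (?A x)"
        unfolding std.kop_def by (rule interval_measure_affine[OF l, of "\<lambda>u. sine_kernel ?s (?A x) u * \<phi> n u"])
      also have "std.kop (sine_kernel ?s) (\<phi> n) (?A x) = lam n * \<phi> n (?A x)" by (rule std.mercerD(3)[OF m])
      finally show ?thesis using l by simp
    qed
    show "J.ip (?\<psi> i) (?\<psi> j) = (if i = j then 1 else 0)" if "lam i \<noteq> 0" "lam j \<noteq> 0" for i j
    proof -
      have "J.ip (?\<psi> i) (?\<psi> j) = (LINT y|interval_measure_on 0 l. (sqrt (2 / l) * sqrt (2 / l)) * (\<phi> i (?A y) * \<phi> j (?A y)))"
        unfolding J.ip_def by (simp only: mult_ac)
      also have "\<dots> = (2 / l) * (LINT y|interval_measure_on 0 l. \<phi> i (?A y) * \<phi> j (?A y))"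
        unfolding r2 by (rule integral_mult_right_zero)
      also have "(LINT y|interval_measure_on 0 l. \<phi> i (?A y) * \<phi> j (?A y)) = (l / 2) * std.ip (\<phi> i) (\<phi> j)"
        unfolding std.ip_def by (rule interval_measure_affine[OF l, of "\<lambda>u. \<phi> i u * \<phi> j u"])
      finally show ?thesis using std.mercerD(4)[OF m that] l by simp
    qed
    show "(\<Sum>k<N. lam k * (?\<psi> k x)\<^sup>2) \<le> nsinc (x - x)" if "x \<in> {0..l}" for N x
    proof -
      have "(\<Sum>k<N. lam k * (?\<psi> k x)\<^sup>2) = (2 / l) * (\<Sum>k<N. lam k * (\<phi> k (?A x))\<^sup>2)"
        using l by (simp add: power_mult_distrib sum_distrib_left mult_ac)
      also have "\<dots> \<le> nsinc (x - x)"
        unfolding sk[of x x] by (rule mult_left_mono[OF std.mercerD(5)[OF m AI[OF that]]]) (use l in simp)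
      finally show ?thesis .
    qed
    show "(\<lambda>k. lam k * ?\<psi> k x * ?\<psi> k y) sums nsinc (x - y)" if "x \<in> {0..l}" "y \<in> {0..l}" for x y
    proof -
      have "lam k * ?\<psi> k x * ?\<psi> k y = (sqrt (2 / l) * sqrt (2 / l)) * (lam k * \<phi> k (?A x) * \<phi> k (?A y))" for k
        by (simp only: mult_ac)
      then have "lam k * ?\<psi> k x * ?\<psi> k y = (2 / l) * (lam k * \<phi> k (?A x) * \<phi> k (?A y))" for k
        unfolding r2 .
      then show ?thesis
        unfolding sk[of x y] using sums_mult[OF std.mercerD(6)[OF m AI[OF that(1)] AI[OF that(2)]], of "2 / l"] by (simp only:)
    qed
  qed
  show "continuous_on UNIV (\<lambda>p. nsinc (fst p - snd p))"
    unfolding sk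
    by (intro continuous_on_mult_left kernel_compose[OF sine_kernel_continuous[OF s0]] cont_fst cont_snd Ac)
qed

lemma S_eigenspace_eq:
  assumes l: "0 < l"
  shows "S_eigenspace l \<mu> = real_interval.eigenspace 0 l (\<lambda>x y. nsinc (x - y)) \<mu>"
proof -
  interpret J: real_interval 0 l by unfold_locales (rule l)
  have "S_op l f x = (LINT y|interval_measure_on 0 l. of_real (nsinc (x - y)) * f y)"
    if x: "x \<in> {0<..<l}" for f x
  proof -
    have "S_op l f x = (LINT y|lborel. of_real (nsinc (x - y)) * P_op l f y)"
      using x by (simp add: S_op_def P_op_def Q_op_def)
    also have "\<dots> = (LINT y|lborel. indicator {0<..<l} y *\<^sub>R (of_real (nsinc (x - y)) * f y))"
      by (intro Bochner_Integration.integral_cong refl) (simp add: P_op_def indicator_def)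
    also have "\<dots> = (LINT y|interval_measure_on 0 l. of_real (nsinc (x - y)) * f y)"
      unfolding integral_interval_measure set_lebesgue_integral_def ..
    finally show ?thesis .
  qed
  then have "(AE x in interval_measure_on 0 l. S_op l f x = of_real \<mu> * f x) \<longleftrightarrow>
     (AE x in interval_measure_on 0 l. (LINT y|interval_measure_on 0 l. of_real (nsinc (x - y)) * f y) = of_real \<mu> * f x)" for f
    by (intro AE_cong) simp
  then show ?thesis unfolding S_eigenspace_def J.eigenspace_def by simp
qed

text \<open>The distance of \<open>I\<close> from \<open>0\<close> makes the set of eigenvalues in \<open>I\<close> finite, without which the sum
defining the count would be \<open>0\<close> by convention.\<close>

theorem S_count_eq:
  assumes l: "0 < l" and m: "std.mercer (sine_kernel (pi * l / 2)) lam \<phi>"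
    and e: "0 < e" and I: "I \<subseteq> {e<..}"
  shows "finite {n. lam n \<in> I}" and "S_count l I = card {n. lam n \<in> I}"
proof -
  interpret J: real_interval 0 l by unfold_locales (rule l)
  note mr = mercer_rescale[OF l m]
  show fin: "finite {n. lam n \<in> I}"
    by (rule finite_subset[OF _ J.mercer_level_finite[OF mr e]]) (use I in auto)
  have mult: "S_multiplicity l \<mu> = card {n. lam n = \<mu>}" if "\<mu> \<in> I" for \<mu>
    unfolding S_multiplicity_def S_eigenspace_eq[OF l]
    by (rule J.eigenspace_dim[OF mr]) (use that I e in auto)
  have fin1: "finite {n. lam n = \<mu>}" if "\<mu> \<in> I" for \<mu>
    by (rule finite_subset[OF _ fin]) (use that in auto)
  have idx: "{\<mu>. \<mu> \<in> I \<and> S_multiplicity l \<mu> > 0} = lam ` {n. lam n \<in> I}"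
    using mult fin1 by (auto simp: card_gt_0_iff image_iff)
  have "S_count l I = (\<Sum>\<mu>\<in>lam ` {n. lam n \<in> I}. card {n. lam n = \<mu>})"
    unfolding S_count_def idx by (intro sum.cong refl) (auto simp: mult)
  also have "\<dots> = (\<Sum>\<mu>\<in>lam ` {n. lam n \<in> I}. \<Sum>n\<in>{n \<in> {n. lam n \<in> I}. lam n = \<mu>}. 1)"
  proof (rule sum.cong[OF refl])
    fix \<mu> assume "\<mu> \<in> lam ` {n. lam n \<in> I}"
    then have "{n \<in> {n. lam n \<in> I}. lam n = \<mu>} = {n. lam n = \<mu>}" by auto
    then show "card {n. lam n = \<mu>} = (\<Sum>n\<in>{n \<in> {n. lam n \<in> I}. lam n = \<mu>}. 1)" by simp
  qed
  also have "\<dots> = (\<Sum>n\<in>{n. lam n \<in> I}. 1)" by (rule sum.image_gen[OF fin, symmetric])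
  finally show "S_count l I = card {n. lam n \<in> I}" by simp
qed

section \<open>Counting in the plunge\<close>

lemma pair_param_surj:
  assumes "0 < t"
  obtains v where "pair_param v = t"
proof -
  have "cosh (arcosh (1 + t / 2)) = 1 + t / 2" by (rule cosh_arcosh_real) (use assms in simp)
  then have "pair_param (arcosh (1 + t / 2)) = t" by (simp add: pair_param_def cosh_def)
  then show ?thesis by (rule that)
qed

text \<open>Each determinant is a limit of nonnegative products and hence nonnegative. The product of the two is the
exponential of a convergent series, so neither is \<open>0\<close> and the logarithm may be split.\<close>

lemma log_det_pair:
  assumes s: "0 \<le> s" and m: "std.mercer (sine_kernel s) lam \<phi>"
  shows "ln (fredholm_det (-1) 1 (sine_kernel s) (1 - exp v)) + ln (fredholm_det (-1) 1 (sine_kernel s) (1 - exp (- v)))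
     = (\<Sum>n. ln (1 + pair_param v * (lam n * (1 - lam n))))"
proof -
  let ?D = "fredholm_det (-1) 1 (sine_kernel s)"
  let ?t = "pair_param v"
  define h where "h n = lam n * (1 - lam n)" for n
  note K = sine_kernel_continuous[OF s]
  have lam: "0 \<le> lam n" "lam n \<le> 1" for n
    using std.mercerD(2)[OF m] sine_kernel_eigenvalue_le_1[OF s m] by auto
  have h0: "0 \<le> h n" "h n \<le> lam n" for n
    using lam[of n] by (auto simp: h_def mult_left_le)
  have th: "0 \<le> ?t * h n" for n by (rule mult_nonneg_nonneg[OF pair_param_nonneg h0(1)])
  have lims: "(\<lambda>N. \<Prod>k<N. 1 - \<sigma> * lam k) \<longlonglongrightarrow> ?D \<sigma>" for \<sigma>
    by (rule std.mercer_fredholm_det(1)[OF m K])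
  have sum_lam: "summable lam" by (rule std.mercer_fredholm_det(2)[OF m K])
  have summ: "summable (\<lambda>n. ln (1 + ?t * h n))"
  proof (rule summable_comparison_test'[OF summable_mult[OF sum_lam, of ?t]])
    fix n :: nat
    have "ln (1 + ?t * h n) \<le> ?t * h n" by (rule ln_add_one_self_le_self[OF th])
    also have "\<dots> \<le> ?t * lam n" by (rule mult_left_mono[OF h0(2) pair_param_nonneg])
    finally show "norm (ln (1 + ?t * h n)) \<le> ?t * lam n" using th[of n] by simp
  qed
  let ?S = "\<Sum>n. ln (1 + ?t * h n)"
  have "(\<lambda>N. (\<Prod>k<N. 1 - (1 - exp v) * lam k) * (\<Prod>k<N. 1 - (1 - exp (- v)) * lam k)) \<longlonglongrightarrow> ?D (1 - exp v) * ?D (1 - exp (- v))"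
    by (intro tendsto_mult lims)
  moreover have "(\<Prod>k<N. 1 - (1 - exp v) * lam k) * (\<Prod>k<N. 1 - (1 - exp (- v)) * lam k) = exp (\<Sum>k<N. ln (1 + ?t * h k))" for N
  proof -
    have "(\<Prod>k<N. 1 - (1 - exp v) * lam k) * (\<Prod>k<N. 1 - (1 - exp (- v)) * lam k) = (\<Prod>k<N. 1 + ?t * h k)"
      unfolding prod.distrib[symmetric] pair_factorisation h_def ..
    also have "\<dots> = (\<Prod>k<N. exp (ln (1 + ?t * h k)))"
    proof (rule prod.cong[OF refl])
      fix k
      have "0 < 1 + ?t * h k" using th[of k] by linarith
      then show "1 + ?t * h k = exp (ln (1 + ?t * h k))" by simp
    qed
    finally show ?thesis by (simp add: exp_sum)
  qed
  moreover have "(\<lambda>N. exp (\<Sum>k<N. ln (1 + ?t * h k))) \<longlonglongrightarrow> exp ?S"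
    by (intro tendsto_exp summable_LIMSEQ summ)
  ultimately have prod: "?D (1 - exp v) * ?D (1 - exp (- v)) = exp ?S"
    using LIMSEQ_unique by (simp only:) blast
  have nonneg: "0 \<le> ?D (1 - exp w)" for w
  proof (rule LIMSEQ_le_const[OF lims], intro exI allI impI prod_nonneg ballI)
    fix k
    have "1 - (1 - exp w) * lam k = (1 - lam k) + exp w * lam k" by (simp add: algebra_simps)
    also have "\<dots> \<ge> 0" using lam[of k] by (intro add_nonneg_nonneg mult_nonneg_nonneg) auto
    finally show "0 \<le> 1 - (1 - exp w) * lam k" .
  qed
  have "?D (1 - exp v) \<noteq> 0" "?D (1 - exp (- v)) \<noteq> 0" using prod by auto
  then have "0 < ?D (1 - exp v)" "0 < ?D (1 - exp (- v))" using nonneg[of v] nonneg[of "- v"] by auto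
  then have "ln (?D (1 - exp v) * ?D (1 - exp (- v))) = ln (?D (1 - exp v)) + ln (?D (1 - exp (- v)))"
    by (simp add: ln_mult)
  then show ?thesis unfolding prod h_def by simp
qed

text \<open>In the sum of the two asymptotic expansions the linear terms \<open>\<plusminus> 2 s v / \<pi>\<close> cancel. The real part of
the Barnes term does not depend on \<open>s\<close>, so it disappears on division by \<open>ln s\<close>.\<close>

lemma log_det_pair_limit:
  assumes bw: "\<And>\<Sigma> :: real set. compact \<Sigma> \<Longrightarrow> \<Sigma> \<subseteq> {..<1} \<Longrightarrow>
       \<exists>C :: real. \<forall>\<^sub>F s :: real in at_top. \<forall>\<sigma>\<in>\<Sigma>.
         cmod (of_real (ln (fredholm_det (-1) 1 (sine_kernel s) \<sigma>)) - bw_main s \<sigma>) \<le> C * (ln s / s)"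
  shows "((\<lambda>s. (ln (fredholm_det (-1) 1 (sine_kernel s) (1 - exp v)) +
            ln (fredholm_det (-1) 1 (sine_kernel s) (1 - exp (- v)))) / ln s) \<longlongrightarrow> v\<^sup>2 / pi\<^sup>2) at_top"
proof -
  let ?D = "\<lambda>s. fredholm_det (-1) 1 (sine_kernel s)"
  define \<kappa> where "\<kappa> \<sigma> = Re (2 * Ln (Barnes_G (1 + \<i> * of_real (bw_z \<sigma>)) * Barnes_G (1 - \<i> * of_real (bw_z \<sigma>))))" for \<sigma>
  define \<kappa>2 where "\<kappa>2 = \<kappa> (1 - exp v) + \<kappa> (1 - exp (- v))"
  have main: "Re (bw_main s (1 - exp w)) = 2 * s / pi * w + w\<^sup>2 / (2 * pi\<^sup>2) * ln (4 * s) + \<kappa> (1 - exp w)" for s w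
    unfolding bw_main_def \<kappa>_def by simp
  obtain C where C: "\<forall>\<^sub>F s in at_top. \<forall>\<sigma>\<in>{1 - exp v, 1 - exp (- v)}.
         cmod (of_real (ln (?D s \<sigma>)) - bw_main s \<sigma>) \<le> C * (ln s / s)"
    using bw[of "{1 - exp v, 1 - exp (- v)}"] by auto
  define E where "E s = ln (?D s (1 - exp v)) + ln (?D s (1 - exp (- v))) - (v\<^sup>2 / pi\<^sup>2 * ln (4 * s) + \<kappa>2)" for s
  have E_bound: "\<forall>\<^sub>F s in at_top. \<bar>E s / ln s\<bar> \<le> 2 * C / s"
    using C eventually_gt_at_top[of 1]
  proof eventually_elim
    case (elim s)
    have b: "\<bar>ln (?D s (1 - exp w)) - Re (bw_main s (1 - exp w))\<bar> \<le> C * (ln s / s)" if "w = v \<or> w = - v" for w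
    proof -
      have "\<bar>Re (of_real (ln (?D s (1 - exp w))) - bw_main s (1 - exp w))\<bar> \<le> cmod (of_real (ln (?D s (1 - exp w))) - bw_main s (1 - exp w))"
        by (rule abs_Re_le_cmod)
      also have "\<dots> \<le> C * (ln s / s)" using elim(1) that by auto
      finally show ?thesis by simp
    qed
    have "E s = (ln (?D s (1 - exp v)) - Re (bw_main s (1 - exp v))) + (ln (?D s (1 - exp (- v))) - Re (bw_main s (1 - exp (- v))))"
    proof -
      define Y where "Y = v\<^sup>2 / pi\<^sup>2 * ln (4 * s)"
      have "Re (bw_main s (1 - exp v)) = 2 * s / pi * v + Y / 2 + \<kappa> (1 - exp v)"
        "Re (bw_main s (1 - exp (- v))) = - (2 * s / pi * v) + Y / 2 + \<kappa> (1 - exp (- v))"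
        unfolding main Y_def by simp_all
      then show ?thesis unfolding E_def \<kappa>2_def Y_def[symmetric] by simp
    qed
    then have "\<bar>E s\<bar> \<le> C * (ln s / s) + C * (ln s / s)" using b[of v] b[of "- v"] by linarith
    also have "\<dots> = 2 * C / s * ln s" by simp
    finally have "\<bar>E s\<bar> \<le> 2 * C / s * ln s" .
    moreover have "0 < ln s" using elim(2) by simp
    ultimately show ?case by (simp add: pos_divide_le_eq)
  qed
  have "((\<lambda>s. 2 * C / s) \<longlongrightarrow> 0) at_top" by real_asymp
  then have E0: "((\<lambda>s. E s / ln s) \<longlongrightarrow> 0) at_top"
    by (rule Lim_null_comparison[OF E_bound[folded real_norm_def]])
  have "((\<lambda>s. (v\<^sup>2 / pi\<^sup>2 * ln (4 * s) + \<kappa>2) / ln s) \<longlongrightarrow> v\<^sup>2 / pi\<^sup>2) at_top"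
  proof -
    have "((\<lambda>s::real. v\<^sup>2 / pi\<^sup>2 * (ln (4 * s) / ln s) + \<kappa>2 * (1 / ln s)) \<longlongrightarrow> v\<^sup>2 / pi\<^sup>2 * 1 + \<kappa>2 * 0) at_top"
    proof (intro tendsto_add tendsto_mult tendsto_const)
      show "((\<lambda>s::real. ln (4 * s) / ln s) \<longlongrightarrow> 1) at_top" by real_asymp
      show "((\<lambda>s::real. 1 / ln s) \<longlongrightarrow> 0) at_top" by real_asymp
    qed
    then show ?thesis by (simp add: add_divide_distrib)
  qed
  from tendsto_add[OF E0 this] show ?thesis
    unfolding add_divide_distrib[symmetric] E_def by (simp only: diff_add_cancel add_0)
qed

lemma parabola_window:
  fixes x p q :: real
  assumes "0 \<le> x" "x \<le> 1" "p < q" "q \<le> 1 / 2" "p * (1 - p) < x * (1 - x)" "x * (1 - x) < q * (1 - q)"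
  shows "x \<in> {p<..<q} \<union> {1 - q<..<1 - p}"
proof -
  have 1: "0 < (x - p) * (1 - x - p)" using assms(5) by (simp add: algebra_simps)
  have 2: "0 < (q - x) * (1 - x - q)" using assms(6) by (simp add: algebra_simps)
  show ?thesis
    using 1 2 assms(3,4) by (auto simp: zero_less_mult_iff)
qed

lemma exp_neg_lt_half:
  fixes u :: real
  assumes "ln 2 < u"
  shows "exp (- u) < (1 / 2 :: real)"
proof -
  have "exp (- u) < exp (- ln (2::real))" using assms by simp
  then show ?thesis by (simp add: exp_minus)
qed

lemma W_ge_card:
  assumes l: "0 < l" and m: "std.mercer (sine_kernel (pi * l / 2)) lam \<phi>" and u: "ln 2 < u"
    and pq: "exp (- 2 * u) \<le> p" "p < q" "q \<le> exp (- u)"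
  shows "card {n. p * (1 - p) < lam n * (1 - lam n) \<and> lam n * (1 - lam n) < q * (1 - q)} \<le> W0 u l + W1 u l"
proof -
  let ?p = "exp (- 2 * u)" and ?q = "exp (- u)"
  have s0: "0 \<le> pi * l / 2" using l by simp
  have qh: "?q < 1 / 2" by (rule exp_neg_lt_half[OF u])
  have p0: "0 < ?p" by simp
  let ?A = "{n. lam n \<in> {?p<..<?q}}" and ?B = "{n. lam n \<in> {1 - ?q<..<1 - ?p}}"
  have "{?p<..<?q} \<subseteq> {?p<..}" "{1 - ?q<..<1 - ?p} \<subseteq> {1 / 2<..}" using qh by auto
  then have A: "finite ?A" "W0 u l = card ?A" and B: "finite ?B" "W1 u l = card ?B"
    unfolding W0_def W1_def
    using S_count_eq[OF l m p0, of "{?p<..<?q}"] S_count_eq[OF l m, of "1 / 2" "{1 - ?q<..<1 - ?p}"] by simp_all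
  have "{n. p * (1 - p) < lam n * (1 - lam n) \<and> lam n * (1 - lam n) < q * (1 - q)} \<subseteq> ?A \<union> ?B"
  proof
    fix n assume n: "n \<in> {n. p * (1 - p) < lam n * (1 - lam n) \<and> lam n * (1 - lam n) < q * (1 - q)}"
    have lam: "0 \<le> lam n" "lam n \<le> 1"
      using std.mercerD(2)[OF m] sine_kernel_eigenvalue_le_1[OF s0 m] by auto
    have "lam n \<in> {p<..<q} \<union> {1 - q<..<1 - p}"
      by (rule parabola_window[OF lam pq(2)]) (use n pq(3) qh in auto)
    then show "n \<in> ?A \<union> ?B" using pq by auto
  qed
  then have "card {n. p * (1 - p) < lam n * (1 - lam n) \<and> lam n * (1 - lam n) < q * (1 - q)} \<le> card (?A \<union> ?B)"
    by (rule card_mono[OF finite_UnI[OF A(1) B(1)]])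
  also have "\<dots> \<le> card ?A + card ?B" by (rule card_Un_le)
  finally show ?thesis using A(2) B(2) by simp
qed

lemma logit_difference:
  fixes u :: real
  assumes "0 < u"
  shows "ln (exp (- u) / (1 - exp (- u))) - ln (exp (- 2 * u) / (1 - exp (- 2 * u))) = u + ln (1 + exp (- u))"
proof -
  define e where "e = exp (- u)"
  have e: "0 < e" "e < 1" using assms by (auto simp: e_def)
  have e2: "exp (- 2 * u) = e * e" by (simp add: e_def mult_exp_exp)
  have "1 - e * e = (1 - e) * (1 + e)" by (simp add: algebra_simps)
  then have "ln (e / (1 - e)) - ln (e * e / (1 - e * e)) = (ln e - ln (1 - e)) - (ln e + ln e - (ln (1 - e) + ln (1 + e)))"
    using e by (simp add: ln_div ln_mult)
  also have "\<dots> = u + ln (1 + e)" by (simp add: e_def)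
  finally show ?thesis unfolding e2 by (simp add: e_def)
qed

text \<open>At \<open>p' = e\<^sup>-\<^sup>2\<^sup>u\<close>, \<open>q' = e\<^sup>-\<^sup>u\<close> with \<open>u = u0\<close> the difference of logits is \<open>u + ln (1 + e\<^sup>-\<^sup>u)\<close>. By continuity the
bound survives when both endpoints are moved inwards by a small \<open>\<eta>\<close> in the exponent, and half of that
room is kept so that the window stays inside those of all \<open>u\<close> close to \<open>u0\<close>.\<close>

lemma W_lower_bound_near:
  assumes bw: "\<And>\<Sigma> :: real set. compact \<Sigma> \<Longrightarrow> \<Sigma> \<subseteq> {..<1} \<Longrightarrow>
       \<exists>C :: real. \<forall>\<^sub>F s :: real in at_top. \<forall>\<sigma>\<in>\<Sigma>.
         cmod (of_real (ln (fredholm_det (-1) 1 (sine_kernel s) \<sigma>)) - bw_main s \<sigma>) \<le> C * (ln s / s)"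
    and u0: "ln 2 < u0" and c0: "0 \<le> c" and c: "c < 2 / pi\<^sup>2 * (u0 + ln (1 + exp (- u0)))"
  shows "\<exists>\<delta>>0. \<forall>\<^sub>F l in at_top. \<forall>u. ln 2 < u \<and> \<bar>u - u0\<bar> < \<delta> \<longrightarrow> c * ln l \<le> real (W0 u l + W1 u l)"
proof -
  have u0pos: "0 < u0" using u0 ln_gt_zero[of "2::real"] by linarith
  have "\<exists>lam \<phi>. 0 \<le> s \<longrightarrow> std.mercer (sine_kernel s) lam \<phi>" for s
    using std.mercer_expansion[OF sine_kernel_psd[of s]] by blast
  then obtain Lam Phi where m: "\<And>s. 0 \<le> s \<Longrightarrow> std.mercer (sine_kernel s) (Lam s) (Phi s)" by metis
  define H where "H s n = (if 0 \<le> s then Lam s n * (1 - Lam s n) else 0)" for s and n :: nat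
  have lam: "0 \<le> Lam s n" "Lam s n \<le> 1" if "0 \<le> s" for s n
    using std.mercerD(2)[OF m[OF that]] sine_kernel_eigenvalue_le_1[OF that m[OF that]] by auto
  interpret plunge_density H ln
  proof
    show "0 \<le> H s n" for s n using lam[of s n] by (simp add: H_def)
    show "H s n \<le> 1 / 4" for s n
      using zero_le_power2[of "Lam s n - 1 / 2"] by (simp add: H_def power2_eq_square algebra_simps)
    show "summable (H s)" for s
    proof (cases "0 \<le> s")
      case True
      show ?thesis
      proof (rule summable_comparison_test'[OF std.mercer_fredholm_det(2)[OF m[OF True] sine_kernel_continuous[OF True]]])
        fix n :: nat
        show "norm (H s n) \<le> Lam s n" using lam[OF True, of n] True by (simp add: H_def abs_mult mult_left_le)
      qed
    qed (simp add: H_def[abs_def])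
    show "\<forall>\<^sub>F s in at_top. 0 < ln (s :: real)"
      using eventually_gt_at_top[of "1::real"] by eventually_elim simp
    fix t :: real assume "0 < t"
    then obtain v where v: "pair_param v = t" by (rule pair_param_surj)
    have "((\<lambda>s. (ln (fredholm_det (-1) 1 (sine_kernel s) (1 - exp v)) +
            ln (fredholm_det (-1) 1 (sine_kernel s) (1 - exp (- v)))) / ln s) \<longlongrightarrow> v\<^sup>2 / pi\<^sup>2) at_top"
      by (rule log_det_pair_limit[OF bw])
    moreover have "\<forall>\<^sub>F s in at_top. (ln (fredholm_det (-1) 1 (sine_kernel s) (1 - exp v)) +
            ln (fredholm_det (-1) 1 (sine_kernel s) (1 - exp (- v)))) / ln s = (\<Sum>n. ln (1 + t * H s n)) / ln s"
      using eventually_ge_at_top[of 0]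
    proof eventually_elim
      case (elim s)
      show ?case unfolding log_det_pair[OF elim m[OF elim]] v using elim by (simp add: H_def)
    qed
    ultimately have "((\<lambda>s. (\<Sum>n. ln (1 + t * H s n)) / ln s) \<longlongrightarrow> v\<^sup>2 / pi\<^sup>2) at_top"
      by (rule Lim_transform_eventually)
    then show "((\<lambda>s. (\<Sum>n. ln (1 + t * H s n)) / ln s) \<longlongrightarrow> (1 / pi\<^sup>2) * integral {0..1} (\<lambda>x. log_quot t (x * (1 - x)))) at_top"
      unfolding v[symmetric] integral_log_quot by simp
  qed
  define D where "D \<eta> = 2 / pi\<^sup>2 * (ln (exp (- u0 - \<eta>) / (1 - exp (- u0 - \<eta>))) - ln (exp (- 2 * u0 + \<eta>) / (1 - exp (- 2 * u0 + \<eta>))))" for \<eta>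
  have "isCont D 0"
    unfolding D_def using u0pos by (intro continuous_intros) auto
  moreover have "D 0 = 2 / pi\<^sup>2 * (u0 + ln (1 + exp (- u0)))"
    unfolding D_def using logit_difference[OF u0pos] by simp
  ultimately have "(D \<longlongrightarrow> 2 / pi\<^sup>2 * (u0 + ln (1 + exp (- u0)))) (at_right 0)"
    unfolding isCont_def by (metis filterlim_at_split)
  then have "\<forall>\<^sub>F \<eta> in at_right 0. c < D \<eta>" by (rule order_tendstoD(1)) (rule c)
  moreover have "\<forall>\<^sub>F \<eta> in at_right 0. \<eta> \<in> {0<..<u0 / 2}" by (rule eventually_at_right_real) (use u0pos in simp)
  ultimately have "\<forall>\<^sub>F \<eta> in at_right 0. c < D \<eta> \<and> \<eta> \<in> {0<..<u0 / 2}" by (rule eventually_conj)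
  then obtain \<eta> where \<eta>: "c < D \<eta>" "0 < \<eta>" "\<eta> < u0 / 2"
    using eventually_happens'[of "at_right (0::real)"] trivial_limit_at_right_real by auto
  define p p' q' q where pq: "p = exp (- 2 * u0 + \<eta> / 2)" "p' = exp (- 2 * u0 + \<eta>)" "q' = exp (- u0 - \<eta>)" "q = exp (- u0 - \<eta> / 2)"
  have ord: "0 < p" "p < p'" "p' \<le> q'" "q' < q" using \<eta> by (auto simp: pq)
  have "q \<le> exp (- u0)" using \<eta> by (simp add: pq)
  then have qh: "q \<le> 1 / 2" using exp_neg_lt_half[OF u0] by linarith
  have "\<forall>\<^sub>F s in at_top. c * ln s \<le> real (card {n. p * (1 - p) < H s n \<and> H s n < q * (1 - q)})"
    by (rule plunge_count[OF ord qh]) (use \<eta>(1) in \<open>simp only: D_def pq\<close>)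
  moreover have "filterlim (\<lambda>l::real. pi * l / 2) at_top at_top"
    by real_asymp
  ultimately have "\<forall>\<^sub>F l in at_top. c * ln (pi * l / 2) \<le> real (card {n. p * (1 - p) < H (pi * l / 2) n \<and> H (pi * l / 2) n < q * (1 - q)})"
    by (rule eventually_compose_filterlim)
  then have "\<forall>\<^sub>F l in at_top. \<forall>u. ln 2 < u \<and> \<bar>u - u0\<bar> < \<eta> / 4 \<longrightarrow> c * ln l \<le> real (W0 u l + W1 u l)"
    using eventually_gt_at_top[of 0]
  proof eventually_elim
    case (elim l)
    let ?s = "pi * l / 2"
    have s0: "0 \<le> ?s" using elim by simp
    \<comment> \<open>\<open>s = \<pi> l / 2\<close> exceeds \<open>l\<close>, so \<open>ln s\<close> may be replaced by \<open>ln l\<close>\<close>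
    have "l \<le> ?s" using elim pi_ge_two by (simp add: mult_right_mono)
    then have "c * ln l \<le> c * ln ?s" using elim c0 by (intro mult_left_mono) auto
    also note elim(1)
    finally have cl: "c * ln l \<le> real (card {n. p * (1 - p) < Lam ?s n * (1 - Lam ?s n) \<and> Lam ?s n * (1 - Lam ?s n) < q * (1 - q)})"
      using s0 by (simp add: H_def)
    show ?case
    proof (intro allI impI)
      fix u assume u: "ln 2 < u \<and> \<bar>u - u0\<bar> < \<eta> / 4"
      have "- 2 * u \<le> - 2 * u0 + \<eta> / 2" "- u0 - \<eta> / 2 \<le> - u" using u \<eta>(2) by linarith+
      then have "exp (- 2 * u) \<le> p" "q \<le> exp (- u)" by (simp_all add: pq)
      moreover have "p < q" using ord by linarith
      ultimately have "card {n. p * (1 - p) < Lam ?s n * (1 - Lam ?s n) \<and> Lam ?s n * (1 - Lam ?s n) < q * (1 - q)} \<le> W0 u l + W1 u l"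
        using u elim by (intro W_ge_card[OF _ m[OF s0]]) auto
      then show "c * ln l \<le> real (W0 u l + W1 u l)" using cl by linarith
    qed
  qed
  moreover have "0 < \<eta> / 4" using \<eta> by simp
  ultimately show ?thesis by blast
qed

theorem proposition6p10:
  assumes basor_widom:
    "\<And>\<Sigma> :: real set. compact \<Sigma> \<Longrightarrow> \<Sigma> \<subseteq> {..<1} \<Longrightarrow>
       \<exists>C :: real. \<forall>\<^sub>F s :: real in at_top. \<forall>\<sigma>\<in>\<Sigma>.
         cmod (of_real (ln (fredholm_det (-1) 1 (sine_kernel s) \<sigma>)) - bw_main s \<sigma>)
           \<le> C * (ln s / s)"
  shows
    "(\<forall>u :: real. u > ln 2 \<longrightarrow>
        (let a = exp (- 2 * u) * (1 - exp (- 2 * u)); b = exp (- u) * (1 - exp (- u))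
         in 0 < a \<and> a < b \<and> b < 1 / 4) \<and>
        (\<forall>c1 :: real. 0 < c1 \<and> c1 < 2 / pi\<^sup>2 * (u + ln (1 + exp (- u))) \<longrightarrow>
           (\<exists>C1 :: real. \<forall>l :: real. l \<ge> 1 \<longrightarrow>
              real (W0 u l + W1 u l) \<ge> c1 * ln l - C1))) \<and>
     (\<forall>J :: real set. compact J \<and> J \<subseteq> {ln 2<..} \<longrightarrow>
        (\<forall>\<^sub>F l :: real in at_top. \<forall>u\<in>J.
           real (W0 u l + W1 u l) / ln l / (2 * u) \<ge> 1 / pi\<^sup>2))"
proof -
  have near: "\<exists>\<delta>>0. \<forall>\<^sub>F l in at_top. \<forall>u. ln 2 < u \<and> \<bar>u - u0\<bar> < \<delta> \<longrightarrow> c * ln l \<le> real (W0 u l + W1 u l)"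
    if "ln 2 < u0" "0 \<le> c" "c < 2 / pi\<^sup>2 * (u0 + ln (1 + exp (- u0)))" for u0 c :: real
    by (rule W_lower_bound_near[OF basor_widom that])
  show ?thesis
  proof (intro conjI allI impI)
    fix u :: real assume u: "ln 2 < u"
    have u0: "0 < u" using u ln_gt_zero[of "2::real"] by linarith
    have qh: "exp (- u) < 1 / 2" by (rule exp_neg_lt_half[OF u])
    have p: "exp (- 2 * u) < exp (- u)" using u0 by simp
    have "exp (- 2 * u) * (1 - exp (- 2 * u)) < exp (- u) * (1 - exp (- u))"
      by (rule parabola_strict_mono[OF p]) (use qh in simp)
    moreover have "exp (- u) * (1 - exp (- u)) < 1 / 2 * (1 - 1 / 2)"
      by (rule parabola_strict_mono[OF qh]) simp
    moreover have "0 < exp (- 2 * u) * (1 - exp (- 2 * u))" using u0 by simp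
    ultimately show "let a = exp (- 2 * u) * (1 - exp (- 2 * u)); b = exp (- u) * (1 - exp (- u))
           in 0 < a \<and> a < b \<and> b < 1 / 4"
      by (simp add: Let_def)
  next
    fix u c1 :: real
    assume u: "ln 2 < u" and c1: "0 < c1 \<and> c1 < 2 / pi\<^sup>2 * (u + ln (1 + exp (- u)))"
    obtain \<delta> where \<delta>: "0 < \<delta>" "\<forall>\<^sub>F l in at_top. \<forall>u'. ln 2 < u' \<and> \<bar>u' - u\<bar> < \<delta> \<longrightarrow> c1 * ln l \<le> real (W0 u' l + W1 u' l)"
      using near[OF u, of c1] c1 by auto
    have "\<forall>\<^sub>F l in at_top. c1 * ln l \<le> real (W0 u l + W1 u l)"
      using \<delta>(2) by eventually_elim (use u \<delta>(1) in auto)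
    then obtain l0 where l0: "\<And>l. l \<ge> l0 \<Longrightarrow> c1 * ln l \<le> real (W0 u l + W1 u l)"
      unfolding eventually_at_top_linorder by blast
    have "c1 * ln l - c1 * ln (max l0 1) \<le> real (W0 u l + W1 u l)" if l: "l \<ge> 1" for l
    proof (cases "l \<ge> l0")
      case True
      have "0 \<le> c1 * ln (max l0 1)" using c1 by simp
      then show ?thesis using l0[OF True] by linarith
    next
      case False
      then have "ln l \<le> ln (max l0 1)" using l by simp
      then have "c1 * ln l \<le> c1 * ln (max l0 1)" using c1 by (intro mult_left_mono) auto
      then show ?thesis using of_nat_0_le_iff[of "W0 u l + W1 u l"] by linarith
    qed
    then show "\<exists>C1. \<forall>l\<ge>1. c1 * ln l - C1 \<le> real (W0 u l + W1 u l)" by blast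
  next
    fix J :: "real set"
    assume J: "compact J \<and> J \<subseteq> {ln 2<..}"
    have nbhd: "\<exists>r>0. \<forall>\<^sub>F l in at_top. \<forall>u\<in>ball u0 r \<inter> J. 1 / pi\<^sup>2 \<le> real (W0 u l + W1 u l) / ln l / (2 * u)"
      if u0: "u0 \<in> J" for u0
    proof -
      have ug: "ln 2 < u0" using J u0 by auto
      have up: "0 < u0" using ug ln_gt_zero[of "2::real"] by linarith
      define g where "g = ln (1 + exp (- u0))"
      have g: "0 < g" unfolding g_def using exp_gt_zero[of "- u0"] by (intro ln_gt_zero) linarith
      \<comment> \<open>the term \<open>ln (1 + e\<^sup>-\<^sup>u)\<close> is the room that allows \<open>u\<close> to vary around \<open>u0\<close>\<close>
      obtain h where h: "0 < h" "h < g" using dense[OF g] by blast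
      define c where "c = 2 / pi\<^sup>2 * (u0 + h)"
      have "c < 2 / pi\<^sup>2 * (u0 + g)" unfolding c_def using h by (intro mult_strict_left_mono) auto
      moreover have "0 \<le> c" unfolding c_def using up h by simp
      ultimately obtain \<delta> where \<delta>: "0 < \<delta>" "\<forall>\<^sub>F l in at_top. \<forall>u. ln 2 < u \<and> \<bar>u - u0\<bar> < \<delta> \<longrightarrow> c * ln l \<le> real (W0 u l + W1 u l)"
        using near[OF ug, of c] unfolding g_def by blast
      let ?r = "min \<delta> h"
      have "\<forall>\<^sub>F l in at_top. \<forall>u\<in>ball u0 ?r \<inter> J. 1 / pi\<^sup>2 \<le> real (W0 u l + W1 u l) / ln l / (2 * u)"
        using \<delta>(2) eventually_gt_at_top[of 1]
      proof eventually_elim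
        case (elim l)
        show ?case
        proof
          fix u assume u: "u \<in> ball u0 ?r \<inter> J"
          have "\<bar>u0 - u\<bar> < \<delta>" "\<bar>u0 - u\<bar> < h" using u by (simp_all add: dist_real_def)
          then have d: "\<bar>u - u0\<bar> < \<delta>" "u \<le> u0 + h" by linarith+
          have u2: "ln 2 < u" using u J by auto
          have upos: "0 < u" using u2 ln_gt_zero[of "2::real"] by linarith
          have lpos: "0 < ln l" using elim(2) by simp
          have "2 / pi\<^sup>2 * u \<le> c" unfolding c_def using d(2) by (intro mult_left_mono) auto
          then have "2 / pi\<^sup>2 * u * ln l \<le> c * ln l" using lpos by (intro mult_right_mono) auto
          also have "\<dots> \<le> real (W0 u l + W1 u l)" using elim(1) d(1) u2 by blast
          finally have le: "1 / pi\<^sup>2 * (2 * u) * ln l \<le> real (W0 u l + W1 u l)" by simp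
          then have "1 / pi\<^sup>2 * (2 * u) \<le> real (W0 u l + W1 u l) / ln l"
            unfolding pos_le_divide_eq[OF lpos] .
          then show "1 / pi\<^sup>2 \<le> real (W0 u l + W1 u l) / ln l / (2 * u)"
            using upos by (subst pos_le_divide_eq) auto
        qed
      qed
      moreover have "0 < ?r" using \<delta>(1) h by simp
      ultimately show ?thesis by blast
    qed
    then have "\<forall>u0\<in>J. \<exists>r>0. \<forall>\<^sub>F l in at_top. \<forall>u\<in>ball u0 r \<inter> J. 1 / pi\<^sup>2 \<le> real (W0 u l + W1 u l) / ln l / (2 * u)"
      by (rule ballI)
    from bchoice[OF this] obtain r where "\<forall>u0\<in>J. 0 < r u0 \<and>
        (\<forall>\<^sub>F l in at_top. \<forall>u\<in>ball u0 (r u0) \<inter> J. 1 / pi\<^sup>2 \<le> real (W0 u l + W1 u l) / ln l / (2 * u))"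
      by (rule exE)
    then have r: "0 < r u0"
      "\<forall>\<^sub>F l in at_top. \<forall>u\<in>ball u0 (r u0) \<inter> J. 1 / pi\<^sup>2 \<le> real (W0 u l + W1 u l) / ln l / (2 * u)"
      if "u0 \<in> J" for u0 using that by simp_all
    obtain T where T: "T \<subseteq> J" "finite T" "J \<subseteq> (\<Union>u0\<in>T. ball u0 (r u0))"
    proof (rule compactE_image[of J J "\<lambda>u0. ball u0 (r u0)"])
      show "J \<subseteq> (\<Union>u0\<in>J. ball u0 (r u0))" using r(1) by force
    qed (use J in auto)
    have "\<forall>\<^sub>F l in at_top. \<forall>u0\<in>T. \<forall>u\<in>ball u0 (r u0) \<inter> J. 1 / pi\<^sup>2 \<le> real (W0 u l + W1 u l) / ln l / (2 * u)"
      by (rule eventually_ball_finite[OF T(2)]) (use r(2) T(1) in blast)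
    then show "\<forall>\<^sub>F l in at_top. \<forall>u\<in>J. 1 / pi\<^sup>2 \<le> real (W0 u l + W1 u l) / ln l / (2 * u)"
      by eventually_elim (use T(3) in blast)
  qed
qed

end
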